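(* Let $v$ be the fixed point with $z_1(v)=0$ in the $\gimel$-orbit of a $1$-singular point, let $\mathcal D_v$ be the universal ring of $v$, let $\mathcal B_v$ be the set of local distributions $D^1_\sigma,D^2_{\sigma'}$ defined in the context, and let $S$ be the complex vector space spanned by $\mathcal B_v$. Then $S$ is a $\mathfrak{gl}_n(\mathbb C)$-module, where $X\in\mathfrak{gl}_n(\mathbb C)$ acts on $D\in S$ by $X\cdot D=D\circ\Phi(X)$. Explicitly, the action is given by the following formula: every $D\in S$ can be written as $D=ev_v\circ A$ with $A\in\mathcal D_v$, and if $A\circ\Phi(X)=\sum_i h_i\sigma_i\in\mathcal D_v$ (finite sum, the $\sigma_i\in\gimel$ distinct), then $$X\cdot D=ev_v\circ\Big(\sum_i h_i\sigma_i\Big)=\sum_i g_i(v)\,D^2_{\sigma_i}+\sum_i\frac{\partial g_i}{\partial z_1}(v)\,D^1_{\sigma_i},\qquad g_i=z_1h_i .$$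
   Context: Tableaux and groups. Let $n\ge 2$ and let $V\simeq\mathbb C^{n(n+1)/2}$ be the complex manifold of tableaux $x=(x_{ki})_{1\le i\le k\le n}$ of complex numbers. Let $\gimel\simeq\mathbb Z^{n(n-1)/2}$ be the free abelian group generated by $\sigma_{st}$, $1\le t\le s\le n-1$, acting on $V$ by letting $\sigma_{st}$ add $1$ to the coordinate $x_{st}$ and fix all other coordinates. Let $G=S_1\times\cdots\times S_n$ (product of symmetric groups) act on $V$ by $(s(x))_{ki}=x_{k\,s_k(i)}$. Let $\mathcal M,\mathcal O$ be the sheaves of meromorphic and holomorphic functions on $V$. For a function $f$, $s\in G$, $\sigma\in\gimel$ put $\sigma(f)=f\circ\sigma^{-1}$, $s(f)=f\circ s^{-1}$, $s(\sigma)=s\circ\sigma\circ s^{-1}\in\gimel$. The ring $\mathcal R$. $\mathcal R$ is the set of finite formal sums $\sum_i f_i\sigma_i$ with $f_i$ meromorphic on $V$ and $\sigma_i\in\gimel$ (the free module over meromorphic functions with basis $\gimel$), with the skew group ring multiplication $(\sum_i f_i\sigma_i)\circ(\sum_j f'_j\sigma'_j)=\sum_{i,j}f_i\,\sigma_i(f'_j)\,\sigma_i\circ\sigma'_j$. A second multiplication is $A*B:=B\circ A$. $G$ acts on $\mathcal R$ by $s(\sum f_i\sigma_i)=\sum s(f_i)s(\sigma_i)$. The point $v$. A point $x^0\in V$ is $1$-singular if there are a row $k$ and indices $i\neq j$ such that $x^0_{ki}-x^0_{kj}\in\mathbb Z$ and $x^0_{rs}-x^0_{rt}\notin\mathbb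 Z$ for all $r$ and $s\ne t$ with $(r,\{s,t\})\neq(k,\{i,j\})$. Fix such $x^0$ and $k,i,j$. Put $z_1=x_{ki}-x_{kj}$, $z_2=x_{ki}+x_{kj}$, and let $z_3,z_4,\dots$ be the remaining coordinates $x_{st}$; $(z_1,z_2,\dots)$ are coordinates on $V$. Fix a point $v\in\gimel(x^0)$ with $z_1(v)=0$. Let $\tau\in G$ be the element with $\tau(z_1)=-z_1$, $\tau(z_l)=z_l$ for $l>1$ (the transposition of $i,j$ in row $k$). The stabilizer of $v$ in $G$ is $G_v=\{\mathrm{id},\tau\}$. Fix a sufficiently small open neighborhood $W$ of the orbit $\gimel(v)$, invariant under $\gimel$ and $\tau$; sufficiently small means in particular that the functions $x_{rs}-x_{rt}$, $s\ne t$, $(r,\{s,t\})\ne(k,\{i,j\})$, have no zeros in $W$. Elements of $\mathcal R$ are considered restricted to $W$. $\mathcal R^{G_v}$ denotes the $G_v$-invariants in $\mathcal R$, and $H^0(W,\mathcal O^{G_v})$ the $\tau$-invariant holomorphic functions on $W$. The universal ring. $\mathcal D_v\subset\mathcal R^{G_v}$ is the subring generated by all elements of $\mathcal R^{G_v}$ of the form $\sum_i (H_i/z_1)\sigma_i$ (finite sum) with $H_i$ holomorphic in $W$. For every $\sum_i h_i\sigma_i\in\mathcal D_v$ the functions $z_1h_i$ are holomorphic at $v$. $\mathcal D_v$ acts on $H^0(W,\mathcal O^{G_v})$ by $(f\sigma)(F)=f\cdot(F\circ\sigma^{-1})$ extended additively. For a linear functional $D$ on $H^0(W,\mathcal O^{G_v})$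 and $A\in\mathcal D_v$, $D\circ A$ is the functional $F\mapsto D(A(F))$. $ev_v$ is evaluation at $v$. The distributions. For $\sigma,\sigma'\in\gimel$ with $\tau(\sigma')\neq\sigma'$ define functionals on $H^0(W,\mathcal O^{G_v})$: $D^1_\sigma=\frac12\,ev_v\circ(\sigma+\tau(\sigma))$, $D^2_{\sigma'}=ev_v\circ\frac{\sigma'-\tau(\sigma')}{2z_1}$; by convention $D^2_{\sigma}=0$ if $\tau(\sigma)=\sigma$. Let $\Delta$ be the set of $\sigma\in\gimel$ which act on the pair of coordinates $(x_{ki},x_{kj})$ by $(x_{ki},x_{kj})\mapsto(x_{ki}+m_1,x_{kj}+m_2)$ with $m_1\le m_2$. Put $\mathcal B_v=\{D^1_\sigma,D^2_{\sigma'}\mid\sigma,\sigma'\in\Delta,\ \tau(\sigma')\ne\sigma'\}$ and let $S\subset H^0(W,\mathcal O^{G_v})^*$ be its linear span. The homomorphism $\Phi$. It is known (Futorny–Ovsienko) that there is a ring homomorphism $\Phi:\mathcal U(\mathfrak{gl}_n(\mathbb C))\to(\mathcal R,* )$ given on the generators of $\mathfrak{gl}_n(\mathbb C)$ (matrix units $E_{st}$) by $$\Phi(E_{k,k+1})=-\sum_{i=1}^k\frac{\prod_{j=1}^{k+1}(x_{ki}-x_{k+1,j})}{\prod_{j\ne i,\,1\le j\le k}(x_{ki}-x_{kj})}\sigma_{ki}^{-1},\quad \Phi(E_{k+1,k})=\sum_{i=1}^k\frac{\prod_{j=1}^{k-1}(x_{ki}-x_{k-1,j})}{\prod_{j\ne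 i,\,1\le j\le k}(x_{ki}-x_{kj})}\sigma_{ki}\quad(1\le k\le n-1),$$ $$\Phi(E_{k,k})=\sum_{i=1}^k(x_{ki}+i-1)-\sum_{i=1}^{k-1}(x_{k-1,i}+i-1)\quad(1\le k\le n).$$ (In these formulas $k,i,j$ are running indices, not the fixed ones above.) *)

theory Defs
  imports "HOL-Analysis.Analysis" "HOL-Library.Poly_Mapping" "HOL-Library.Function_Algebras"
    "HOL-Combinatorics.Transposition"
begin

section \<open>Holomorphic and meromorphic functions of several complex variables\<close>

text \<open>Complex (Frechet) differentiability at every point; used for open \<open>U\<close> only.\<close>

definition holo_on :: "(complex ^ 'm::finite \<Rightarrow> complex) \<Rightarrow> (complex ^ 'm) set \<Rightarrow> bool"
    (infix "holo'_on" 50)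
  where "f holo_on U \<longleftrightarrow>
    (\<forall>x\<in>U. \<exists>f'. (f has_derivative f') (at x) \<and> (\<forall>c y. f' (c *s y) = c * f' y))"

text \<open>Equality on a dense open subset of the open set \<open>U\<close>.\<close>

definition agree_on :: "('a::topological_space) set \<Rightarrow> ('a \<Rightarrow> 'b) \<Rightarrow> ('a \<Rightarrow> 'b) \<Rightarrow> bool"
  where "agree_on U f g \<longleftrightarrow> (\<exists>D. open D \<and> D \<subseteq> U \<and> U \<subseteq> closure D \<and> (\<forall>x\<in>D. f x = g x))"

text \<open>A total function represents a meromorphic function if locally it is a quotient \<open>g / h\<close> of
  holomorphic functions, \<open>h\<close> being nonzero on a dense set; its values at zeros of \<open>h\<close> are
  irrelevant.\<close>

definition meromorphic :: "(complex ^ 'm::finite \<Rightarrow> complex) \<Rightarrow> bool"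
  where "meromorphic f \<longleftrightarrow>
    (\<forall>p. \<exists>U g h. open U \<and> p \<in> U \<and> g holo_on U \<and> h holo_on U \<and>
        U \<subseteq> closure {x\<in>U. h x \<noteq> 0} \<and> (\<forall>x\<in>U. h x \<noteq> 0 \<longrightarrow> f x = g x / h x))"

lemma agree_on_refl: "open U \<Longrightarrow> agree_on U f f"
  unfolding agree_on_def by (intro exI[of _ U]) (auto intro: closure_subset[THEN subsetD])

lemma agree_on_sym: "agree_on U f g \<Longrightarrow> agree_on U g f"
  unfolding agree_on_def by metis

lemma dense_Int:
  fixes D :: "'a::topological_space set"
  assumes "open D" "D \<subseteq> U" "U \<subseteq> closure D" "U \<subseteq> closure D'"
  shows "U \<subseteq> closure (D \<inter> D')"
proof
  fix x assume x: "x \<in> U"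
  show "x \<in> closure (D \<inter> D')"
    unfolding closure_iff_nhds_not_empty
  proof (intro allI impI)
    fix A V assume V: "V \<subseteq> A" "open V" "x \<in> V"
    then obtain y where y: "y \<in> V \<inter> D"
      using x assms(3) unfolding closure_iff_nhds_not_empty
      by (metis IntI disjoint_iff subsetD open_Int closure_iff_nhds_not_empty order_refl)
    then have "y \<in> closure D'" using assms by auto
    then have "(V \<inter> D) \<inter> D' \<noteq> {}"
      using y V assms(1) by (metis Int_commute closure_iff_nhds_not_empty open_Int order_refl)
    then show "D \<inter> D' \<inter> A \<noteq> {}" using V by auto
  qed
qed

lemma agree_on_binop:
  assumes "agree_on U f f'" "agree_on U g g'"
  shows "agree_on U (\<lambda>x. h (f x) (g x)) (\<lambda>x. h (f' x) (g' x))"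
proof -
  obtain D D' where D: "open D" "D \<subseteq> U" "U \<subseteq> closure D" "\<forall>x\<in>D. f x = f' x"
    "open D'" "D' \<subseteq> U" "U \<subseteq> closure D'" "\<forall>x\<in>D'. g x = g' x"
    using assms unfolding agree_on_def by auto
  show ?thesis unfolding agree_on_def
    by (rule exI[of _ "D \<inter> D'"]) (use D dense_Int[OF D(1-3) D(7)] in auto)
qed

lemma agree_on_trans:
  assumes "agree_on U f g" "agree_on U g h" shows "agree_on U f h"
proof -
  obtain D D' where D: "open D" "D \<subseteq> U" "U \<subseteq> closure D" "\<forall>x\<in>D. f x = g x"
    "open D'" "D' \<subseteq> U" "U \<subseteq> closure D'" "\<forall>x\<in>D'. g x = h x"
    using assms unfolding agree_on_def by auto
  show ?thesis unfolding agree_on_def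
    by (rule exI[of _ "D \<inter> D'"]) (use D dense_Int[OF D(1-3) D(7)] in auto)
qed

lemma agree_on_subset:
  assumes "agree_on U f g" "open V" "V \<subseteq> U" shows "agree_on V f g"
proof -
  obtain D where D: "open D" "D \<subseteq> U" "U \<subseteq> closure D" "\<forall>x\<in>D. f x = g x"
    using assms unfolding agree_on_def by auto
  have "V \<subseteq> closure (V \<inter> D)"
    using dense_Int[of V V D] assms(2,3) D(3) closure_subset[of V] by blast
  then show ?thesis unfolding agree_on_def
    by (intro exI[of _ "V \<inter> D"]) (use D assms in auto)
qed

lemma holo_on_const: "(\<lambda>x. c) holo_on U"
  unfolding holo_on_def by (intro ballI exI[of _ "\<lambda>x. 0"]) auto

lemma holo_on_subset: "f holo_on U \<Longrightarrow> V \<subseteq> U \<Longrightarrow> f holo_on V"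
  unfolding holo_on_def by auto

lemma holo_on_add:
  assumes "f holo_on U" "g holo_on U" shows "(\<lambda>x. f x + g x) holo_on U"
  unfolding holo_on_def
proof
  fix x assume "x \<in> U"
  then obtain f' g' where d: "(f has_derivative f') (at x)" "\<forall>c y. f' (c *s y) = c * f' y"
    "(g has_derivative g') (at x)" "\<forall>c y. g' (c *s y) = c * g' y"
    using assms unfolding holo_on_def by metis
  show "\<exists>f'. ((\<lambda>x. f x + g x) has_derivative f') (at x) \<and> (\<forall>c y. f' (c *s y) = c * f' y)"
    by (rule exI[of _ "\<lambda>y. f' y + g' y"])
      (use d in \<open>auto intro!: derivative_intros simp: algebra_simps\<close>)
qed

lemma holo_on_mult:
  assumes "f holo_on U" "g holo_on U" shows "(\<lambda>x. f x * g x) holo_on U"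
  unfolding holo_on_def
proof
  fix x assume "x \<in> U"
  then obtain f' g' where d: "(f has_derivative f') (at x)" "\<forall>c y. f' (c *s y) = c * f' y"
    "(g has_derivative g') (at x)" "\<forall>c y. g' (c *s y) = c * g' y"
    using assms unfolding holo_on_def by metis
  show "\<exists>f'. ((\<lambda>x. f x * g x) has_derivative f') (at x) \<and> (\<forall>c y. f' (c *s y) = c * f' y)"
    by (rule exI[of _ "\<lambda>y. f x * g' y + f' y * g x"])
      (use d has_derivative_mult[OF d(1,3)] in \<open>auto simp: algebra_simps\<close>)
qed

lemma holo_on_imp_open_nonzero:
  assumes "h holo_on U" "open U" shows "open {x\<in>U. h x \<noteq> 0}"
proof -
  have "continuous_on U h"
    using assms unfolding holo_on_def
    by (meson continuous_at_imp_continuous_on has_derivative_continuous)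
  then have "open (U \<inter> h -` (- {0}))"
    using assms(2) continuous_open_preimage by blast
  moreover have "U \<inter> h -` (- {0}) = {x\<in>U. h x \<noteq> 0}" by auto
  ultimately show ?thesis by simp
qed

lemma meromorphic_const: "meromorphic (\<lambda>x. c)"
  unfolding meromorphic_def
  by (intro allI exI[of _ UNIV] exI[of _ "\<lambda>_. c"] exI[of _ "\<lambda>_. 1"]) (auto intro: holo_on_const)

lemma meromorphic_binop:
  fixes f f' :: "complex ^ 'm::finite \<Rightarrow> complex"
  assumes "meromorphic f" "meromorphic f'"
    and G: "\<And>(U :: (complex ^ 'm) set) g h g' h'. g holo_on U \<Longrightarrow> h holo_on U \<Longrightarrow> g' holo_on U \<Longrightarrow> h' holo_on U \<Longrightarrow>
        (\<lambda>x. G (g x) (h x) (g' x) (h' x)) holo_on U"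
    and op: "\<And>a b c d. b \<noteq> 0 \<Longrightarrow> d \<noteq> 0 \<Longrightarrow> op (a / b) (c / d) = G a b c d / (b * d)"
  shows "meromorphic (\<lambda>x. op (f x) (f' x))"
  unfolding meromorphic_def
proof
  fix p
  obtain U g h where U: "open U" "p \<in> U" "g holo_on U" "h holo_on U"
    "U \<subseteq> closure {x\<in>U. h x \<noteq> 0}" "\<forall>x\<in>U. h x \<noteq> 0 \<longrightarrow> f x = g x / h x"
    using assms(1)[unfolded meromorphic_def] by meson
  obtain U' g' h' where U': "open U'" "p \<in> U'" "g' holo_on U'" "h' holo_on U'"
    "U' \<subseteq> closure {x\<in>U'. h' x \<noteq> 0}" "\<forall>x\<in>U'. h' x \<noteq> 0 \<longrightarrow> f' x = g' x / h' x"
    using assms(2)[unfolded meromorphic_def] by meson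
  let ?V = "U \<inter> U'"
  have V: "open ?V" using U U' by auto
  have hol: "g holo_on ?V" "h holo_on ?V" "g' holo_on ?V" "h' holo_on ?V"
    using U U' by (auto intro: holo_on_subset)
  have "?V \<subseteq> closure (?V \<inter> {x\<in>U. h x \<noteq> 0})"
    using dense_Int[of ?V ?V "{x\<in>U. h x \<noteq> 0}"] V U(5) closure_subset[of ?V] by blast
  moreover have "?V \<inter> {x\<in>U. h x \<noteq> 0} = {x\<in>?V. h x \<noteq> 0}" by auto
  ultimately have 1: "?V \<subseteq> closure {x\<in>?V. h x \<noteq> 0}" by simp
  have "?V \<subseteq> closure ({x\<in>?V. h x \<noteq> 0} \<inter> {x\<in>U'. h' x \<noteq> 0})"
    using dense_Int[of "{x\<in>?V. h x \<noteq> 0}" ?V "{x\<in>U'. h' x \<noteq> 0}"]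
      holo_on_imp_open_nonzero[OF hol(2) V] 1 U'(5) by blast
  moreover have "{x\<in>?V. h x \<noteq> 0} \<inter> {x\<in>U'. h' x \<noteq> 0} = {x\<in>?V. h x * h' x \<noteq> 0}" by auto
  ultimately have 2: "?V \<subseteq> closure {x\<in>?V. h x * h' x \<noteq> 0}" by simp
  show "\<exists>U g h. open U \<and> p \<in> U \<and> g holo_on U \<and> h holo_on U \<and> U \<subseteq> closure {x \<in> U. h x \<noteq> 0} \<and>
        (\<forall>x\<in>U. h x \<noteq> 0 \<longrightarrow> op (f x) (f' x) = g x / h x)"
    by (rule exI[of _ ?V], rule exI[of _ "\<lambda>x. G (g x) (h x) (g' x) (h' x)"],
        rule exI[of _ "\<lambda>x. h x * h' x"])
      (use V 2 U U' hol holo_on_mult[OF hol(2,4)] G[OF hol] in \<open>simp add: op\<close>)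
qed

lemma meromorphic_add: "meromorphic f \<Longrightarrow> meromorphic g \<Longrightarrow> meromorphic (\<lambda>x. f x + g x)"
  by (rule meromorphic_binop[where G = "\<lambda>a b c d. a * d + c * b"])
    (auto intro!: holo_on_mult holo_on_add simp: divide_simps)

lemma meromorphic_mult: "meromorphic f \<Longrightarrow> meromorphic g \<Longrightarrow> meromorphic (\<lambda>x. f x * g x)"
  by (rule meromorphic_binop[where G = "\<lambda>a b c d. a * c"])
    (auto intro!: holo_on_mult simp: divide_simps)

lemma meromorphic_uminus: "meromorphic f \<Longrightarrow> meromorphic (\<lambda>x. - f x)"
  using meromorphic_mult[OF meromorphic_const[of "-1"]] by simp

lemma meromorphic_diff: "meromorphic f \<Longrightarrow> meromorphic g \<Longrightarrow> meromorphic (\<lambda>x. f x - g x)"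
  using meromorphic_add[of f "\<lambda>x. - g x"] meromorphic_uminus[of g] by simp

definition mero_rel :: "(complex ^ 'm::finite \<Rightarrow> complex) \<Rightarrow> (complex ^ 'm \<Rightarrow> complex) \<Rightarrow> bool"
  where "mero_rel f g \<longleftrightarrow> meromorphic f \<and> meromorphic g \<and> agree_on UNIV f g"

lemma mero_rel_eqI: "f = g \<Longrightarrow> meromorphic f \<Longrightarrow> mero_rel f g"
  by (simp add: mero_rel_def agree_on_refl)

quotient_type 'm mero = "complex ^ 'm::finite \<Rightarrow> complex" / partial: mero_rel
proof (rule part_equivpI)
  show "\<exists>x. mero_rel x (x :: complex ^ 'm \<Rightarrow> complex)"
    by (rule exI[of _ "\<lambda>_. 0"]) (rule mero_rel_eqI[OF refl meromorphic_const])
  show "symp (mero_rel :: (complex ^ 'm \<Rightarrow> complex) \<Rightarrow> _)"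
    by (rule sympI) (simp add: mero_rel_def agree_on_sym)
  show "transp (mero_rel :: (complex ^ 'm \<Rightarrow> complex) \<Rightarrow> _)"
    by (rule transpI) (auto simp: mero_rel_def elim: agree_on_trans)
qed

instantiation mero :: (finite) comm_ring_1
begin

lift_definition zero_mero :: "'a mero" is "\<lambda>x. 0"
  by (simp add: mero_rel_def meromorphic_const agree_on_refl)
lift_definition one_mero :: "'a mero" is "\<lambda>x. 1"
  by (simp add: mero_rel_def meromorphic_const agree_on_refl)
lift_definition plus_mero :: "'a mero \<Rightarrow> 'a mero \<Rightarrow> 'a mero" is "\<lambda>f g x. f x + g x"
  by (auto simp: mero_rel_def intro: meromorphic_add agree_on_binop[where h = "(+)"])
lift_definition times_mero :: "'a mero \<Rightarrow> 'a mero \<Rightarrow> 'a mero" is "\<lambda>f g x. f x * g x"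
  by (auto simp: mero_rel_def intro: meromorphic_mult agree_on_binop[where h = "(*)"])
lift_definition minus_mero :: "'a mero \<Rightarrow> 'a mero \<Rightarrow> 'a mero" is "\<lambda>f g x. f x - g x"
  by (auto simp: mero_rel_def intro: meromorphic_diff agree_on_binop[where h = "(-)"])
lift_definition uminus_mero :: "'a mero \<Rightarrow> 'a mero" is "\<lambda>f x. - f x"
  by (auto simp: mero_rel_def intro: meromorphic_uminus agree_on_binop[where h = "\<lambda>a b. - a"])

instance
proof
  show "(0 :: 'a mero) \<noteq> 1"
    by transfer (auto simp: mero_rel_def agree_on_def)
qed (transfer, rule mero_rel_eqI, (simp add: fun_eq_iff algebra_simps; fail),
    (simp add: mero_rel_def meromorphic_const meromorphic_add meromorphic_mult meromorphic_diff
        meromorphic_uminus; fail))+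

end

text \<open>The class of \<open>f\<close>; only used when \<open>f\<close> satisfies \<^const>\<open>meromorphic\<close>.\<close>

definition mero_of :: "(complex ^ 'm::finite \<Rightarrow> complex) \<Rightarrow> 'm mero"
  where "mero_of f = abs_mero f"

text \<open>The value at \<open>p\<close> of the holomorphic extension of \<open>f\<close> to a neighbourhood of \<open>p\<close>; it is \<open>0\<close>
  when there is no such extension.\<close>

definition hol_value :: "(complex ^ 'm::finite \<Rightarrow> complex) \<Rightarrow> complex ^ 'm \<Rightarrow> complex"
  where "hol_value f p =
    (if \<exists>U g. open U \<and> p \<in> U \<and> g holo_on U \<and> agree_on U f g
     then THE c. \<exists>U g. open U \<and> p \<in> U \<and> g holo_on U \<and> agree_on U f g \<and> c = g p
     else 0)"

lift_definition mero_value :: "'m::finite mero \<Rightarrow> complex ^ 'm \<Rightarrow> complex" is hol_value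
proof
  fix f g :: "complex ^ 'm \<Rightarrow> complex" and p
  assume fg: "mero_rel f g"
  have "agree_on U f k \<longleftrightarrow> agree_on U g k" if "open U" for U k
    using fg that unfolding mero_rel_def
    by (meson agree_on_subset agree_on_sym agree_on_trans subset_UNIV)
  then show "hol_value f p = hol_value g p"
    unfolding hol_value_def by (simp cong: conj_cong)
qed


section \<open>Tableaux, shifts and row permutations\<close>

text \<open>Throughout, \<open>n = CARD('n)\<close>.\<close>

typedef (overloaded) ('n::finite) tab_index = "{(k::nat, i::nat). 1 \<le> i \<and> i \<le> k \<and> k \<le> CARD('n)}"
  by (rule exI[of _ "(1, 1)"]) (simp add: Suc_leI)

instance tab_index :: (finite) finite
proof
  have eq: "(UNIV :: 'a tab_index set) = Abs_tab_index ` {(k::nat, i::nat). 1 \<le> i \<and> i \<le> k \<and> k \<le> CARD('a)}"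
    by (rule type_definition.Abs_image[OF type_definition_tab_index, symmetric])
  have fin: "finite {(k::nat, i::nat). 1 \<le> i \<and> i \<le> k \<and> k \<le> CARD('a)}"
    by (rule finite_subset[of _ "{0..CARD('a)} \<times> {0..CARD('a)}"]) auto
  show "finite (UNIV :: 'a tab_index set)" unfolding eq using fin by (rule finite_imageI)
qed

definition row :: "'n::finite tab_index \<Rightarrow> nat" where "row a = fst (Rep_tab_index a)"
definition col :: "'n::finite tab_index \<Rightarrow> nat" where "col a = snd (Rep_tab_index a)"

definition idx :: "nat \<Rightarrow> nat \<Rightarrow> 'n::finite tab_index"
  where "idx k i = Abs_tab_index (k, i)"

lemma row_idx: "1 \<le> i \<Longrightarrow> i \<le> k \<Longrightarrow> k \<le> CARD('n) \<Longrightarrow> row (idx k i :: 'n::finite tab_index) = k"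
  and col_idx: "1 \<le> i \<Longrightarrow> i \<le> k \<Longrightarrow> k \<le> CARD('n) \<Longrightarrow> col (idx k i :: 'n::finite tab_index) = i"
  by (simp_all add: idx_def row_def col_def Abs_tab_index_inverse)

type_synonym 'n tab = "complex ^ 'n tab_index"

text \<open>A shift is determined by the integers it adds to the coordinates; those in row \<open>n\<close> vanish.
  The group is written additively.\<close>

typedef (overloaded) ('n::finite) gimel = "{m :: int ^ 'n tab_index. \<forall>a. row a = CARD('n) \<longrightarrow> m $ a = 0}"
  by (rule exI[of _ 0]) simp

setup_lifting type_definition_gimel

instantiation gimel :: (finite) ab_group_add
begin

lift_definition zero_gimel :: "'a gimel" is 0 by simp
lift_definition plus_gimel :: "'a gimel \<Rightarrow> 'a gimel \<Rightarrow> 'a gimel" is "(+)" by simp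
lift_definition minus_gimel :: "'a gimel \<Rightarrow> 'a gimel \<Rightarrow> 'a gimel" is "(-)" by simp
lift_definition uminus_gimel :: "'a gimel \<Rightarrow> 'a gimel" is uminus by simp

instance by standard (transfer; simp)+

end

lift_definition sigma :: "nat \<Rightarrow> nat \<Rightarrow> 'n::finite gimel"
  is "\<lambda>s t. \<chi> a. if row a = s \<and> col a = t \<and> s < CARD('n) then 1 else 0"
  by simp

definition shift_at :: "'n::finite gimel \<Rightarrow> 'n tab_index \<Rightarrow> int" where "shift_at \<sigma> a = Rep_gimel \<sigma> $ a"

definition shift_tab :: "'n::finite gimel \<Rightarrow> 'n tab \<Rightarrow> 'n tab"
  where "shift_tab \<sigma> x = (\<chi> a. x $ a + of_int (shift_at \<sigma> a))"

text \<open>A tuple of permutations \<open>(s\<^sub>1, \<dots>, s\<^sub>n)\<close> is encoded as the row-preserving permutation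
  \<open>(k, i) \<mapsto> (k, s\<^sub>k(i))\<close> of the index set.\<close>

typedef (overloaded) ('n::finite) row_perm =
  "{p :: 'n tab_index \<Rightarrow> 'n tab_index. bij p \<and> (\<forall>a. row (p a) = row a)}"
  by (rule exI[of _ id]) simp

setup_lifting type_definition_row_perm

lift_definition perm_tab :: "'n::finite row_perm \<Rightarrow> 'n tab \<Rightarrow> 'n tab" is "\<lambda>p x. \<chi> a. x $ p a" .

lift_definition perm_shift :: "'n::finite row_perm \<Rightarrow> 'n gimel \<Rightarrow> 'n gimel" is "\<lambda>p m. \<chi> a. m $ p a"
  by simp

lift_definition row_transp :: "'n::finite tab_index \<Rightarrow> 'n tab_index \<Rightarrow> 'n row_perm"
  is "\<lambda>a b. if row a = row b then Transposition.transpose a b else id"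
  by (auto simp: Transposition.transpose_def)

lemma shift_tab_add: "shift_tab (\<sigma> + \<rho>) x = shift_tab \<sigma> (shift_tab \<rho> x)"
  unfolding shift_tab_def vec_eq_iff by (simp add: shift_at_def plus_gimel.rep_eq)

lemma shift_tab_zero: "shift_tab 0 x = x"
  unfolding shift_tab_def vec_eq_iff by (simp add: shift_at_def zero_gimel.rep_eq)

lemma inv_shift_tab: "inv (shift_tab \<sigma>) = shift_tab (- \<sigma>)"
  by (rule inv_unique_comp) (simp_all add: fun_eq_iff shift_tab_add[symmetric] shift_tab_zero)

lemma bij_shift_tab: "bij (shift_tab \<sigma>)"
  by (rule o_bij[of "shift_tab (- \<sigma>)"]) (simp_all add: fun_eq_iff shift_tab_add[symmetric] shift_tab_zero)

lemma bij_perm_tab: "bij (perm_tab s)"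
proof (rule o_bij)
  let ?p = "Rep_row_perm s"
  have "bij ?p" using Rep_row_perm[of s] by simp
  then show "(\<lambda>x. \<chi> a. x $ inv ?p a) \<circ> perm_tab s = id" "perm_tab s \<circ> (\<lambda>x. \<chi> a. x $ inv ?p a) = id"
    by (simp_all add: fun_eq_iff vec_eq_iff perm_tab.rep_eq bij_is_inj bij_is_surj surj_f_inv_f)
qed

lemma inv_perm_tab: "inv (perm_tab s) = (\<lambda>x. \<chi> a. x $ inv (Rep_row_perm s) a)"
proof (rule inv_unique_comp)
  have "bij (Rep_row_perm s)" using Rep_row_perm[of s] by simp
  then show "perm_tab s \<circ> (\<lambda>x. \<chi> a. x $ inv (Rep_row_perm s) a) = id"
    "(\<lambda>x. \<chi> a. x $ inv (Rep_row_perm s) a) \<circ> perm_tab s = id"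
    by (simp_all add: fun_eq_iff vec_eq_iff perm_tab.rep_eq bij_is_inj bij_is_surj surj_f_inv_f)
qed

text \<open>\<^const>\<open>perm_shift\<close> is conjugation.\<close>

lemma shift_tab_perm_shift:
  "shift_tab (perm_shift s \<sigma>) = perm_tab s \<circ> shift_tab \<sigma> \<circ> inv (perm_tab s)"
proof -
  have "bij (Rep_row_perm s)" using Rep_row_perm[of s] by simp
  then show ?thesis
    unfolding inv_perm_tab
    by (simp add: fun_eq_iff vec_eq_iff shift_tab_def shift_at_def perm_shift.rep_eq
        perm_tab.rep_eq bij_is_inj)
qed

lemma agree_on_comp:
  fixes \<phi> :: "'a::topological_space \<Rightarrow> 'a"
  assumes "agree_on U f g" "\<And>x. \<phi> (\<psi> x) = x" "\<And>x. \<psi> (\<phi> x) = x"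
    "continuous_on UNIV \<phi>" "continuous_on UNIV \<psi>"
  shows "agree_on (\<phi> -` U) (\<lambda>x. f (\<phi> x)) (\<lambda>x. g (\<phi> x))"
proof -
  obtain D where D: "open D" "D \<subseteq> U" "U \<subseteq> closure D" "\<forall>x\<in>D. f x = g x"
    using assms(1) unfolding agree_on_def by auto
  have e: "\<phi> -` X = \<psi> ` X" for X
    using assms(2,3) by (auto simp: image_iff) metis
  have "\<psi> ` closure D \<subseteq> closure (\<psi> ` D)"
    using assms(5) by (intro image_closure_subset) (auto intro: continuous_on_subset closure_subset[THEN subsetD])
  then have "\<phi> -` U \<subseteq> closure (\<phi> -` D)"
    using D(3) unfolding e by blast
  moreover have "open (\<phi> -` D)" using assms(4) D(1) by (simp add: open_vimage)
  ultimately show ?thesis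
    unfolding agree_on_def by (intro exI[of _ "\<phi> -` D"]) (use D in auto)
qed

lemma holo_on_comp:
  assumes "f holo_on U" "\<And>x. (\<phi> has_derivative L) (at x)" "\<And>c y. L (c *s y) = c *s L y"
  shows "(\<lambda>x. f (\<phi> x)) holo_on (\<phi> -` U)"
  unfolding holo_on_def
proof
  fix x assume "x \<in> \<phi> -` U"
  then obtain f' where f': "(f has_derivative f') (at (\<phi> x))" "\<forall>c y. f' (c *s y) = c * f' y"
    using assms(1) unfolding holo_on_def by auto
  show "\<exists>f'. ((\<lambda>x. f (\<phi> x)) has_derivative f') (at x) \<and> (\<forall>c y. f' (c *s y) = c * f' y)"
    by (rule exI[of _ "\<lambda>y. f' (L y)"])
      (use f' assms(3) has_derivative_compose[OF assms(2) f'(1)] in auto)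
qed

lemma meromorphic_comp:
  fixes \<phi> :: "complex ^ 'm::finite \<Rightarrow> complex ^ 'm"
  assumes "meromorphic f" "\<And>x. \<phi> (\<psi> x) = x" "\<And>x. \<psi> (\<phi> x) = x"
    "continuous_on UNIV \<psi>" "\<And>x. (\<phi> has_derivative L) (at x)" "\<And>c y. L (c *s y) = c *s L y"
  shows "meromorphic (\<lambda>x. f (\<phi> x))"
  unfolding meromorphic_def
proof
  fix p
  have c: "continuous_on UNIV \<phi>"
    by (meson assms(5) continuous_at_imp_continuous_on has_derivative_continuous)
  obtain U g h where U: "open U" "\<phi> p \<in> U" "g holo_on U" "h holo_on U"
    "U \<subseteq> closure {x\<in>U. h x \<noteq> 0}" "\<forall>x\<in>U. h x \<noteq> 0 \<longrightarrow> f x = g x / h x"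
    using assms(1)[unfolded meromorphic_def] by meson
  have e: "\<phi> -` X = \<psi> ` X" for X
    using assms(2,3) by (auto simp: image_iff) metis
  have "\<psi> ` closure {x\<in>U. h x \<noteq> 0} \<subseteq> closure (\<psi> ` {x\<in>U. h x \<noteq> 0})"
    using assms(4) by (intro image_closure_subset) (auto intro: continuous_on_subset closure_subset[THEN subsetD])
  then have "\<phi> -` U \<subseteq> closure (\<phi> -` {x\<in>U. h x \<noteq> 0})"
    using U(5) unfolding e by blast
  moreover have "\<phi> -` {x\<in>U. h x \<noteq> 0} = {x \<in> \<phi> -` U. h (\<phi> x) \<noteq> 0}" by auto
  ultimately have "\<phi> -` U \<subseteq> closure {x \<in> \<phi> -` U. h (\<phi> x) \<noteq> 0}" by simp
  then show "\<exists>U g h. open U \<and> p \<in> U \<and> g holo_on U \<and> h holo_on U \<and> U \<subseteq> closure {x \<in> U. h x \<noteq> 0} \<and>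
        (\<forall>x\<in>U. h x \<noteq> 0 \<longrightarrow> f (\<phi> x) = g x / h x)"
    by (intro exI[of _ "\<phi> -` U"] exI[of _ "\<lambda>x. g (\<phi> x)"] exI[of _ "\<lambda>x. h (\<phi> x)"])
      (use U c assms(5,6) in \<open>auto intro!: holo_on_comp open_vimage\<close>)
qed

lemma continuous_shift_tab: "continuous_on S (shift_tab \<sigma>)"
  unfolding shift_tab_def[abs_def] by (intro continuous_intros)

lemma mero_rel_shift:
  assumes "mero_rel f g" shows "mero_rel (f \<circ> inv (shift_tab \<sigma>)) (g \<circ> inv (shift_tab \<sigma>))"
proof -
  have d: "(shift_tab (- \<sigma>) has_derivative (\<lambda>y. y)) (at x)" for x
  proof -
    have "shift_tab (- \<sigma>) = (\<lambda>x. x + (\<chi> a. of_int (shift_at (- \<sigma>) a)))"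
      by (simp add: fun_eq_iff vec_eq_iff shift_tab_def)
    then show ?thesis by (auto intro!: derivative_eq_intros)
  qed
  have i: "shift_tab (- \<sigma>) (shift_tab \<sigma> x) = x" "shift_tab \<sigma> (shift_tab (- \<sigma>) x) = x" for x
    by (simp_all add: shift_tab_add[symmetric] shift_tab_zero)
  note * = meromorphic_comp[OF _ i continuous_shift_tab d refl]
    agree_on_comp[OF _ i continuous_shift_tab continuous_shift_tab, where U = UNIV]
  show ?thesis
    using assms *(1)[of f] *(1)[of g] *(2)[of f g] unfolding mero_rel_def inv_shift_tab comp_def by simp
qed

lemma mero_rel_perm:
  assumes "mero_rel f g" shows "mero_rel (f \<circ> inv (perm_tab s)) (g \<circ> inv (perm_tab s))"
proof -
  have c: "continuous_on UNIV (\<lambda>x. \<chi> a. x $ p a)" for p :: "'a tab_index \<Rightarrow> 'a tab_index"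
    and s :: "'a row_perm"
    by (intro continuous_intros)
  have c1: "continuous_on UNIV (perm_tab s)" for s :: "'a row_perm"
    unfolding perm_tab.rep_eq[abs_def] by (rule c)
  have c2: "continuous_on UNIV (inv (perm_tab s))" unfolding inv_perm_tab by (rule c)
  have "linear (inv (perm_tab s))"
    unfolding inv_perm_tab by (rule linearI) (simp_all add: vec_eq_iff)
  then have d: "(inv (perm_tab s) has_derivative inv (perm_tab s)) (at x)" for x
    by (rule linear_imp_has_derivative)
  have l: "inv (perm_tab s) (c *s y) = c *s inv (perm_tab s) y" for c y
    unfolding inv_perm_tab by (simp add: vec_eq_iff)
  have i: "inv (perm_tab s) (perm_tab s x) = x" "perm_tab s (inv (perm_tab s) x) = x" for x
    using bij_perm_tab[of s] by (simp_all add: bij_is_inj bij_is_surj surj_f_inv_f)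
  note * = meromorphic_comp[OF _ i c1 d l] agree_on_comp[OF _ i c2 c1, where U = UNIV]
  show ?thesis
    using assms *(1)[of f] *(1)[of g] *(2)[of f g] unfolding mero_rel_def comp_def by simp
qed

lift_definition shift_mero :: "'n::finite gimel \<Rightarrow> 'n tab_index mero \<Rightarrow> 'n tab_index mero"
  is "\<lambda>\<sigma> f. f \<circ> inv (shift_tab \<sigma>)" by (rule mero_rel_shift)

lift_definition perm_mero :: "'n::finite row_perm \<Rightarrow> 'n tab_index mero \<Rightarrow> 'n tab_index mero"
  is "\<lambda>s f. f \<circ> inv (perm_tab s)" by (rule mero_rel_perm)

lemma shift_mero_hom:
  "shift_mero \<sigma> (f + g) = shift_mero \<sigma> f + shift_mero \<sigma> g"
  "shift_mero \<sigma> (f * g) = shift_mero \<sigma> f * shift_mero \<sigma> g"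
  "shift_mero \<sigma> 0 = 0" "shift_mero \<sigma> 1 = 1"
proof -
  show "shift_mero \<sigma> 0 = 0" "shift_mero \<sigma> 1 = 1"
    by (transfer, simp add: mero_rel_def comp_def meromorphic_const agree_on_refl)+
  show "shift_mero \<sigma> (f + g) = shift_mero \<sigma> f + shift_mero \<sigma> g"
  proof transfer
    fix \<sigma> :: "'a gimel" and f g :: "'a tab \<Rightarrow> complex"
    assume "mero_rel f f" "mero_rel g g"
    then have "mero_rel (\<lambda>x. f x + g x) (\<lambda>x. f x + g x)"
      by (auto simp: mero_rel_def intro: meromorphic_add agree_on_refl)
    from mero_rel_shift[OF this, of \<sigma>]
    show "mero_rel ((\<lambda>x. f x + g x) \<circ> inv (shift_tab \<sigma>))
      (\<lambda>x. (f \<circ> inv (shift_tab \<sigma>)) x + (g \<circ> inv (shift_tab \<sigma>)) x)" by (simp add: comp_def)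
  qed
  show "shift_mero \<sigma> (f * g) = shift_mero \<sigma> f * shift_mero \<sigma> g"
  proof transfer
    fix \<sigma> :: "'a gimel" and f g :: "'a tab \<Rightarrow> complex"
    assume "mero_rel f f" "mero_rel g g"
    then have "mero_rel (\<lambda>x. f x * g x) (\<lambda>x. f x * g x)"
      by (auto simp: mero_rel_def intro: meromorphic_mult agree_on_refl)
    from mero_rel_shift[OF this, of \<sigma>]
    show "mero_rel ((\<lambda>x. f x * g x) \<circ> inv (shift_tab \<sigma>))
      (\<lambda>x. (f \<circ> inv (shift_tab \<sigma>)) x * (g \<circ> inv (shift_tab \<sigma>)) x)" by (simp add: comp_def)
  qed
qed

lemma shift_mero_add: "shift_mero (\<sigma> + \<rho>) f = shift_mero \<sigma> (shift_mero \<rho> f)"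
proof transfer
  fix \<sigma> \<rho> :: "'a gimel" and f :: "'a tab \<Rightarrow> complex" assume "mero_rel f f"
  from mero_rel_shift[OF this, of "\<sigma> + \<rho>"]
  show "mero_rel (f \<circ> inv (shift_tab (\<sigma> + \<rho>))) (f \<circ> inv (shift_tab \<rho>) \<circ> inv (shift_tab \<sigma>))"
    unfolding inv_shift_tab
    by (simp add: comp_def shift_tab_add[symmetric] add.commute)
qed

lemma shift_mero_zero: "shift_mero 0 f = f"
  by transfer (simp add: inv_shift_tab comp_def shift_tab_zero)


section \<open>The skew group ring\<close>

typedef (overloaded) ('n::finite) skew_ring = "UNIV :: ('n gimel \<Rightarrow>\<^sub>0 'n tab_index mero) set"
  by simp

setup_lifting type_definition_skew_ring

definition skew_times :: "('n::finite gimel \<Rightarrow>\<^sub>0 'n tab_index mero) \<Rightarrow>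
    ('n gimel \<Rightarrow>\<^sub>0 'n tab_index mero) \<Rightarrow> ('n gimel \<Rightarrow>\<^sub>0 'n tab_index mero)"
  where "skew_times A B = (\<Sum>\<sigma>\<in>Poly_Mapping.keys A. \<Sum>\<rho>\<in>Poly_Mapping.keys B.
    Poly_Mapping.single (\<sigma> + \<rho>)
      (Poly_Mapping.lookup A \<sigma> * shift_mero \<sigma> (Poly_Mapping.lookup B \<rho>)))"

lemma skew_times_superset:
  assumes "finite S" "finite T" "Poly_Mapping.keys A \<subseteq> S" "Poly_Mapping.keys B \<subseteq> T"
  shows "skew_times A B = (\<Sum>\<sigma>\<in>S. \<Sum>\<rho>\<in>T. Poly_Mapping.single (\<sigma> + \<rho>)
      (Poly_Mapping.lookup A \<sigma> * shift_mero \<sigma> (Poly_Mapping.lookup B \<rho>)))"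
proof -
  have "skew_times A B = (\<Sum>\<sigma>\<in>Poly_Mapping.keys A. \<Sum>\<rho>\<in>T. Poly_Mapping.single (\<sigma> + \<rho>)
      (Poly_Mapping.lookup A \<sigma> * shift_mero \<sigma> (Poly_Mapping.lookup B \<rho>)))"
    unfolding skew_times_def
  proof (rule sum.cong[OF refl])
    fix \<sigma>
    show "(\<Sum>\<rho>\<in>Poly_Mapping.keys B. Poly_Mapping.single (\<sigma> + \<rho>)
        (Poly_Mapping.lookup A \<sigma> * shift_mero \<sigma> (Poly_Mapping.lookup B \<rho>))) =
      (\<Sum>\<rho>\<in>T. Poly_Mapping.single (\<sigma> + \<rho>)
        (Poly_Mapping.lookup A \<sigma> * shift_mero \<sigma> (Poly_Mapping.lookup B \<rho>)))"
      by (rule sum.mono_neutral_left[OF assms(2,4)]) (simp add: in_keys_iff shift_mero_hom)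
  qed
  also have "\<dots> = (\<Sum>\<sigma>\<in>S. \<Sum>\<rho>\<in>T. Poly_Mapping.single (\<sigma> + \<rho>)
      (Poly_Mapping.lookup A \<sigma> * shift_mero \<sigma> (Poly_Mapping.lookup B \<rho>)))"
    by (rule sum.mono_neutral_left[OF assms(1,3)]) (simp add: in_keys_iff)
  finally show ?thesis .
qed

lemma skew_times_add_left: "skew_times (A + B) C = skew_times A C + skew_times B C"
proof -
  let ?S = "Poly_Mapping.keys A \<union> Poly_Mapping.keys B" and ?T = "Poly_Mapping.keys C"
  have fin: "finite ?S" "finite ?T" by simp_all
  note e = skew_times_superset[OF fin _ order_refl]
  show ?thesis
    unfolding e[OF Poly_Mapping.keys_add] e[OF Un_upper1] e[OF Un_upper2]
    by (simp add: lookup_add distrib_right single_add sum.distrib)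
qed

lemma skew_times_add_right: "skew_times C (A + B) = skew_times C A + skew_times C B"
proof -
  let ?S = "Poly_Mapping.keys A \<union> Poly_Mapping.keys B" and ?T = "Poly_Mapping.keys C"
  have fin: "finite ?T" "finite ?S" by simp_all
  note e = skew_times_superset[OF fin order_refl]
  show ?thesis
    unfolding e[OF Poly_Mapping.keys_add] e[OF Un_upper1] e[OF Un_upper2]
    by (simp add: lookup_add distrib_left single_add sum.distrib shift_mero_hom)
qed

lemma skew_times_single:
  "skew_times (Poly_Mapping.single \<sigma> f) (Poly_Mapping.single \<rho> g) =
    Poly_Mapping.single (\<sigma> + \<rho>) (f * shift_mero \<sigma> g)"
proof -
  have "Poly_Mapping.keys (Poly_Mapping.single \<alpha> h) \<subseteq> {\<alpha>}" for \<alpha> and h :: "'a tab_index mero"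
    by simp
  then show ?thesis
    by (simp add: skew_times_superset[where S = "{\<sigma>}" and T = "{\<rho>}"])
qed

lemma skew_times_zero: "skew_times 0 A = 0" "skew_times A 0 = 0"
  by (simp_all add: skew_times_def)

lemma poly_mapping_single_induct:
  fixes A :: "'a \<Rightarrow>\<^sub>0 'b::comm_monoid_add"
  assumes "P 0" "\<And>a b. P (Poly_Mapping.single a b)" "\<And>A B. P A \<Longrightarrow> P B \<Longrightarrow> P (A + B)"
  shows "P A"
proof (induction A rule: update_induct)
  case const
  show ?case by (rule assms(1))
next
  case (update A a b)
  have "Poly_Mapping.update a b A = A + Poly_Mapping.single a b"
    by (rule poly_mapping_eqI)
      (use update in \<open>auto simp: lookup_update lookup_add lookup_single when_def in_keys_iff\<close>)
  then show ?case using update.IH assms(2,3) by metis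
qed

lemma skew_times_assoc: "skew_times (skew_times A B) C = skew_times A (skew_times B C)"
proof (induction A rule: poly_mapping_single_induct)
  case (2 \<sigma> f)
  show ?case
  proof (induction B rule: poly_mapping_single_induct)
    case (2 \<rho> g)
    show ?case
      by (induction C rule: poly_mapping_single_induct)
        (auto simp: skew_times_zero skew_times_add_right skew_times_single shift_mero_hom
          shift_mero_add add.assoc mult.assoc)
  qed (auto simp: skew_times_zero skew_times_add_left skew_times_add_right)
qed (auto simp: skew_times_zero skew_times_add_left)

instantiation skew_ring :: (finite) ring_1
begin

lift_definition zero_skew_ring :: "'a skew_ring" is 0 .
lift_definition one_skew_ring :: "'a skew_ring" is "Poly_Mapping.single 0 1" .
lift_definition plus_skew_ring :: "'a skew_ring \<Rightarrow> 'a skew_ring \<Rightarrow> 'a skew_ring" is "(+)" .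
lift_definition minus_skew_ring :: "'a skew_ring \<Rightarrow> 'a skew_ring \<Rightarrow> 'a skew_ring" is "(-)" .
lift_definition uminus_skew_ring :: "'a skew_ring \<Rightarrow> 'a skew_ring" is uminus .
lift_definition times_skew_ring :: "'a skew_ring \<Rightarrow> 'a skew_ring \<Rightarrow> 'a skew_ring" is skew_times .

instance
proof
  fix A :: "'a skew_ring"
  show "1 * A = A"
  proof transfer
    fix A :: "'a gimel \<Rightarrow>\<^sub>0 'a tab_index mero"
    show "skew_times (Poly_Mapping.single 0 1) A = A"
      by (induction A rule: poly_mapping_single_induct)
        (auto simp: skew_times_zero skew_times_add_right skew_times_single shift_mero_zero
          simp del: single_one)
  qed
  show "A * 1 = A"
  proof transfer
    fix A :: "'a gimel \<Rightarrow>\<^sub>0 'a tab_index mero"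
    show "skew_times A (Poly_Mapping.single 0 1) = A"
      by (induction A rule: poly_mapping_single_induct)
        (auto simp: skew_times_zero skew_times_add_left skew_times_single shift_mero_hom
          simp del: single_one)
  qed
  show "(0 :: 'a skew_ring) \<noteq> 1"
    by transfer (metis lookup_single_eq lookup_zero zero_neq_one)
qed (transfer; simp add: skew_times_assoc skew_times_add_left skew_times_add_right
    skew_times_zero algebra_simps)+

end

definition star :: "'n::finite skew_ring \<Rightarrow> 'n skew_ring \<Rightarrow> 'n skew_ring"
  where "star A B = B * A"

definition coeff :: "'n::finite skew_ring \<Rightarrow> 'n gimel \<Rightarrow> 'n tab_index mero"
  where "coeff A = Poly_Mapping.lookup (Rep_skew_ring A)"

definition supp :: "'n::finite skew_ring \<Rightarrow> 'n gimel set"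
  where "supp A = Poly_Mapping.keys (Rep_skew_ring A)"

definition fn :: "'n::finite tab_index mero \<Rightarrow> 'n skew_ring"
  where "fn f = Abs_skew_ring (Poly_Mapping.single 0 f)"

definition grp :: "'n::finite gimel \<Rightarrow> 'n skew_ring"
  where "grp \<sigma> = Abs_skew_ring (Poly_Mapping.single \<sigma> 1)"

text \<open>The formal sum \<open>\<Sum> f\<^sub>i \<sigma>\<^sub>i\<close> is the ring element \<open>\<Sum> fn f\<^sub>i * grp \<sigma>\<^sub>i\<close>.\<close>

lemma coeff_fn_grp: "coeff (fn f * grp \<sigma>) \<rho> = (if \<rho> = \<sigma> then f else 0)"
  by (simp add: coeff_def fn_def grp_def times_skew_ring.rep_eq Abs_skew_ring_inverse
      skew_times_single shift_mero_hom shift_mero_zero lookup_single when_def)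

definition perm_skew :: "'n::finite row_perm \<Rightarrow> 'n skew_ring \<Rightarrow> 'n skew_ring"
  where "perm_skew s A = (\<Sum>\<sigma>\<in>supp A. fn (perm_mero s (coeff A \<sigma>)) * grp (perm_shift s \<sigma>))"

definition skew_invariants :: "'n::finite tab \<Rightarrow> 'n skew_ring set"
  where "skew_invariants v = {A. \<forall>s. perm_tab s v = v \<longrightarrow> perm_skew s A = A}"


section \<open>The universal ring and its action on invariant holomorphic functions\<close>

text \<open>The singular pair of coordinates \<open>(k,i)\<close>, \<open>(k,j)\<close> is given by two indices \<open>a \<noteq> b\<close> of the
  same row.\<close>

definition one_singular :: "'n::finite tab_index \<Rightarrow> 'n tab_index \<Rightarrow> 'n tab \<Rightarrow> bool"
  where "one_singular a b x \<longleftrightarrow> row a = row b \<and> a \<noteq> b \<and> x $ a - x $ b \<in> \<int> \<and>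
    (\<forall>c d. row c = row d \<and> c \<noteq> d \<and> {c, d} \<noteq> {a, b} \<longrightarrow> x $ c - x $ d \<notin> \<int>)"

definition z1 :: "'n::finite tab_index \<Rightarrow> 'n tab_index \<Rightarrow> 'n tab \<Rightarrow> complex"
  where "z1 a b x = x $ a - x $ b"

definition gimel_orbit :: "'n::finite tab \<Rightarrow> 'n tab set"
  where "gimel_orbit x = range (\<lambda>\<sigma>. shift_tab \<sigma> x)"

definition admissible_nbhd ::
    "'n::finite tab_index \<Rightarrow> 'n tab_index \<Rightarrow> 'n tab \<Rightarrow> 'n tab set \<Rightarrow> bool"
  where "admissible_nbhd a b v W \<longleftrightarrow> open W \<and> gimel_orbit v \<subseteq> W \<and>
    (\<forall>\<sigma>. shift_tab \<sigma> ` W = W) \<and> perm_tab (row_transp a b) ` W = W \<and>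
    (\<forall>c d. row c = row d \<and> c \<noteq> d \<and> {c, d} \<noteq> {a, b} \<longrightarrow> (\<forall>x\<in>W. x $ c - x $ d \<noteq> 0))"

text \<open>Coefficients are meromorphic on the whole space; only the condition on the generators refers
  to \<open>W\<close>.\<close>

inductive_set universal_ring ::
    "'n::finite tab_index \<Rightarrow> 'n tab_index \<Rightarrow> 'n tab \<Rightarrow> 'n tab set \<Rightarrow> 'n skew_ring set"
  for a b v W where
    generator: "A \<in> skew_invariants v \<Longrightarrow>
      (\<And>\<sigma>. \<exists>H. H holo_on W \<and> agree_on W (mero_value (coeff A \<sigma>)) (\<lambda>x. H x / z1 a b x)) \<Longrightarrow>
      A \<in> universal_ring a b v W"
  | one: "1 \<in> universal_ring a b v W"
  | add: "A \<in> universal_ring a b v W \<Longrightarrow> B \<in> universal_ring a b v W \<Longrightarrow>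
      A + B \<in> universal_ring a b v W"
  | uminus: "A \<in> universal_ring a b v W \<Longrightarrow> - A \<in> universal_ring a b v W"
  | times: "A \<in> universal_ring a b v W \<Longrightarrow> B \<in> universal_ring a b v W \<Longrightarrow>
      A * B \<in> universal_ring a b v W"

text \<open>A function on \<open>W\<close> is encoded as its extension by zero to the whole space, and a functional
  on these functions as its extension by zero to all functions; so equality of functions and of
  functionals is equality in HOL.\<close>

definition inv_holo :: "'n::finite tab \<Rightarrow> 'n tab set \<Rightarrow> ('n tab \<Rightarrow> complex) set"
  where "inv_holo v W = {F. F holo_on W \<and> (\<forall>x. x \<notin> W \<longrightarrow> F x = 0) \<and>
    (\<forall>s. perm_tab s v = v \<longrightarrow> F \<circ> inv (perm_tab s) = F)}"

type_synonym 'n functional = "('n tab \<Rightarrow> complex) \<Rightarrow> complex"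

text \<open>\<open>\<Sum> f\<^sub>\<sigma> (F \<circ> \<sigma>\<^sup>-\<^sup>1)\<close>, computed as a meromorphic function: single summands may have poles that
  cancel, hence \<^const>\<open>hol_value\<close>.\<close>

definition act :: "'n::finite tab set \<Rightarrow> 'n skew_ring \<Rightarrow> ('n tab \<Rightarrow> complex) \<Rightarrow> ('n tab \<Rightarrow> complex)"
  where "act W A F = (\<lambda>x. if x \<in> W
    then hol_value (\<lambda>y. \<Sum>\<sigma>\<in>supp A. mero_value (coeff A \<sigma>) y * F (inv (shift_tab \<sigma>) y)) x
    else 0)"

definition ev :: "'n::finite tab \<Rightarrow> 'n tab set \<Rightarrow> 'n functional"
  where "ev v W = (\<lambda>F. if F \<in> inv_holo v W then F v else 0)"

definition dcomp :: "'n::finite tab \<Rightarrow> 'n tab set \<Rightarrow> 'n functional \<Rightarrow> 'n skew_ring \<Rightarrow> 'n functional"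
  where "dcomp v W D A = (\<lambda>F. if F \<in> inv_holo v W then D (act W A F) else 0)"

definition fscale :: "complex \<Rightarrow> 'n::finite functional \<Rightarrow> 'n functional"
  where "fscale c D = (\<lambda>F. c * D F)"

global_interpretation functional: vector_space fscale
  by standard (auto simp: fscale_def fun_eq_iff algebra_simps)


section \<open>Local distributions\<close>

definition D1 :: "'n::finite tab_index \<Rightarrow> 'n tab_index \<Rightarrow> 'n tab \<Rightarrow> 'n tab set \<Rightarrow> 'n gimel \<Rightarrow> 'n functional"
  where "D1 a b v W \<sigma> =
    fscale (1/2) (dcomp v W (ev v W) (grp \<sigma> + grp (perm_shift (row_transp a b) \<sigma>)))"

definition D2 :: "'n::finite tab_index \<Rightarrow> 'n tab_index \<Rightarrow> 'n tab \<Rightarrow> 'n tab set \<Rightarrow> 'n gimel \<Rightarrow> 'n functional"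
  where "D2 a b v W \<sigma> =
    (if perm_shift (row_transp a b) \<sigma> = \<sigma> then 0
     else dcomp v W (ev v W)
       (fn (mero_of (\<lambda>x. 1 / (2 * z1 a b x))) * (grp \<sigma> - grp (perm_shift (row_transp a b) \<sigma>))))"

definition Delta :: "'n::finite tab_index \<Rightarrow> 'n tab_index \<Rightarrow> 'n gimel set"
  where "Delta a b = {\<sigma>. shift_at \<sigma> a \<le> shift_at \<sigma> b}"

definition distributions ::
    "'n::finite tab_index \<Rightarrow> 'n tab_index \<Rightarrow> 'n tab \<Rightarrow> 'n tab set \<Rightarrow> 'n functional set"
  where "distributions a b v W = D1 a b v W ` Delta a b \<union>
    D2 a b v W ` {\<sigma> \<in> Delta a b. perm_shift (row_transp a b) \<sigma> \<noteq> \<sigma>}"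

definition distribution_space ::
    "'n::finite tab_index \<Rightarrow> 'n tab_index \<Rightarrow> 'n tab \<Rightarrow> 'n tab set \<Rightarrow> 'n functional set"
  where "distribution_space a b v W = functional.span (distributions a b v W)"

text \<open>\<open>\<partial>g/\<partial>z\<^sub>1\<close> in the coordinates \<open>z\<^sub>1 = x\<^sub>a - x\<^sub>b\<close>, \<open>z\<^sub>2 = x\<^sub>a + x\<^sub>b\<close>, \<open>z\<^sub>3, \<dots>\<close>: moving \<open>z\<^sub>1\<close> by \<open>t\<close> with
  the others fixed moves \<open>x\<^sub>a\<close> by \<open>t/2\<close> and \<open>x\<^sub>b\<close> by \<open>-t/2\<close>.\<close>

definition deriv_z1 ::
    "'n::finite tab_index \<Rightarrow> 'n tab_index \<Rightarrow> 'n tab_index mero \<Rightarrow> 'n tab \<Rightarrow> complex"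
  where "deriv_z1 a b g v = deriv (\<lambda>t. mero_value g (v + (t/2) *s (axis a 1 - axis b 1))) 0"


section \<open>The enveloping algebra of the general linear Lie algebra\<close>

datatype 'a free_word = Word "'a list"

instantiation free_word :: (type) monoid_add
begin

definition "0 = Word []"
fun plus_free_word where "plus_free_word (Word xs) (Word ys) = Word (xs @ ys)"

instance
proof
  fix a b c :: "'a free_word"
  show "a + b + c = a + (b + c)" by (cases a; cases b; cases c) simp
  show "0 + a = a" "a + 0 = a" by (cases a; simp add: zero_free_word_def)+
qed

end

text \<open>The algebra of finitely supported functions on words is the free associative algebra.\<close>

type_synonym 'a free_algebra = "'a free_word \<Rightarrow>\<^sub>0 complex"

definition free_gen :: "'a \<Rightarrow> 'a free_algebra"
  where "free_gen a = Poly_Mapping.single (Word [a]) 1"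

typedef (overloaded) ('n::finite) mat_index = "{1..CARD('n)}"
  by (rule exI[of _ 1]) (simp add: Suc_leI)

instance mat_index :: (finite) finite
proof
  have eq: "(UNIV :: 'a mat_index set) = Abs_mat_index ` {1..CARD('a)}"
    by (rule type_definition.Abs_image[OF type_definition_mat_index, symmetric])
  show "finite (UNIV :: 'a mat_index set)" unfolding eq by simp
qed

type_synonym 'n gl = "complex ^ 'n mat_index ^ 'n mat_index"

text \<open>The two-sided ideal generated by
  \<open>E\<^sub>s\<^sub>t E\<^sub>u\<^sub>w - E\<^sub>u\<^sub>w E\<^sub>s\<^sub>t - [E\<^sub>s\<^sub>t, E\<^sub>u\<^sub>w]\<close>, where \<open>[E\<^sub>s\<^sub>t, E\<^sub>u\<^sub>w] = \<delta>\<^sub>t\<^sub>u E\<^sub>s\<^sub>w - \<delta>\<^sub>s\<^sub>w E\<^sub>u\<^sub>t\<close>.\<close>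

inductive_set gl_ideal :: "('n::finite mat_index \<times> 'n mat_index) free_algebra set" where
    zero: "0 \<in> gl_ideal"
  | rel: "free_gen (s, t) * free_gen (u, w) - free_gen (u, w) * free_gen (s, t) -
      ((if t = u then free_gen (s, w) else 0) - (if s = w then free_gen (u, t) else 0)) \<in> gl_ideal"
  | add: "x \<in> gl_ideal \<Longrightarrow> y \<in> gl_ideal \<Longrightarrow> x + y \<in> gl_ideal"
  | mult: "x \<in> gl_ideal \<Longrightarrow> p * x * q \<in> gl_ideal"

lemma gl_ideal_uminus: "x \<in> gl_ideal \<Longrightarrow> - x \<in> gl_ideal"
  using gl_ideal.mult[of x "-1" 1] by simp

lemma gl_ideal_diff: "x \<in> gl_ideal \<Longrightarrow> y \<in> gl_ideal \<Longrightarrow> x - y \<in> gl_ideal"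
  using gl_ideal.add[of x "- y"] gl_ideal_uminus[of y] by simp

quotient_type 'n uea = "('n::finite mat_index \<times> 'n mat_index) free_algebra" /
  "\<lambda>x y. x - y \<in> gl_ideal"
proof (rule equivpI)
  let ?R = "\<lambda>x y. x - y \<in> (gl_ideal :: ('n mat_index \<times> 'n mat_index) free_algebra set)"
  show "reflp ?R" by (rule reflpI) (simp add: gl_ideal.zero)
  show "symp ?R"
  proof (rule sympI)
    fix x y assume "?R x y"
    from gl_ideal_uminus[OF this] show "?R y x" by simp
  qed
  show "transp ?R"
  proof (rule transpI)
    fix x y z assume "?R x y" "?R y z"
    from gl_ideal.add[OF this] show "?R x z" by simp
  qed
qed

instantiation uea :: (finite) "{ring, monoid_mult}"
begin

lift_definition zero_uea :: "'a uea" is 0 .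
lift_definition one_uea :: "'a uea" is 1 .
lift_definition plus_uea :: "'a uea \<Rightarrow> 'a uea \<Rightarrow> 'a uea" is "(+)"
proof -
  fix a b c d :: "('a mat_index \<times> 'a mat_index) free_algebra"
  assume "a - b \<in> gl_ideal" "c - d \<in> gl_ideal"
  from gl_ideal.add[OF this] show "a + c - (b + d) \<in> gl_ideal" by (simp add: algebra_simps)
qed
lift_definition minus_uea :: "'a uea \<Rightarrow> 'a uea \<Rightarrow> 'a uea" is "(-)"
proof -
  fix a b c d :: "('a mat_index \<times> 'a mat_index) free_algebra"
  assume "a - b \<in> gl_ideal" "c - d \<in> gl_ideal"
  from gl_ideal_diff[OF this] show "a - c - (b - d) \<in> gl_ideal" by (simp add: algebra_simps)
qed
lift_definition uminus_uea :: "'a uea \<Rightarrow> 'a uea" is uminus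
proof -
  fix a b :: "('a mat_index \<times> 'a mat_index) free_algebra"
  assume "a - b \<in> gl_ideal"
  from gl_ideal_uminus[OF this] show "- a - - b \<in> gl_ideal" by simp
qed
lift_definition times_uea :: "'a uea \<Rightarrow> 'a uea \<Rightarrow> 'a uea" is "(*)"
proof -
  fix a b c d :: "('a mat_index \<times> 'a mat_index) free_algebra"
  assume "a - b \<in> gl_ideal" "c - d \<in> gl_ideal"
  then have "1 * (a - b) * c + b * (c - d) * 1 \<in> gl_ideal"
    by (intro gl_ideal.add gl_ideal.mult)
  then show "a * c - b * d \<in> gl_ideal" by (simp add: algebra_simps)
qed

instance
  by standard (transfer; simp add: algebra_simps gl_ideal.zero)+

end

lift_definition uea_scalar :: "complex \<Rightarrow> 'n::finite uea" is "\<lambda>c. Poly_Mapping.single 0 c" .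

lift_definition uea_gen :: "'n::finite mat_index \<Rightarrow> 'n mat_index \<Rightarrow> 'n uea"
  is "\<lambda>s t. free_gen (s, t)" .

definition uea_E :: "nat \<Rightarrow> nat \<Rightarrow> 'n::finite uea"
  where "uea_E s t = uea_gen (Abs_mat_index s) (Abs_mat_index t)"

definition uea_of :: "'n::finite gl \<Rightarrow> 'n uea"
  where "uea_of X = (\<Sum>s\<in>UNIV. \<Sum>t\<in>UNIV. uea_scalar (X $ s $ t) * uea_gen s t)"

definition raising_coeff :: "nat \<Rightarrow> nat \<Rightarrow> 'n::finite tab_index mero"
  where "raising_coeff k i = mero_of (\<lambda>x.
    (\<Prod>j\<in>{1..k+1}. x $ idx k i - x $ idx (k+1) j) / (\<Prod>j\<in>{1..k} - {i}. x $ idx k i - x $ idx k j))"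

definition lowering_coeff :: "nat \<Rightarrow> nat \<Rightarrow> 'n::finite tab_index mero"
  where "lowering_coeff k i = mero_of (\<lambda>x.
    (\<Prod>j\<in>{1..k-1}. x $ idx k i - x $ idx (k-1) j) / (\<Prod>j\<in>{1..k} - {i}. x $ idx k i - x $ idx k j))"

definition diagonal_coeff :: "nat \<Rightarrow> 'n::finite tab_index mero"
  where "diagonal_coeff k = mero_of (\<lambda>x.
    (\<Sum>i\<in>{1..k}. x $ idx k i + of_nat i - 1) - (\<Sum>i\<in>{1..k-1}. x $ idx (k-1) i + of_nat i - 1))"

text \<open>Homomorphisms of complex algebras into the ring with multiplication \<^const>\<open>star\<close>; preservation
  of \<open>1\<close> is the case \<open>c = 1\<close> of the scalar clause.\<close>

definition gelfand_tsetlin_hom :: "('n::finite uea \<Rightarrow> 'n skew_ring) \<Rightarrow> bool"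
  where "gelfand_tsetlin_hom \<Phi> \<longleftrightarrow>
    (\<forall>x y. \<Phi> (x + y) = \<Phi> x + \<Phi> y) \<and>
    (\<forall>x y. \<Phi> (x * y) = star (\<Phi> x) (\<Phi> y)) \<and>
    (\<forall>c. \<Phi> (uea_scalar c) = fn (mero_of (\<lambda>x. c))) \<and>
    (\<forall>k. 1 \<le> k \<and> k < CARD('n) \<longrightarrow>
      \<Phi> (uea_E k (k+1)) = - (\<Sum>i\<in>{1..k}. fn (raising_coeff k i) * grp (- sigma k i))) \<and>
    (\<forall>k. 1 \<le> k \<and> k < CARD('n) \<longrightarrow>
      \<Phi> (uea_E (k+1) k) = (\<Sum>i\<in>{1..k}. fn (lowering_coeff k i) * grp (sigma k i))) \<and>
    (\<forall>k. 1 \<le> k \<and> k \<le> CARD('n) \<longrightarrow> \<Phi> (uea_E k k) = fn (diagonal_coeff k))"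

definition gl_act :: "'n::finite tab \<Rightarrow> 'n tab set \<Rightarrow> ('n uea \<Rightarrow> 'n skew_ring) \<Rightarrow>
    'n gl \<Rightarrow> 'n functional \<Rightarrow> 'n functional"
  where "gl_act v W \<Phi> X D = dcomp v W D (\<Phi> (uea_of X))"

text \<open>Complex Lie algebra modules: \<open>mat c ** X\<close> is the scalar multiple \<open>c X\<close>.\<close>

definition gl_module :: "'n::finite functional set \<Rightarrow> ('n gl \<Rightarrow> 'n functional \<Rightarrow> 'n functional) \<Rightarrow> bool"
  where "gl_module S \<rho> \<longleftrightarrow> functional.subspace S \<and>
    (\<forall>X. \<forall>D\<in>S. \<rho> X D \<in> S) \<and>
    (\<forall>X. \<forall>D\<in>S. \<forall>D'\<in>S. \<rho> X (D + D') = \<rho> X D + \<rho> X D') \<and>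
    (\<forall>X c. \<forall>D\<in>S. \<rho> X (fscale c D) = fscale c (\<rho> X D)) \<and>
    (\<forall>X Y. \<forall>D\<in>S. \<rho> (X + Y) D = \<rho> X D + \<rho> Y D) \<and>
    (\<forall>c X. \<forall>D\<in>S. \<rho> (mat c ** X) D = fscale c (\<rho> X D)) \<and>
    (\<forall>X Y. \<forall>D\<in>S. \<rho> (X ** Y - Y ** X) D = \<rho> X (\<rho> Y D) - \<rho> Y (\<rho> X D))"

end

theory Submission
  imports Defs "HOL-Complex_Analysis.Cauchy_Integral_Formula"
begin

text \<open>
  Let \<open>A = \<Sum> h\<^sub>\<sigma> \<sigma>\<close> be an element of the universal ring, \<open>F\<close> a \<open>\<tau>\<close>-invariant holomorphic function and
  \<open>\<phi>\<^sub>\<sigma> = F \<circ> \<sigma>\<^sup>-\<^sup>1\<close>. A single product \<open>h\<^sub>\<sigma> \<phi>\<^sub>\<sigma>\<close> may have a pole along \<open>z\<^sub>1 = 0\<close>, but the sum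
  \<open>A(F) = \<Sum> h\<^sub>\<sigma> \<phi>\<^sub>\<sigma>\<close> has none: for a generator, \<open>z\<^sub>1 A(F)\<close> is holomorphic and changes sign under
  \<open>\<tau>\<close>, hence vanishes on \<open>z\<^sub>1 = 0\<close> and is divisible by \<open>z\<^sub>1\<close> (\<open>symmetric_simple_polar_extends\<close>). So
  the universal ring acts on the invariant holomorphic functions (\<open>universal_ring_acts\<close>) and, by
  composition, from the right on their functionals.

  The formula for the action is the value at \<open>v\<close> of a derivative. Near \<open>v\<close> the functions
  \<open>g\<^sub>\<sigma> = z\<^sub>1 h\<^sub>\<sigma>\<close> are holomorphic and \<open>z\<^sub>1 A(F) = \<Sum> g\<^sub>\<sigma> \<phi>\<^sub>\<sigma>\<close>. Apply \<open>\<partial>/\<partial>z\<^sub>1\<close> at \<open>v\<close>, where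
  \<open>z\<^sub>1 = 0\<close>: the left side gives \<open>A(F)(v)\<close>, the right side
  \<open>\<Sum> g\<^sub>\<sigma>(v) \<partial>\<phi>\<^sub>\<sigma>(v) + \<partial>g\<^sub>\<sigma>(v) \<phi>\<^sub>\<sigma>(v)\<close> (\<open>act_at_v\<close>). Since \<open>F\<close> is invariant,
  \<open>\<phi>\<^sub>\<sigma>(v) = D\<^sup>1\<^sub>\<sigma>(F)\<close> and \<open>\<partial>\<phi>\<^sub>\<sigma>(v) = D\<^sup>2\<^sub>\<sigma>(F)\<close> (\<open>D1_apply\<close>, \<open>D2_apply\<close>), which is the formula.
  It also shows that every \<open>ev\<^sub>v \<circ> A\<close> lies in the span of the local distributions; the converse holds
  because each \<open>D\<^sup>1\<^sub>\<sigma>\<close> and \<open>D\<^sup>2\<^sub>\<sigma>\<close> is evaluation after a generator.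

  That \<open>g\<^sub>\<sigma>\<close> is holomorphic at \<open>v\<close> for products of generators too is the point of
  \<open>universal_ring_tame\<close>. Multiplying on the right by a generator, the shift \<open>\<sigma>\<close> moves the pole of the
  new factor to \<open>z\<^sub>1 = m\<close> for an integer \<open>m\<close>. If \<open>m \<noteq> 0\<close>, this factor is holomorphic at \<open>v\<close>; if
  \<open>m = 0\<close>, then \<open>\<tau>(\<sigma>) = \<sigma>\<close>, so the old coefficient of \<open>\<sigma>\<close> is \<open>\<tau>\<close>-invariant with at most a simple
  pole, and therefore holomorphic. In either case only one simple pole is left.

  Finally \<open>\<Phi>(X)\<close> lies in the universal ring for every matrix \<open>X\<close>: in the images of the simple root
  vectors at most one factor of a denominator has zeros on \<open>W\<close>, namely \<open>z\<^sub>1\<close> or \<open>-z\<^sub>1\<close>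
  (\<open>ladder_in_universal_ring\<close>), and commutators give the other matrix units. Since \<open>\<Phi>\<close> is multiplicative for the opposite product, the
  right action of the universal ring becomes a left action of the Lie algebra.

  Two technical points run through the proof. Meromorphic functions are classes of functions modulo
  agreement on a dense open set, so identities are first obtained on such a set and extended by
  continuity. And holomorphy means complex Frechet differentiability, for which division by \<open>z\<^sub>1\<close>
  (\<open>z1_divides\<close>) needs an argument: the quotient equals its mean over a circle in the direction of
  \<open>z\<^sub>1\<close> that avoids \<open>z\<^sub>1 = 0\<close>, and this mean can be differentiated under the integral sign.
\<close>

section \<open>Holomorphic functions of several variables\<close>

lemma norm_smult_complex: "norm (c *s (u :: complex ^ 'm::finite)) = norm c * norm u"
  by (simp add: norm_vec_def norm_mult L2_set_right_distrib)

lemma continuous_on_smult [continuous_intros]: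
  fixes u :: "'a::topological_space \<Rightarrow> complex ^ 'm::finite"
  assumes "continuous_on S c" "continuous_on S u"
  shows "continuous_on S (\<lambda>x. c x *s u x)"
  unfolding vector_scalar_mult_def
  by (intro continuous_on_vec_lambda continuous_intros assms)

lemma openE_double:
  assumes "open U" "p \<in> U"
  obtains d where "d > 0" "ball p (2 * d) \<subseteq> U"
proof -
  obtain e where e: "e > 0" "ball p e \<subseteq> U" using assms openE by blast
  show thesis by (rule that[of "e / 2"]) (use e in auto)
qed

lemma holo_on_frechet:
  assumes "f holo_on U" "x \<in> U"
  shows "(f has_derivative frechet_derivative f (at x)) (at x)"
    and "frechet_derivative f (at x) (c *s y) = c * frechet_derivative f (at x) y"
proof -
  obtain f' where f': "(f has_derivative f') (at x)" "\<forall>c y. f' (c *s y) = c * f' y"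
    using assms unfolding holo_on_def by blast
  have "f' = frechet_derivative f (at x)" by (rule frechet_derivative_at[OF f'(1)])
  then show "(f has_derivative frechet_derivative f (at x)) (at x)"
    "frechet_derivative f (at x) (c *s y) = c * frechet_derivative f (at x) y"
    using f' by auto
qed

lemma holo_on_imp_continuous_on: "f holo_on U \<Longrightarrow> continuous_on U f"
  by (meson continuous_at_imp_continuous_on has_derivative_continuous holo_on_frechet(1))

lemma holo_on_line_derivative:
  assumes "f holo_on U" "x + t *s u \<in> U"
  shows "((\<lambda>t. f (x + t *s u)) has_field_derivative frechet_derivative f (at (x + t *s u)) u) (at t)"
proof -
  have "bounded_linear (\<lambda>t::complex. t *s u)"
    by (rule linear_conv_bounded_linear[THEN iffD1], rule linearI)
      (simp_all add: vec_eq_iff algebra_simps)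
  then have "((\<lambda>t. x + t *s u) has_derivative (\<lambda>t. t *s u)) (at t)"
    by (auto intro!: derivative_eq_intros bounded_linear_imp_has_derivative)
  from has_derivative_compose[OF this holo_on_frechet(1)[OF assms]]
  show ?thesis
    unfolding has_field_derivative_def
    by (simp add: holo_on_frechet(2)[OF assms] mult.commute[of _ "frechet_derivative f (at (x + t *s u)) u"])
qed

lemma holo_on_line:
  assumes "f holo_on U" "\<And>t. t \<in> T \<Longrightarrow> x + t *s u \<in> U"
  shows "(\<lambda>t. f (x + t *s u)) holomorphic_on T"
  unfolding holomorphic_on_def field_differentiable_def
  using has_field_derivative_at_within[OF holo_on_line_derivative[OF assms(1,2)]] by blast

text \<open>The contour integral in Cauchy's formula, written over \<open>[0, 1]\<close>: in this form it can be
  differentiated under the integral sign with respect to parameters of \<open>f\<close>.\<close>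

lemma circle_mean_value:
  assumes "f holomorphic_on cball 0 r" "r > 0"
  shows "((\<lambda>t. f (of_real r * exp (2 * of_real pi * \<i> * of_real t))) has_integral f 0) {0..1}"
proof -
  have "((\<lambda>u. f u / (u - 0)) has_contour_integral (2 * of_real pi * \<i> * f 0)) (circlepath 0 r)"
    by (rule Cauchy_integral_circlepath_simple) (use assms in auto)
  then have "((\<lambda>t. 2 * of_real pi * \<i> * f (of_real r * exp (2 * of_real pi * \<i> * of_real t)))
      has_integral 2 * of_real pi * \<i> * f 0) {0..1}"
    unfolding has_contour_integral_def
  proof (rule has_integral_eq[rotated])
    fix t :: real assume "t \<in> {0..1}"
    then have d: "vector_derivative (circlepath 0 r) (at t within {0..1}) =
        2 * of_real pi * \<i> * circlepath 0 r t"
      by (simp add: vector_derivative_circlepath01) (simp add: circlepath)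
    have c: "circlepath 0 r t = of_real r * exp (2 * of_real pi * \<i> * of_real t)"
      by (simp add: circlepath)
    then have "circlepath 0 r t \<noteq> 0" using assms(2) by simp
    then show "f (circlepath 0 r t) / (circlepath 0 r t - 0) *
        vector_derivative (circlepath 0 r) (at t within {0..1}) =
      2 * of_real pi * \<i> * f (of_real r * exp (2 * of_real pi * \<i> * of_real t))"
      unfolding d c[symmetric] by simp
  qed
  from has_integral_mult_right[OF this, of "1 / (2 * of_real pi * \<i>)"] show ?thesis by simp
qed

text \<open>The mean value property of the difference quotient, whose value at the removed point is the
  derivative. It expresses a derivative through values of \<open>f\<close> on a circle, so that continuity of \<open>f\<close>
  passes to its derivatives.\<close>

lemma difference_quotient_mean_value:
  assumes "f holomorphic_on cball 0 r" "r > 0"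
  shows "((\<lambda>t. (f (of_real r * exp (2 * of_real pi * \<i> * of_real t)) - f 0) /
      (of_real r * exp (2 * of_real pi * \<i> * of_real t))) has_integral deriv f 0) {0..1}"
proof -
  have "(\<lambda>z. if z = 0 then deriv f 0 else (f z - f 0) / (z - 0)) holomorphic_on cball 0 r"
    by (rule pole_lemma) (use assms in auto)
  from circle_mean_value[OF this assms(2)] show ?thesis
    using assms(2) by simp
qed

text \<open>Holomorphy only asks for the derivative to exist at each point. Its continuity, which
  differentiation under an integral requires, comes from the integral over a circle in the direction
  \<open>u\<close>.\<close>

lemma holo_on_frechet_continuous:
  assumes "f holo_on U" "open U"
  shows "continuous_on U (\<lambda>x. frechet_derivative f (at x) u)"
  unfolding continuous_on_eq_continuous_at[OF assms(2)]
proof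
  fix p assume "p \<in> U"
  then obtain d where d: "d > 0" "ball p (2 * d) \<subseteq> U"
    using openE_double[OF assms(2)] by metis
  \<comment> \<open>The denominator is increased by \<open>1\<close> to cover \<open>u = 0\<close>; then the circle of radius \<open>r\<close> around a point
    of \<open>ball p d\<close> in the direction \<open>u\<close> stays in \<open>ball p (2 * d)\<close>.\<close>
  define r where "r = d / (norm u + 1)"
  have nu: "norm u + 1 > 0" using norm_ge_zero[of u] by linarith
  have r: "r > 0" "r * norm u < d"
    using d(1) nu unfolding r_def by (simp_all add: divide_simps)
  have inU: "x + t *s u \<in> U" if "x \<in> ball p d" "norm t \<le> r" for x t
  proof -
    have "norm (t *s u) < d"
      unfolding norm_smult_complex using that r(2) mult_right_mono[OF that(2), of "norm u"] by auto
    moreover have "dist p (x + t *s u) \<le> dist p x + norm (t *s u)"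
      by (metis add_diff_cancel_left' dist_commute dist_norm dist_triangle)
    ultimately have "x + t *s u \<in> ball p (2 * d)" using that(1) by simp
    then show ?thesis using d(2) by blast
  qed
  define e where "e = (\<lambda>t. of_real r * exp (2 * of_real pi * \<i> * of_real t) :: complex)"
  have e: "norm (e t) = r" "e t \<noteq> 0" for t
    using r by (auto simp: e_def norm_mult)
  have ce: "continuous_on S e" for S unfolding e_def by (intro continuous_intros)
  define F where "F = (\<lambda>x. integral {0..1} (\<lambda>t. (f (x + e t *s u) - f x) / e t))"
  have "continuous_on (ball p d \<times> cbox 0 1) (\<lambda>(x, t). (f (x + e t *s u) - f x) / e t)"
    unfolding case_prod_beta using inU[of _ 0] r(1) e
    by (intro continuous_intros continuous_on_compose2[OF holo_on_imp_continuous_on[OF assms(1)]]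
        continuous_on_compose2[OF ce]) (auto intro!: inU)
  then have "continuous_on (ball p d) F"
    unfolding F_def box_real[symmetric] by (rule integral_continuous_on_param)
  moreover have "F x = frechet_derivative f (at x) u" if "x \<in> ball p d" for x
  proof -
    have "(\<lambda>t. f (x + t *s u)) holomorphic_on cball 0 r"
      by (rule holo_on_line[OF assms(1)]) (use inU[OF that] in auto)
    from difference_quotient_mean_value[OF this r(1)]
    have "F x = deriv (\<lambda>t. f (x + t *s u)) 0"
      unfolding F_def e_def by (intro integral_unique) simp
    also have "\<dots> = frechet_derivative f (at (x + 0 *s u)) u"
      by (intro DERIV_imp_deriv holo_on_line_derivative[OF assms(1)] inU[OF that]) (use r in auto)
    finally show ?thesis by simp
  qed
  ultimately have "continuous_on (ball p d) (\<lambda>x. frechet_derivative f (at x) u)"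
    by (rule continuous_on_eq)
  then show "isCont (\<lambda>x. frechet_derivative f (at x) u) p"
    using d(1) by (simp add: continuous_on_eq_continuous_at)
qed

text \<open>The parameters \<open>c t\<close> will run through a circle, along which \<open>f\<close> is known to be holomorphic while
  nothing is assumed about the points inside.\<close>

lemma holo_on_average:
  fixes f :: "complex ^ 'm::finite \<Rightarrow> complex" and c :: "real \<Rightarrow> complex ^ 'm"
  assumes "f holo_on U" "open U" "open V" "continuous_on {0..1} c"
    and VU: "\<And>x t. x \<in> V \<Longrightarrow> t \<in> {0..1} \<Longrightarrow> x + c t \<in> U"
  shows "(\<lambda>x. integral {0..1} (\<lambda>t. f (x + c t))) holo_on V"
  unfolding holo_on_def
proof
  fix p assume "p \<in> V"
  then obtain d where d: "d > 0" "ball p d \<subseteq> V" using assms(3) openE by blast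
  define f' where "f' = (\<lambda>x. Blinfun (frechet_derivative f (at x)))"
  have f': "blinfun_apply (f' x) = frechet_derivative f (at x)" if "x \<in> U" for x
    unfolding f'_def using holo_on_frechet(1)[OF assms(1) that]
    by (simp add: bounded_linear_Blinfun_apply has_derivative_bounded_linear)
  have "continuous_on U (\<lambda>x. blinfun_apply (f' x) i)" for i
    using holo_on_frechet_continuous[OF assms(1,2), of i] f' by (simp cong: continuous_on_cong)
  then have cf': "continuous_on U f'" by (intro continuous_on_blinfun_componentwise)
  have c: "continuous_on (S \<times> {0..1}) (\<lambda>z. fst z + c (snd z))" for S
    by (intro continuous_intros continuous_on_compose2[OF assms(4)]) auto
  have cont: "continuous_on (ball p d \<times> cbox 0 1) (\<lambda>(x, t). f' (x + c t))"
    unfolding case_prod_beta box_real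
    by (rule continuous_on_compose2[OF cf' c]) (use VU d(2) in auto)
  have int: "(\<lambda>t. f (x + c t)) integrable_on cbox 0 1" if "x \<in> ball p d" for x
  proof -
    have "continuous_on {0..1} (\<lambda>t. x + c t)" by (intro continuous_intros assms(4))
    then have "continuous_on {0..1} (\<lambda>t. f (x + c t))"
      by (rule continuous_on_compose2[OF holo_on_imp_continuous_on[OF assms(1)]])
        (use VU d(2) that in blast)
    then show ?thesis unfolding box_real by (rule integrable_continuous_real)
  qed
  have der: "((\<lambda>x. f (x + c t)) has_derivative blinfun_apply (f' (x + c t))) (at x within ball p d)"
    if "x \<in> ball p d" "t \<in> cbox 0 1" for x t
  proof -
    have "x + c t \<in> U" using VU d(2) that by auto
    have "((\<lambda>x. x + c t) has_derivative (\<lambda>y. y)) (at x)"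
      by (auto intro!: derivative_eq_intros)
    from has_derivative_compose[OF this holo_on_frechet(1)[OF assms(1) \<open>x + c t \<in> U\<close>]]
    have "((\<lambda>x. f (x + c t)) has_derivative frechet_derivative f (at (x + c t))) (at x)" .
    then show ?thesis by (simp add: f'[OF \<open>x + c t \<in> U\<close>] has_derivative_at_withinI)
  qed
  let ?D = "integral (cbox 0 1) (\<lambda>t. f' (p + c t))"
  have "((\<lambda>x. integral (cbox 0 1) (\<lambda>t. f (x + c t))) has_derivative blinfun_apply ?D) (at p within ball p d)"
    using leibniz_rule[OF der int cont _ convex_ball, of p] d(1) by simp
  then have "((\<lambda>x. integral {0..1} (\<lambda>t. f (x + c t))) has_derivative blinfun_apply ?D) (at p)"
    using d(1) at_within_open[of p "ball p d"] by simp
  moreover have "blinfun_apply ?D (k *s y) = k * blinfun_apply ?D y" for k y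
  proof -
    have "continuous_on {0..1} (\<lambda>t. p + c t)" by (intro continuous_intros assms(4))
    then have "continuous_on {0..1} (\<lambda>t. f' (p + c t))"
      by (rule continuous_on_compose2[OF cf']) (use VU \<open>p \<in> V\<close> in blast)
    then have i: "(\<lambda>t. f' (p + c t)) integrable_on cbox 0 1"
      unfolding box_real by (rule integrable_continuous_real)
    have "f' (p + c t) (k *s y) = k * f' (p + c t) y" if "t \<in> cbox 0 1" for t
    proof -
      have "p + c t \<in> U" using VU \<open>p \<in> V\<close> that by simp
      then show ?thesis by (simp add: f' holo_on_frechet(2)[OF assms(1)])
    qed
    then have "integral (cbox 0 1) (\<lambda>t. f' (p + c t) (k *s y)) =
        integral (cbox 0 1) (\<lambda>t. k * f' (p + c t) y)"
      by (rule integral_cong)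
    then show ?thesis unfolding blinfun_apply_integral[OF i] integral_mult_right .
  qed
  ultimately show "\<exists>D. ((\<lambda>x. integral {0..1} (\<lambda>t. f (x + c t))) has_derivative D) (at p) \<and>
      (\<forall>k y. D (k *s y) = k * D y)"
    by (rule_tac x = "blinfun_apply ?D" in exI) simp
qed

lemma holo_on_uminus: "f holo_on U \<Longrightarrow> (\<lambda>x. - f x) holo_on U"
  using holo_on_mult[OF holo_on_const[of "-1"]] by simp

lemma holo_on_sum: "(\<And>i. i \<in> I \<Longrightarrow> f i holo_on U) \<Longrightarrow> (\<lambda>x. \<Sum>i\<in>I. f i x) holo_on U"
  by (induction I rule: infinite_finite_induct) (auto intro: holo_on_const holo_on_add)

lemma holo_on_prod: "(\<And>i. i \<in> I \<Longrightarrow> f i holo_on U) \<Longrightarrow> (\<lambda>x. \<Prod>i\<in>I. f i x) holo_on U"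
  by (induction I rule: infinite_finite_induct) (auto intro: holo_on_const holo_on_mult)

lemma holo_on_inverse:
  assumes "f holo_on U" "\<And>x. x \<in> U \<Longrightarrow> f x \<noteq> 0"
  shows "(\<lambda>x. inverse (f x)) holo_on U"
  unfolding holo_on_def
proof
  fix x assume x: "x \<in> U"
  show "\<exists>f'. ((\<lambda>x. inverse (f x)) has_derivative f') (at x) \<and> (\<forall>c y. f' (c *s y) = c * f' y)"
    by (rule exI, rule conjI, rule Deriv.has_derivative_inverse[OF assms(2)[OF x] holo_on_frechet(1)[OF assms(1) x]])
      (simp add: holo_on_frechet(2)[OF assms(1) x])
qed

lemma holo_on_divide:
  assumes "f holo_on U" "g holo_on U" "\<And>x. x \<in> U \<Longrightarrow> g x \<noteq> 0"
  shows "(\<lambda>x. f x / g x) holo_on U"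
  using holo_on_mult[OF assms(1) holo_on_inverse[OF assms(2,3)]] by (simp add: divide_inverse)

lemma holo_on_component: "(\<lambda>x. x $ i) holo_on U"
  unfolding holo_on_def
  by (intro ballI exI[of _ "\<lambda>x. x $ i"]) (auto intro: bounded_linear_imp_has_derivative bounded_linear_vec_nth)

lemma holo_on_diff: "f holo_on U \<Longrightarrow> g holo_on U \<Longrightarrow> (\<lambda>x. f x - g x) holo_on U"
  using holo_on_add[OF _ holo_on_uminus, of f U g] by simp

lemma holo_on_cong:
  assumes "open U" "\<And>x. x \<in> U \<Longrightarrow> f x = g x" "f holo_on U" shows "g holo_on U"
  unfolding holo_on_def
proof
  fix x assume x: "x \<in> U"
  have "(g has_derivative frechet_derivative f (at x)) (at x)"
    by (rule has_derivative_transform_within_open[OF holo_on_frechet(1)[OF assms(3) x] assms(1) x assms(2)])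
  then show "\<exists>f'. (g has_derivative f') (at x) \<and> (\<forall>c y. f' (c *s y) = c * f' y)"
    using holo_on_frechet(2)[OF assms(3) x] by blast
qed

lemma holo_on_locally:
  assumes "\<And>p. p \<in> U \<Longrightarrow> \<exists>V. p \<in> V \<and> f holo_on V" shows "f holo_on U"
  using assms unfolding holo_on_def by blast

section \<open>Division by the singular coordinate\<close>

text \<open>The direction in which \<open>z\<^sub>1\<close> grows with unit speed while \<open>z\<^sub>2, z\<^sub>3, \<dots>\<close> stay fixed.\<close>

abbreviation z1_dir :: "'n::finite tab_index \<Rightarrow> 'n tab_index \<Rightarrow> 'n tab"
  where "z1_dir a b \<equiv> (1/2) *s (axis a 1 - axis b 1)"

lemma z1_along: "a \<noteq> b \<Longrightarrow> z1 a b (x + t *s z1_dir a b) = z1 a b x + t"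
  by (simp add: z1_def axis_def algebra_simps)

lemma holo_on_z1: "z1 a b holo_on U"
  unfolding z1_def[abs_def] by (intro holo_on_diff holo_on_component)

text \<open>Off the hyperplane \<open>z\<^sub>1 = 0\<close> the quotient is holomorphic. On a line in the direction of \<open>z\<^sub>1\<close> it has
  a removable singularity, so near a point of the hyperplane it equals its mean over a circle on that
  line. The radius is chosen larger than \<open>\<bar>z\<^sub>1\<bar>\<close>, so the circle misses the hyperplane and the mean is
  holomorphic in all variables.\<close>

lemma z1_divides:
  assumes "a \<noteq> b" "open U" "f holo_on U" "\<And>x. x \<in> U \<Longrightarrow> z1 a b x = 0 \<Longrightarrow> f x = 0"
  obtains g where "g holo_on U" "\<And>x. x \<in> U \<Longrightarrow> f x = z1 a b x * g x"
proof
  define u where "u = z1_dir a b"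
  have along: "z1 a b (x + t *s u) = z1 a b x + t" for x t
    unfolding u_def by (rule z1_along[OF assms(1)])
  \<comment> \<open>On the hyperplane the quotient is the derivative of \<open>f\<close> in the direction of \<open>z\<^sub>1\<close>.\<close>
  define g where "g = (\<lambda>x. if z1 a b x = 0 then deriv (\<lambda>t. f (x + t *s u)) 0 else f x / z1 a b x)"
  show "f x = z1 a b x * g x" if "x \<in> U" for x
    using assms(4)[OF that] unfolding g_def by (cases "z1 a b x = 0") auto
  define Z where "Z = {x \<in> U. z1 a b x \<noteq> 0}"
  have Z: "open Z" unfolding Z_def by (rule holo_on_imp_open_nonzero[OF holo_on_z1 assms(2)])
  have "f holo_on Z" by (rule holo_on_subset[OF assms(3)]) (simp add: Z_def)
  then have "(\<lambda>x. f x / z1 a b x) holo_on Z"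
    by (rule holo_on_divide[OF _ holo_on_z1]) (simp add: Z_def)
  then have gZ: "g holo_on Z"
  proof (rule holo_on_cong[OF Z, rotated])
    fix x assume "x \<in> Z"
    then have "z1 a b x \<noteq> 0" unfolding Z_def by blast
    then show "f x / z1 a b x = g x" unfolding g_def by (rule if_not_P[symmetric])
  qed
  show "g holo_on U"
  proof (rule holo_on_locally)
    fix p assume p: "p \<in> U"
    show "\<exists>V. p \<in> V \<and> g holo_on V"
    proof (cases "z1 a b p = 0")
      case False
      then have "p \<in> Z" using p by (simp add: Z_def)
      then show ?thesis using gZ by blast
    next
      case True
      obtain d where d: "d > 0" "ball p (2 * d) \<subseteq> U"
        using openE_double[OF assms(2) p] .
      define r where "r = d / (norm u + 1)"
      have nu: "norm u + 1 > 0" using norm_ge_zero[of u] by linarith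
      have r: "r > 0" "r * norm u < d"
        using d(1) nu unfolding r_def by (simp_all add: divide_simps)
      define V where "V = ball p d \<inter> {x. norm (z1 a b x) < r}"
      have "open {x. norm (z1 a b x) < r}"
        by (rule open_Collect_less[OF continuous_on_norm[OF holo_on_imp_continuous_on[OF holo_on_z1]]
              continuous_on_const])
      then have V: "open V" unfolding V_def by auto
      have inU: "x + t *s u \<in> U" if "x \<in> V" "norm t \<le> r" for x t
      proof -
        have "norm (t *s u) < d"
          unfolding norm_smult_complex[of t] using that r(2) mult_right_mono[OF that(2), of "norm u"] by auto
        moreover have "dist p (x + t *s u) \<le> dist p x + norm (t *s u)"
          by (metis add_diff_cancel_left' dist_commute dist_norm dist_triangle)
        ultimately have "x + t *s u \<in> ball p (2 * d)" using that(1) unfolding V_def by simp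
        then show ?thesis using d(2) by blast
      qed
      define e where "e = (\<lambda>t. of_real r * exp (2 * of_real pi * \<i> * of_real t) :: complex)"
      have e: "norm (e t) = r" "e t \<noteq> 0" for t
        using r by (auto simp: e_def norm_mult)
      have ce: "continuous_on S e" for S unfolding e_def by (intro continuous_intros)
      have "(\<lambda>x. integral {0..1} (\<lambda>t. g (x + e t *s u))) holo_on V"
      proof (rule holo_on_average[OF gZ Z V])
        fix x and t :: real assume x: "x \<in> V"
        \<comment> \<open>The circle has radius \<open>r\<close> and \<open>\<bar>z\<^sub>1 x\<bar> < r\<close>, so it does not meet the hyperplane.\<close>
        have "z1 a b x + e t \<noteq> 0"
          using x e(1)[of t] norm_minus_cancel[of "e t"] unfolding V_def
          by (auto simp: add_eq_0_iff2)
        then show "x + e t *s u \<in> Z"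
          unfolding Z_def using inU[OF x, of "e t"] e(1)[of t] along by simp
      qed (intro continuous_intros ce)
      moreover have "integral {0..1} (\<lambda>t. g (x + e t *s u)) = g x" if x: "x \<in> V" for x
      proof -
        have "(\<lambda>t. g (x + t *s u)) holomorphic_on cball 0 r"
        proof -
          \<comment> \<open>The parameter at which the line meets the hyperplane.\<close>
          define w where "w = - z1 a b x"
          define \<phi> where "\<phi> = (\<lambda>t. f (x + t *s u))"
          have w: "w \<in> ball 0 r" using x unfolding w_def V_def by simp
          have "\<phi> holomorphic_on cball 0 r"
            unfolding \<phi>_def by (rule holo_on_line[OF assms(3)]) (use inU[OF x] in auto)
          then have "(\<lambda>t. if t = w then deriv \<phi> w else (\<phi> t - \<phi> w) / (t - w)) holomorphic_on cball 0 r"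
            by (rule pole_lemma) (use w in auto)
          moreover have "(if t = w then deriv \<phi> w else (\<phi> t - \<phi> w) / (t - w)) = g (x + t *s u)"
            if "t \<in> cball 0 r" for t
          proof -
            have "\<phi> w = 0"
              unfolding \<phi>_def
            proof (rule assms(4))
              show "x + w *s u \<in> U" by (rule inU[OF x]) (use w in auto)
              show "z1 a b (x + w *s u) = 0" unfolding along by (simp add: w_def)
            qed
            moreover have "deriv (\<lambda>s. f (x + w *s u + s *s u)) 0 = deriv \<phi> w"
            proof -
              have m: "x + w *s u \<in> U" by (rule inU[OF x]) (use w in auto)
              then have m0: "x + w *s u + 0 *s u \<in> U" by simp
              show ?thesis
                using DERIV_imp_deriv[OF holo_on_line_derivative[OF assms(3) m0]]
                  DERIV_imp_deriv[OF holo_on_line_derivative[OF assms(3) m]]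
                unfolding \<phi>_def by simp
            qed
            moreover have "(z1 a b x + t = 0) = (t = w)" "t - w = z1 a b x + t"
              unfolding w_def by (auto simp: add_eq_0_iff2)
            ultimately show ?thesis
              unfolding g_def along by (simp add: \<phi>_def)
          qed
          ultimately show ?thesis by (rule holomorphic_transform)
        qed
        from circle_mean_value[OF this r(1)] show ?thesis
          unfolding e_def by (intro integral_unique) simp
      qed
      ultimately have "g holo_on V" by (rule holo_on_cong[OF V, rotated])
      moreover have "p \<in> V" unfolding V_def using True d(1) r(1) by simp
      ultimately show ?thesis by blast
    qed
  qed
qed

section \<open>Meromorphic functions modulo agreement on dense open sets\<close>

lemma agree_on_continuous_eq:
  fixes f g :: "'a::topological_space \<Rightarrow> complex"
  assumes "agree_on U f g" "open U" "continuous_on U f" "continuous_on U g" "p \<in> U"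
  shows "f p = g p"
proof (rule ccontr)
  assume ne: "f p \<noteq> g p"
  obtain D where D: "open D" "D \<subseteq> U" "U \<subseteq> closure D" "\<forall>x\<in>D. f x = g x"
    using assms(1) unfolding agree_on_def by auto
  have "continuous_on U (\<lambda>x. f x - g x)" by (intro continuous_intros assms)
  then have "open (U \<inter> (\<lambda>x. f x - g x) -` (- {0}))"
    using assms(2) continuous_open_preimage by blast
  moreover have "p \<in> U \<inter> (\<lambda>x. f x - g x) -` (- {0})" using assms(5) ne by simp
  moreover have "p \<in> closure D" using assms(5) D(3) by blast
  ultimately obtain x where "x \<in> D" "x \<in> U \<inter> (\<lambda>x. f x - g x) -` (- {0})"
    by (metis (no_types, lifting) closure_iff_nhds_not_empty disjoint_iff order_refl)
  then show False using D(4) by simp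
qed

lemma holo_agree_eq:
  assumes "agree_on U f g" "open U" "f holo_on U" "g holo_on U" "p \<in> U" shows "f p = g p"
  using agree_on_continuous_eq[OF assms(1,2) _ _ assms(5)] holo_on_imp_continuous_on assms(3,4) by blast

text \<open>Two holomorphic extensions agree on a dense set, hence everywhere by continuity; so the
  definite description in \<^const>\<open>hol_value\<close> picks the value of any one of them.\<close>

lemma hol_value_eq:
  assumes "open U" "p \<in> U" "g holo_on U" "agree_on U f g"
  shows "hol_value f p = g p"
proof -
  have "c = g p" if "\<exists>V k. open V \<and> p \<in> V \<and> k holo_on V \<and> agree_on V f k \<and> c = k p" for c
  proof -
    from that obtain V k where "open V \<and> p \<in> V \<and> k holo_on V \<and> agree_on V f k \<and> c = k p"
      by (elim exE)
    then have k: "open V" "p \<in> V" "k holo_on V" "agree_on V f k" "c = k p" by simp_all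
    have UV: "open (U \<inter> V)" using assms(1) k(1) by (rule open_Int)
    have "agree_on (U \<inter> V) k f" "agree_on (U \<inter> V) f g"
      using agree_on_sym[OF agree_on_subset[OF k(4) UV]] agree_on_subset[OF assms(4) UV] by simp_all
    then have "agree_on (U \<inter> V) k g" by (rule agree_on_trans)
    then have "k p = g p"
      by (rule holo_agree_eq[OF _ UV]) (use assms(2,3) k(2,3) in \<open>auto intro: holo_on_subset\<close>)
    then show ?thesis using k(5) by simp
  qed
  moreover have "\<exists>V k. open V \<and> p \<in> V \<and> k holo_on V \<and> agree_on V f k \<and> g p = k p"
    by (rule exI[of _ U], rule exI[of _ g]) (simp add: assms)
  ultimately have "(THE c. \<exists>V k. open V \<and> p \<in> V \<and> k holo_on V \<and> agree_on V f k \<and> c = k p) = g p"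
    by (intro the_equality)
  moreover have "\<exists>V k. open V \<and> p \<in> V \<and> k holo_on V \<and> agree_on V f k"
    by (rule exI[of _ U], rule exI[of _ g]) (simp add: assms)
  ultimately show ?thesis unfolding hol_value_def by simp
qed

text \<open>Where a local denominator does not vanish, the function is itself holomorphic and coincides
  with its extension; these points are dense.\<close>

lemma mero_value_mero_of:
  assumes "meromorphic f" shows "agree_on UNIV (mero_value (mero_of f)) f"
proof -
  define D where "D = \<Union>{U. open U \<and> f holo_on U}"
  have "mero_value (mero_of f) = hol_value f"
    unfolding mero_of_def using assms
    by (intro mero_value.abs_eq) (simp add: mero_rel_def agree_on_refl)
  moreover have "hol_value f x = f x" if "x \<in> D" for x
  proof -
    from that obtain U where "open U" "x \<in> U" "f holo_on U" unfolding D_def by auto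
    then show ?thesis using hol_value_eq agree_on_refl by metis
  qed
  moreover have "p \<in> closure D" for p
  proof -
    obtain U g h where U: "open U" "p \<in> U" "g holo_on U" "h holo_on U"
      "U \<subseteq> closure {x\<in>U. h x \<noteq> 0}" "\<forall>x\<in>U. h x \<noteq> 0 \<longrightarrow> f x = g x / h x"
      using assms[unfolded meromorphic_def] by meson
    let ?Z = "{x\<in>U. h x \<noteq> 0}"
    have Z: "open ?Z" by (rule holo_on_imp_open_nonzero[OF U(4,1)])
    have "(\<lambda>x. g x / h x) holo_on ?Z"
      by (rule holo_on_divide) (use U(3,4) in \<open>auto intro: holo_on_subset\<close>)
    then have "f holo_on ?Z" by (rule holo_on_cong[OF Z, rotated]) (use U(6) in simp)
    then have "?Z \<subseteq> D" unfolding D_def using Z by (intro Union_upper) simp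
    then show ?thesis using U(2,5) closure_mono[of ?Z D] by blast
  qed
  moreover have "open D" unfolding D_def by (rule open_Union) simp
  ultimately show ?thesis unfolding agree_on_def by (intro exI[of _ D]) auto
qed

lemma mero_obtain_representative:
  obtains f where "meromorphic f" "m = mero_of f"
proof (induction m rule: mero.abs_induct)
  case (1 f)
  then show ?case by (metis mero_of_def mero_rel_def)
qed

lemma mero_of_ops:
  assumes "meromorphic f" "meromorphic g"
  shows "mero_of f + mero_of g = mero_of (\<lambda>x. f x + g x)"
    "mero_of f * mero_of g = mero_of (\<lambda>x. f x * g x)"
  using assms unfolding mero_of_def
  by (simp_all add: plus_mero.abs_eq times_mero.abs_eq mero_rel_def agree_on_refl)

lemma mero_value_const:
  fixes p :: "complex ^ 'm::finite"
  shows "mero_value (mero_of (\<lambda>x. c)) p = c"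
proof -
  have "mero_value (mero_of (\<lambda>x :: complex ^ 'm. c)) = hol_value (\<lambda>x. c)"
    unfolding mero_of_def
    by (intro mero_value.abs_eq) (simp add: mero_rel_def agree_on_refl meromorphic_const)
  then show ?thesis
    using hol_value_eq[of UNIV p "\<lambda>x. c" "\<lambda>x. c"] by (simp add: holo_on_const agree_on_refl)
qed

lemma mero_of_zero: "mero_of (\<lambda>x. 0) = 0" and mero_of_one: "mero_of (\<lambda>x. 1) = 1"
  unfolding mero_of_def zero_mero_def one_mero_def by simp_all

lemma mero_value_zero: "mero_value 0 p = 0" and mero_value_one: "mero_value 1 p = 1"
  using mero_value_const[of 0 p] mero_value_const[of 1 p] by (simp_all add: mero_of_zero mero_of_one)

text \<open>Values are not additive point by point: poles of the summands may cancel, and a summand with a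
  pole is assigned the value \<open>0\<close> there. Hence only agreement on a dense open set.\<close>

lemma mero_value_add: "agree_on UNIV (mero_value (m + m')) (\<lambda>x. mero_value m x + mero_value m' x)"
proof -
  obtain f g where fg: "meromorphic f" "m = mero_of f" "meromorphic g" "m' = mero_of g"
    by (metis mero_obtain_representative)
  have "agree_on UNIV (\<lambda>x. f x + g x) (\<lambda>x. mero_value m x + mero_value m' x)"
    by (rule agree_on_binop[of _ _ _ _ _ "(+)"]) (simp_all add: fg mero_value_mero_of agree_on_sym)
  then show ?thesis
    using agree_on_trans[OF mero_value_mero_of[OF meromorphic_add[OF fg(1,3)]]]
    by (simp add: fg mero_of_ops)
qed

lemma mero_value_mult: "agree_on UNIV (mero_value (m * m')) (\<lambda>x. mero_value m x * mero_value m' x)"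
proof -
  obtain f g where fg: "meromorphic f" "m = mero_of f" "meromorphic g" "m' = mero_of g"
    by (metis mero_obtain_representative)
  have "agree_on UNIV (\<lambda>x. f x * g x) (\<lambda>x. mero_value m x * mero_value m' x)"
    by (rule agree_on_binop[of _ _ _ _ _ "(*)"]) (simp_all add: fg mero_value_mero_of agree_on_sym)
  then show ?thesis
    using agree_on_trans[OF mero_value_mero_of[OF meromorphic_mult[OF fg(1,3)]]]
    by (simp add: fg mero_of_ops)
qed

lemma meromorphic_shift:
  "meromorphic f \<Longrightarrow> meromorphic (f \<circ> inv (shift_tab \<sigma>))"
  using mero_rel_shift[of f f \<sigma>] by (simp add: mero_rel_def agree_on_refl)

lemma meromorphic_perm:
  "meromorphic f \<Longrightarrow> meromorphic (f \<circ> inv (perm_tab s))"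
  using mero_rel_perm[of f f s] by (simp add: mero_rel_def agree_on_refl)

lemma shift_mero_mero_of: "meromorphic f \<Longrightarrow> shift_mero \<sigma> (mero_of f) = mero_of (f \<circ> inv (shift_tab \<sigma>))"
  unfolding mero_of_def by (intro shift_mero.abs_eq) (simp add: mero_rel_def agree_on_refl)

lemma perm_mero_mero_of: "meromorphic f \<Longrightarrow> perm_mero s (mero_of f) = mero_of (f \<circ> inv (perm_tab s))"
  unfolding mero_of_def by (intro perm_mero.abs_eq) (simp add: mero_rel_def agree_on_refl)

lemma agree_on_shift:
  assumes "agree_on U f g" "\<And>\<sigma>. shift_tab \<sigma> ` U = U"
  shows "agree_on U (\<lambda>x. f (shift_tab \<sigma> x)) (\<lambda>x. g (shift_tab \<sigma> x))"
proof -
  have i: "shift_tab (- \<sigma>) (shift_tab \<sigma> x) = x" "shift_tab \<sigma> (shift_tab (- \<sigma>) x) = x" for x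
    by (simp_all add: shift_tab_add[symmetric] shift_tab_zero)
  have "shift_tab \<sigma> -` U = U"
  proof -
    have "shift_tab \<sigma> -` U = shift_tab \<sigma> -` (shift_tab \<sigma> ` U)" using assms(2) by simp
    also have "\<dots> = U" by (rule inj_vimage_image_eq[OF bij_is_inj[OF bij_shift_tab]])
    finally show ?thesis .
  qed
  then show ?thesis
    using agree_on_comp[OF assms(1) i(2) i(1) continuous_shift_tab continuous_shift_tab] by simp
qed

lemma linear_row_perm: "linear (perm_tab s)" "linear (inv (perm_tab s))"
  unfolding inv_perm_tab by (rule linearI; simp add: vec_eq_iff perm_tab.rep_eq)+

lemma continuous_perm_tab: "continuous_on S (perm_tab s)" "continuous_on S (inv (perm_tab s))"
  using linear_row_perm linear_continuous_on linear_conv_bounded_linear by blast+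

lemma perm_tab_inverse: "inv (perm_tab s) (perm_tab s x) = x" "perm_tab s (inv (perm_tab s) x) = x"
  using bij_perm_tab[of s] by (simp_all add: bij_is_inj bij_is_surj surj_f_inv_f)

lemma agree_on_perm:
  assumes "agree_on UNIV f g"
  shows "agree_on UNIV (\<lambda>x. f (inv (perm_tab s) x)) (\<lambda>x. g (inv (perm_tab s) x))"
  using agree_on_comp[OF assms perm_tab_inverse continuous_perm_tab(2,1)] by simp

lemma mero_value_shift:
  "agree_on UNIV (mero_value (shift_mero \<sigma> m)) (\<lambda>x. mero_value m (shift_tab (- \<sigma>) x))"
proof -
  obtain f where f: "meromorphic f" "m = mero_of f" by (rule mero_obtain_representative)
  have "agree_on UNIV (\<lambda>x. f (shift_tab (- \<sigma>) x)) (\<lambda>x. mero_value m (shift_tab (- \<sigma>) x))"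
    by (rule agree_on_shift[OF agree_on_sym]) (simp_all add: f mero_value_mero_of bij_shift_tab bij_is_surj)
  then show ?thesis
    using agree_on_trans[OF mero_value_mero_of[OF meromorphic_shift[OF f(1), of \<sigma>]]]
    by (simp add: f shift_mero_mero_of inv_shift_tab comp_def)
qed

lemma mero_value_perm:
  "agree_on UNIV (mero_value (perm_mero s m)) (\<lambda>x. mero_value m (inv (perm_tab s) x))"
proof -
  obtain f where f: "meromorphic f" "m = mero_of f" by (rule mero_obtain_representative)
  have "agree_on UNIV (\<lambda>x. f (inv (perm_tab s) x)) (\<lambda>x. mero_value m (inv (perm_tab s) x))"
    by (rule agree_on_perm[OF agree_on_sym]) (simp_all add: f mero_value_mero_of)
  then show ?thesis
    using agree_on_trans[OF mero_value_mero_of[OF meromorphic_perm[OF f(1), of s]]]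
    by (simp add: f perm_mero_mero_of comp_def)
qed

lemma meromorphic_quotient:
  assumes "g holo_on UNIV" "h holo_on UNIV" "closure {x. h x \<noteq> 0} = UNIV"
  shows "meromorphic (\<lambda>x. g x / h x)"
  unfolding meromorphic_def
  by (intro allI exI[of _ UNIV] exI[of _ g] exI[of _ h]) (use assms in auto)

declare agree_on_trans [trans]

lemma agree_on_sum:
  fixes f g :: "'i \<Rightarrow> 'a::topological_space \<Rightarrow> 'b::comm_monoid_add"
  assumes "open U" "\<And>i. i \<in> I \<Longrightarrow> agree_on U (f i) (g i)"
  shows "agree_on U (\<lambda>x. \<Sum>i\<in>I. f i x) (\<lambda>x. \<Sum>i\<in>I. g i x)"
  using assms(2)
proof (induction I rule: infinite_finite_induct)
  case (insert i I)
  then show ?case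
    using agree_on_binop[of U "f i" "g i" "\<lambda>x. \<Sum>i\<in>I. f i x" "\<lambda>x. \<Sum>i\<in>I. g i x" "(+)"] by simp
qed (simp_all add: agree_on_refl[OF assms(1)])

lemma agree_on_add: "agree_on U f f' \<Longrightarrow> agree_on U g g' \<Longrightarrow>
    agree_on U (\<lambda>x. f x + g x) (\<lambda>x. f' x + g' x :: 'b :: plus)"
  by (rule agree_on_binop)

lemma agree_on_mult: "agree_on U f f' \<Longrightarrow> agree_on U g g' \<Longrightarrow>
    agree_on U (\<lambda>x. f x * g x) (\<lambda>x. f' x * g' x :: 'b :: times)"
  by (rule agree_on_binop)

lemma agree_on_eqI: "open U \<Longrightarrow> (\<And>x. x \<in> U \<Longrightarrow> f x = g x) \<Longrightarrow> agree_on U f g"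
  unfolding agree_on_def using closure_subset by (intro exI[of _ U]) auto

lemma agree_on_UNIV: "agree_on UNIV f g \<Longrightarrow> open U \<Longrightarrow> agree_on U f g"
  by (rule agree_on_subset) auto

lemma mero_value_eq:
  assumes "open U" "g holo_on U" "agree_on U (mero_value m) g" "p \<in> U"
  shows "mero_value m p = g p"
proof -
  obtain f where f: "meromorphic f" "m = mero_of f" by (rule mero_obtain_representative)
  have "agree_on U f g"
    using agree_on_trans[OF agree_on_sym[OF agree_on_UNIV[OF mero_value_mero_of[OF f(1)] assms(1)]]]
      assms(3) by (simp add: f(2))
  moreover have "mero_value m = hol_value f"
    unfolding f(2) mero_of_def using f(1)
    by (intro mero_value.abs_eq) (simp add: mero_rel_def agree_on_refl)
  ultimately show ?thesis using hol_value_eq[OF assms(1,4,2)] by simp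
qed

lemma meromorphic_holo: "f holo_on UNIV \<Longrightarrow> meromorphic f"
  using meromorphic_quotient[of f "\<lambda>_. 1"] by (simp add: holo_on_const)

lemma mero_value_uminus: "agree_on UNIV (mero_value (- m)) (\<lambda>x. - mero_value m x)"
proof -
  have "agree_on UNIV (\<lambda>x. mero_value (m + - m) x - mero_value m x)
      (\<lambda>x. (mero_value m x + mero_value (- m) x) - mero_value m x)"
    by (rule agree_on_binop[of _ _ _ _ _ "(-)", OF mero_value_add agree_on_refl[OF open_UNIV]])
  then show ?thesis by (simp add: mero_value_zero agree_on_sym)
qed

section \<open>The skew group ring and its operators\<close>

lemma monomial_Abs: "fn f * grp \<sigma> = Abs_skew_ring (Poly_Mapping.single \<sigma> f)"
  unfolding fn_def grp_def times_skew_ring_def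
  by (simp add: Abs_skew_ring_inverse skew_times_single shift_mero_hom shift_mero_zero)

lemma monomial_mult: "(fn f * grp \<sigma>) * (fn g * grp \<rho>) = fn (f * shift_mero \<sigma> g) * grp (\<sigma> + \<rho>)"
  unfolding monomial_Abs unfolding times_skew_ring_def
  by (simp add: Abs_skew_ring_inverse skew_times_single)

lemma coeff_add: "coeff (A + B) \<sigma> = coeff A \<sigma> + coeff B \<sigma>"
  by (simp add: coeff_def plus_skew_ring.rep_eq lookup_add)

lemma coeff_zero: "coeff 0 \<sigma> = 0"
  by (simp add: coeff_def zero_skew_ring.rep_eq)

lemma coeff_uminus: "coeff (- A) \<sigma> = - coeff A \<sigma>"
  by (simp add: coeff_def uminus_skew_ring.rep_eq)

lemma coeff_one: "coeff 1 \<sigma> = (if \<sigma> = 0 then 1 else 0)"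
  by (simp add: coeff_def one_skew_ring.rep_eq lookup_single when_def flip: single_one)

lemma coeff_sum: "coeff (\<Sum>i\<in>I. A i) \<sigma> = (\<Sum>i\<in>I. coeff (A i) \<sigma>)"
  by (induction I rule: infinite_finite_induct) (simp_all add: coeff_add coeff_zero)

lemma skew_eqI: "(\<And>\<sigma>. coeff A \<sigma> = coeff B \<sigma>) \<Longrightarrow> A = B"
  unfolding coeff_def by (metis Rep_skew_ring_inject poly_mapping_eqI)

lemma finite_supp: "finite (supp A)"
  by (simp add: supp_def)

lemma supp_iff: "\<sigma> \<in> supp A \<longleftrightarrow> coeff A \<sigma> \<noteq> 0"
  by (simp add: supp_def coeff_def in_keys_iff)

lemma supp_monomial: "supp (fn f * grp \<sigma>) \<subseteq> {\<sigma>}"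
  by (auto simp: supp_iff coeff_fn_grp split: if_splits)

lemma coeff_monomial_sum:
  "finite I \<Longrightarrow> coeff (\<Sum>\<sigma>\<in>I. fn (h \<sigma>) * grp \<sigma>) \<rho> = (if \<rho> \<in> I then h \<rho> else 0)"
  by (simp add: coeff_sum coeff_fn_grp)

lemma fn_as_monomial: "fn f * grp 0 = fn f"
  unfolding monomial_Abs unfolding fn_def ..

lemma one_as_monomial: "fn 1 * grp 0 = 1"
  by (rule skew_eqI) (simp add: coeff_one coeff_fn_grp)

lemma grp_as_monomial: "fn 1 * grp \<sigma> = grp \<sigma>"
  using one_as_monomial by (metis fn_as_monomial mult_1)

lemma skew_ring_induct [case_names zero monomial add]:
  assumes "P 0" "\<And>f \<sigma>. P (fn f * grp \<sigma>)" "\<And>A B. P A \<Longrightarrow> P B \<Longrightarrow> P (A + B)"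
  shows "P A"
proof -
  have "P (Abs_skew_ring p)" for p
  proof (induction p rule: poly_mapping_single_induct)
    case 1
    show ?case using assms(1) by (simp add: zero_skew_ring_def)
  next
    case (2 \<sigma> f)
    show ?case using assms(2)[of f \<sigma>] by (simp add: monomial_Abs)
  next
    case (3 p q)
    have "Abs_skew_ring (p + q) = Abs_skew_ring p + Abs_skew_ring q"
      by (simp add: plus_skew_ring_def Abs_skew_ring_inverse)
    then show ?case using assms(3) 3 by simp
  qed
  from this[of "Rep_skew_ring A"] show ?thesis by (simp add: Rep_skew_ring_inverse)
qed

lemma coeff_monomial_times: "coeff (fn f * grp \<sigma> * B) \<rho> = f * shift_mero \<sigma> (coeff B (\<rho> - \<sigma>))"
proof (induction B rule: skew_ring_induct)
  case (monomial g \<mu>)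
  have "\<rho> - \<sigma> = \<mu> \<longleftrightarrow> \<rho> = \<sigma> + \<mu>" by (auto simp: algebra_simps)
  then show ?case by (auto simp: monomial_mult coeff_fn_grp shift_mero_hom)
qed (simp_all add: coeff_zero coeff_add shift_mero_hom distrib_left)

lemma skew_ring_expand: "A = (\<Sum>\<sigma>\<in>supp A. fn (coeff A \<sigma>) * grp \<sigma>)"
  by (rule skew_eqI) (simp add: coeff_monomial_sum finite_supp supp_iff)

text \<open>The left factor stays expanded in its support: this isolates the coefficients \<open>h\<^sub>\<sigma>\<close> whose poles have to
  be compared with the shifted poles of \<open>B\<close>.\<close>

lemma coeff_times: "coeff (A * B) \<rho> = (\<Sum>\<sigma>\<in>supp A. coeff A \<sigma> * shift_mero \<sigma> (coeff B (\<rho> - \<sigma>)))"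
proof -
  have "A * B = (\<Sum>\<sigma>\<in>supp A. fn (coeff A \<sigma>) * grp \<sigma> * B)"
    by (subst skew_ring_expand) (simp add: sum_distrib_right)
  then show ?thesis by (simp add: coeff_sum coeff_monomial_times)
qed

lemma perm_mero_hom:
  "perm_mero s (f + g) = perm_mero s f + perm_mero s g"
  "perm_mero s (f * g) = perm_mero s f * perm_mero s g"
  "perm_mero s 0 = 0" "perm_mero s 1 = 1"
proof -
  obtain f' g' where fg: "meromorphic f'" "f = mero_of f'" "meromorphic g'" "g = mero_of g'"
    by (metis mero_obtain_representative)
  show "perm_mero s (f + g) = perm_mero s f + perm_mero s g"
    "perm_mero s (f * g) = perm_mero s f * perm_mero s g"
    using fg meromorphic_perm[OF fg(1), of s] meromorphic_perm[OF fg(3), of s]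
    by (simp_all add: mero_of_ops perm_mero_mero_of meromorphic_add meromorphic_mult comp_def)
  show "perm_mero s 0 = 0" "perm_mero s 1 = 1"
    unfolding mero_of_zero[symmetric] mero_of_one[symmetric]
    by (simp_all add: perm_mero_mero_of meromorphic_const comp_def)
qed

lemma shift_at_ops:
  "shift_at (\<sigma> + \<rho>) c = shift_at \<sigma> c + shift_at \<rho> c"
  "shift_at (\<sigma> - \<rho>) c = shift_at \<sigma> c - shift_at \<rho> c"
  "shift_at (- \<sigma>) c = - shift_at \<sigma> c" "shift_at 0 c = 0"
  by (simp_all add: shift_at_def plus_gimel.rep_eq minus_gimel.rep_eq uminus_gimel.rep_eq
      zero_gimel.rep_eq)

lemma shift_at_perm: "shift_at (perm_shift s \<sigma>) c = shift_at \<sigma> (Rep_row_perm s c)"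
  by (simp add: shift_at_def perm_shift.rep_eq)

lemma gimel_eqI: "(\<And>c. shift_at \<sigma> c = shift_at \<rho> c) \<Longrightarrow> \<sigma> = \<rho>"
  unfolding shift_at_def by (metis Rep_gimel_inject vec_eq_iff)

lemma perm_shift_hom:
  "perm_shift s (\<sigma> + \<rho>) = perm_shift s \<sigma> + perm_shift s \<rho>"
  "perm_shift s (- \<sigma>) = - perm_shift s \<sigma>" "perm_shift s 0 = 0"
  by (rule gimel_eqI; simp add: shift_at_perm shift_at_ops)+

lemma inj_perm_shift: "perm_shift s \<sigma> = perm_shift s \<rho> \<longleftrightarrow> \<sigma> = \<rho>"
proof
  assume e: "perm_shift s \<sigma> = perm_shift s \<rho>"
  have "bij (Rep_row_perm s)" using Rep_row_perm[of s] by simp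
  then show "\<sigma> = \<rho>"
    using e by (intro gimel_eqI) (metis shift_at_perm bij_pointE)
qed simp

lemma perm_mero_shift_mero:
  "perm_mero s (shift_mero \<sigma> f) = shift_mero (perm_shift s \<sigma>) (perm_mero s f)"
proof -
  obtain g where g: "meromorphic g" "f = mero_of g" by (rule mero_obtain_representative)
  have "inv (shift_tab \<sigma>) (inv (perm_tab s) x) = inv (perm_tab s) (inv (shift_tab (perm_shift s \<sigma>)) x)" for x
    by (simp add: inv_shift_tab flip: perm_shift_hom) (simp add: shift_tab_perm_shift perm_tab_inverse)
  then show ?thesis
    using meromorphic_shift[OF g(1), of \<sigma>] meromorphic_perm[OF g(1), of s]
    by (simp add: g shift_mero_mero_of perm_mero_mero_of comp_def)
qed

lemma perm_skew_superset:
  assumes "finite S" "supp A \<subseteq> S"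
  shows "perm_skew s A = (\<Sum>\<sigma>\<in>S. fn (perm_mero s (coeff A \<sigma>)) * grp (perm_shift s \<sigma>))"
  unfolding perm_skew_def
  by (rule sum.mono_neutral_left[OF assms])
    (auto simp: supp_iff perm_mero_hom intro!: skew_eqI simp: coeff_fn_grp coeff_zero)

lemma perm_skew_zero: "perm_skew s 0 = 0"
  using perm_skew_superset[of "{}" 0 s] by (simp add: supp_iff[abs_def] coeff_zero subset_iff)

lemma fn_add: "fn (f + g) * grp \<sigma> = fn f * grp \<sigma> + fn g * grp \<sigma>"
  by (rule skew_eqI) (simp add: coeff_fn_grp coeff_add)

lemma fn_uminus: "fn (- f) * grp \<sigma> = - (fn f * grp \<sigma>)"
  by (rule skew_eqI) (simp add: coeff_fn_grp coeff_uminus)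

lemma perm_skew_add: "perm_skew s (A + B) = perm_skew s A + perm_skew s B"
proof -
  let ?S = "supp A \<union> supp B"
  have S: "finite ?S" "supp A \<subseteq> ?S" "supp B \<subseteq> ?S" "supp (A + B) \<subseteq> ?S"
    by (auto simp: finite_supp supp_iff coeff_add)
  show ?thesis
    unfolding perm_skew_superset[OF S(1,2)] perm_skew_superset[OF S(1,3)] perm_skew_superset[OF S(1,4)]
    by (simp add: coeff_add perm_mero_hom fn_add sum.distrib)
qed

lemma perm_skew_sum: "perm_skew s (\<Sum>i\<in>I. A i) = (\<Sum>i\<in>I. perm_skew s (A i))"
  by (induction I rule: infinite_finite_induct) (simp_all add: perm_skew_zero perm_skew_add)

lemma perm_skew_monomial: "perm_skew s (fn f * grp \<sigma>) = fn (perm_mero s f) * grp (perm_shift s \<sigma>)"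
  using perm_skew_superset[OF _ supp_monomial, of \<sigma> s f]
  by (simp add: coeff_fn_grp)

text \<open>Multiplicativity makes invariance under row permutations pass to products, and reduces to the
  fact that a permutation conjugates shifts to shifts.\<close>

lemma perm_skew_mult: "perm_skew s (A * B) = perm_skew s A * perm_skew s B"
proof (induction A rule: skew_ring_induct)
  case (monomial f \<sigma>)
  show ?case
    by (induction B rule: skew_ring_induct)
      (simp_all add: perm_skew_zero perm_skew_add perm_skew_monomial monomial_mult perm_mero_hom
        perm_mero_shift_mero perm_shift_hom distrib_left)
qed (simp_all add: perm_skew_zero perm_skew_add distrib_right)

lemma coeff_perm_skew: "coeff (perm_skew s A) (perm_shift s \<sigma>) = perm_mero s (coeff A \<sigma>)"
  by (induction A rule: skew_ring_induct)
    (simp_all add: perm_skew_zero perm_skew_add perm_skew_monomial coeff_fn_grp coeff_add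
      coeff_zero perm_mero_hom inj_perm_shift)

lemma perm_skew_one: "perm_skew s 1 = 1"
  using perm_skew_monomial[of s 1 0] by (simp add: one_as_monomial perm_mero_hom perm_shift_hom)

lemma perm_skew_uminus: "perm_skew s (- A) = - perm_skew s A"
  using perm_skew_add[of s A "- A"] by (simp add: perm_skew_zero eq_neg_iff_add_eq_0 add.commute)

text \<open>The operator of a ring element before its removable singularities are filled in. As its values
  are computed from meromorphic coefficients, it respects the ring operations only up to agreement on
  a dense open set, but for arbitrary functions \<open>F\<close>.\<close>

definition skew_op :: "'n::finite skew_ring \<Rightarrow> ('n tab \<Rightarrow> complex) \<Rightarrow> 'n tab \<Rightarrow> complex"
  where "skew_op A F = (\<lambda>y. \<Sum>\<sigma>\<in>supp A. mero_value (coeff A \<sigma>) y * F (shift_tab (- \<sigma>) y))"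

lemma act_skew_op: "act W A F = (\<lambda>x. if x \<in> W then hol_value (skew_op A F) x else 0)"
  unfolding act_def skew_op_def inv_shift_tab ..

lemma skew_op_superset:
  assumes "finite S" "supp A \<subseteq> S"
  shows "skew_op A F y = (\<Sum>\<sigma>\<in>S. mero_value (coeff A \<sigma>) y * F (shift_tab (- \<sigma>) y))"
  unfolding skew_op_def
  by (rule sum.mono_neutral_left[OF assms]) (simp add: supp_iff mero_value_zero)

lemma skew_op_zero: "skew_op 0 F y = 0"
  by (simp add: skew_op_def coeff_zero mero_value_zero)

lemma skew_op_monomial: "skew_op (fn f * grp \<sigma>) F y = mero_value f y * F (shift_tab (- \<sigma>) y)"
  using skew_op_superset[OF _ supp_monomial, of \<sigma> f F y]
  by (simp add: coeff_fn_grp)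

lemma skew_op_fn: "skew_op (fn f) F y = mero_value f y * F y"
  using skew_op_monomial[of f 0 F y] by (simp add: fn_as_monomial shift_tab_zero)

lemma skew_op_one: "skew_op 1 F y = F y"
  using skew_op_monomial[of 1 0 F y] by (simp add: one_as_monomial shift_tab_zero mero_value_one)

lemma skew_op_add: "agree_on UNIV (skew_op (A + B) F) (\<lambda>y. skew_op A F y + skew_op B F y)"
proof -
  let ?S = "supp A \<union> supp B"
  have S: "finite ?S" "supp A \<subseteq> ?S" "supp B \<subseteq> ?S" "supp (A + B) \<subseteq> ?S"
    by (auto simp: finite_supp supp_iff coeff_add)
  have "agree_on UNIV (\<lambda>y. \<Sum>\<sigma>\<in>?S. mero_value (coeff (A + B) \<sigma>) y * F (shift_tab (- \<sigma>) y))
      (\<lambda>y. \<Sum>\<sigma>\<in>?S. (mero_value (coeff A \<sigma>) y + mero_value (coeff B \<sigma>) y) * F (shift_tab (- \<sigma>) y))"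
    unfolding coeff_add by (intro agree_on_sum agree_on_mult mero_value_add agree_on_refl) auto
  then show ?thesis
    unfolding skew_op_superset[OF S(1,2)] skew_op_superset[OF S(1,3)]
      skew_op_superset[OF S(1,4), abs_def]
    by (simp add: distrib_right sum.distrib)
qed

lemma skew_op_uminus: "agree_on UNIV (skew_op (- A) F) (\<lambda>y. - skew_op A F y)"
proof -
  have "agree_on UNIV (\<lambda>y. skew_op (A + - A) F y - skew_op A F y)
      (\<lambda>y. (skew_op A F y + skew_op (- A) F y) - skew_op A F y)"
    by (rule agree_on_binop[of _ _ _ _ _ "(-)", OF skew_op_add agree_on_refl[OF open_UNIV]])
  then show ?thesis by (simp add: skew_op_zero agree_on_sym)
qed

text \<open>Agreement is only preserved on sets that are stable under all shifts, because \<open>F\<close> is evaluated at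
  shifted points.\<close>

lemma skew_op_cong:
  assumes "agree_on U F F'" "open U" "\<And>\<sigma>. shift_tab \<sigma> ` U = U"
  shows "agree_on U (skew_op A F) (skew_op A F')"
  unfolding skew_op_def
  by (intro agree_on_sum agree_on_mult agree_on_refl agree_on_shift assms)

lemma shift_tab_image_UNIV: "shift_tab \<sigma> ` UNIV = UNIV"
  by (simp add: bij_shift_tab bij_is_surj)

lemma skew_op_linear: "skew_op A (\<lambda>y. c * F y + d * F' y) y = c * skew_op A F y + d * skew_op A F' y"
  unfolding skew_op_def by (simp add: sum_distrib_left sum.distrib algebra_simps)

lemma skew_op_mult: "agree_on UNIV (skew_op (A * B) F) (skew_op A (skew_op B F))"
proof (induction A rule: skew_ring_induct)
  case zero
  show ?case by (intro agree_on_eqI) (simp_all add: skew_op_zero)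
next
  case (add A A')
  have "agree_on UNIV (skew_op ((A + A') * B) F) (\<lambda>y. skew_op (A * B) F y + skew_op (A' * B) F y)"
    unfolding distrib_right by (rule skew_op_add)
  also have "agree_on UNIV \<dots> (\<lambda>y. skew_op A (skew_op B F) y + skew_op A' (skew_op B F) y)"
    by (rule agree_on_add[OF add])
  also have "agree_on UNIV \<dots> (skew_op (A + A') (skew_op B F))"
    by (rule agree_on_sym[OF skew_op_add])
  finally show ?case .
next
  case (monomial f \<sigma>)
  show ?case
  proof (induction B rule: skew_ring_induct)
    case zero
    show ?case by (intro agree_on_eqI) (simp_all add: skew_op_zero skew_op_monomial)
  next
    case (add B B')
    have "agree_on UNIV (skew_op (fn f * grp \<sigma> * (B + B')) F)
        (\<lambda>y. skew_op (fn f * grp \<sigma> * B) F y + skew_op (fn f * grp \<sigma> * B') F y)"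
      unfolding distrib_left by (rule skew_op_add)
    also have "agree_on UNIV \<dots> (\<lambda>y. skew_op (fn f * grp \<sigma>) (skew_op B F) y
        + skew_op (fn f * grp \<sigma>) (skew_op B' F) y)"
      by (rule agree_on_add[OF add])
    also have "\<dots> = skew_op (fn f * grp \<sigma>) (\<lambda>y. skew_op B F y + skew_op B' F y)"
      using skew_op_linear[of "fn f * grp \<sigma>" 1 "skew_op B F" 1 "skew_op B' F"] by (simp add: fun_eq_iff)
    also have "agree_on UNIV \<dots> (skew_op (fn f * grp \<sigma>) (skew_op (B + B') F))"
      by (rule skew_op_cong[OF agree_on_sym[OF skew_op_add] open_UNIV shift_tab_image_UNIV])
    finally show ?case .
  next
    case (monomial g \<rho>)
    have "agree_on UNIV (\<lambda>y. mero_value (f * shift_mero \<sigma> g) y * F (shift_tab (- (\<sigma> + \<rho>)) y))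
       (\<lambda>y. (mero_value f y * mero_value (shift_mero \<sigma> g) y) * F (shift_tab (- (\<sigma> + \<rho>)) y))"
      by (intro agree_on_mult mero_value_mult agree_on_refl open_UNIV)
    also have "agree_on UNIV \<dots>
       (\<lambda>y. (mero_value f y * mero_value g (shift_tab (- \<sigma>) y)) * F (shift_tab (- (\<sigma> + \<rho>)) y))"
      by (intro agree_on_mult mero_value_shift agree_on_refl open_UNIV)
    finally show ?case
      unfolding monomial_mult skew_op_monomial[abs_def]
      by (simp add: mult.assoc shift_tab_add[symmetric] add.commute)
  qed
qed

lemma skew_op_perm:
  "agree_on UNIV (skew_op (perm_skew s A) F)
    (\<lambda>y. skew_op A (\<lambda>x. F (perm_tab s x)) (inv (perm_tab s) y))"
proof (induction A rule: skew_ring_induct)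
  case zero
  show ?case by (intro agree_on_eqI) (simp_all add: skew_op_zero perm_skew_zero)
next
  case (add A B)
  let ?F = "\<lambda>x. F (perm_tab s x)"
  have "agree_on UNIV (skew_op (perm_skew s (A + B)) F)
      (\<lambda>y. skew_op (perm_skew s A) F y + skew_op (perm_skew s B) F y)"
    unfolding perm_skew_add by (rule skew_op_add)
  also have "agree_on UNIV \<dots> (\<lambda>y. skew_op A ?F (inv (perm_tab s) y) + skew_op B ?F (inv (perm_tab s) y))"
    by (rule agree_on_add[OF add])
  also have "agree_on UNIV \<dots> (\<lambda>y. skew_op (A + B) ?F (inv (perm_tab s) y))"
    by (rule agree_on_perm[OF agree_on_sym[OF skew_op_add]])
  finally show ?case .
next
  case (monomial f \<sigma>)
  have "agree_on UNIV (\<lambda>y. mero_value (perm_mero s f) y * F (shift_tab (- perm_shift s \<sigma>) y))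
      (\<lambda>y. mero_value f (inv (perm_tab s) y) * F (shift_tab (- perm_shift s \<sigma>) y))"
    by (intro agree_on_mult mero_value_perm agree_on_refl open_UNIV)
  then show ?case
    unfolding perm_skew_monomial skew_op_monomial[abs_def] perm_shift_hom[symmetric]
    by (simp add: shift_tab_perm_shift)
qed

section \<open>Density of the regular points\<close>

lemma dense_coordinates_distinct:
  fixes c d :: "'m::finite"
  assumes "c \<noteq> d" shows "closure {x :: complex ^ 'm. x $ c - x $ d \<noteq> 0} = UNIV"
proof -
  have "x \<in> closure {x :: complex ^ 'm. x $ c - x $ d \<noteq> 0}" for x
    unfolding closure_approachable
  proof (intro allI impI)
    fix e :: real assume e: "e > 0"
    show "\<exists>y\<in>{x :: complex ^ 'm. x $ c - x $ d \<noteq> 0}. dist y x < e"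
    proof (cases "x $ c - x $ d = 0")
      case False
      then show ?thesis using e by (intro bexI[of _ x]) auto
    next
      case True
      let ?y = "x + of_real (e / 2) *s axis c 1"
      have "dist ?y x < e"
        using e by (simp add: dist_norm norm_smult_complex norm_axis_1)
      moreover have "?y $ c - ?y $ d \<noteq> 0" using True assms e by (simp add: axis_def)
      ultimately show ?thesis by blast
    qed
  qed
  then show ?thesis by blast
qed

lemma dense_prod_nonzero:
  fixes h :: "'i \<Rightarrow> complex ^ 'm::finite \<Rightarrow> complex"
  assumes "finite I" "\<And>i. i \<in> I \<Longrightarrow> h i holo_on UNIV" "\<And>i. i \<in> I \<Longrightarrow> closure {x. h i x \<noteq> 0} = UNIV"
  shows "closure {x. (\<Prod>i\<in>I. h i x) \<noteq> 0} = UNIV"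
  using assms
proof (induction I)
  case (insert i I)
  have o: "open {x. h i x \<noteq> 0}" using holo_on_imp_open_nonzero[of "h i" UNIV] insert.prems(1) by simp
  have "UNIV \<subseteq> closure ({x. h i x \<noteq> 0} \<inter> {x. (\<Prod>i\<in>I. h i x) \<noteq> 0})"
    by (rule dense_Int[OF o]) (use insert in auto)
  moreover have "{x. h i x \<noteq> 0} \<inter> {x. (\<Prod>i\<in>I. h i x) \<noteq> 0} = {x. (\<Prod>i\<in>insert i I. h i x) \<noteq> 0}"
    using insert.hyps by auto
  ultimately show ?case by (simp add: top.extremum_unique)
qed simp

text \<open>The complement of \<open>z\<^sub>1 = 0\<close> is dense, so multiplying and dividing by \<open>z\<^sub>1\<close> are inverse to each other
  modulo agreement, whatever value division by zero produces.\<close>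

lemma agree_off_z1:
  assumes "a \<noteq> b" "open U" "\<And>x. x \<in> U \<Longrightarrow> z1 a b x \<noteq> 0 \<Longrightarrow> f x = g x"
  shows "agree_on U f g"
proof -
  have "U \<subseteq> closure (U \<inter> {x. z1 a b x \<noteq> 0})"
    by (rule dense_Int) (use assms(2) dense_coordinates_distinct[OF assms(1)] closure_subset[of U] in
        \<open>auto simp: z1_def\<close>)
  moreover have "U \<inter> {x. z1 a b x \<noteq> 0} = {x \<in> U. z1 a b x \<noteq> 0}" by auto
  moreover have "open {x \<in> U. z1 a b x \<noteq> 0}" by (rule holo_on_imp_open_nonzero[OF holo_on_z1 assms(2)])
  ultimately show ?thesis
    unfolding agree_on_def by (intro exI[of _ "{x \<in> U. z1 a b x \<noteq> 0}"]) (use assms(3) in auto)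
qed

lemma shift_tab_vimage: "shift_tab \<sigma> ` U = U \<Longrightarrow> shift_tab \<sigma> -` U = U"
  using inj_vimage_image_eq[OF bij_is_inj[OF bij_shift_tab[of \<sigma>]], of U] by simp

section \<open>Shifts and row permutations of holomorphic functions\<close>

lemma holo_on_shift:
  assumes "f holo_on U" shows "(\<lambda>x. f (shift_tab \<sigma> x)) holo_on (shift_tab \<sigma> -` U)"
proof (rule holo_on_comp[OF assms])
  have "shift_tab \<sigma> = (\<lambda>x. x + (\<chi> a. of_int (shift_at \<sigma> a)))"
    by (simp add: fun_eq_iff vec_eq_iff shift_tab_def)
  then show "(shift_tab \<sigma> has_derivative (\<lambda>y. y)) (at x)" for x
    by (auto intro!: derivative_eq_intros)
qed simp

lemma holo_on_perm:
  assumes "f holo_on U" shows "(\<lambda>x. f (perm_tab s x)) holo_on (perm_tab s -` U)"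
proof (rule holo_on_comp[OF assms])
  show "(perm_tab s has_derivative perm_tab s) (at x)" for x
    by (rule linear_imp_has_derivative[OF linear_row_perm(1)])
  show "perm_tab s (c *s y) = c *s perm_tab s y" for c y
    by (simp add: vec_eq_iff perm_tab.rep_eq)
qed

section \<open>Indexing the rows of a tableau\<close>

lemma tab_index_eqI: "row c = row d \<Longrightarrow> col c = col d \<Longrightarrow> c = d"
  unfolding row_def col_def by (metis Rep_tab_index_inject prod_eqI)

lemma tab_index_bounds: "1 \<le> col c" "col c \<le> row c" "row (c :: 'n::finite tab_index) \<le> CARD('n)"
  using Rep_tab_index[of c] by (auto simp: row_def col_def)

lemma idx_row_col: "idx (row c) (col c) = c"
  by (simp add: idx_def row_def col_def Rep_tab_index_inverse)

lemma bij_betw_idx_row: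
  assumes "k \<le> CARD('n::finite)"
  shows "bij_betw (idx k) {1..k} {c :: 'n tab_index. row c = k}"
proof (rule bij_betw_byWitness[where f' = col])
  show "\<forall>i\<in>{1..k}. col (idx k i :: 'n tab_index) = i" using assms by (simp add: col_idx)
  show "\<forall>c\<in>{c :: 'n tab_index. row c = k}. idx k (col c) = c" using idx_row_col by auto
  show "idx k ` {1..k} \<subseteq> {c :: 'n tab_index. row c = k}" using assms by (auto simp: row_idx)
  show "col ` {c :: 'n tab_index. row c = k} \<subseteq> {1..k}" using tab_index_bounds by auto
qed

lemma prod_idx_row_minus:
  assumes "k \<le> CARD('n::finite)" "i \<in> {1..k}"
  shows "(\<Prod>j\<in>{1..k} - {i}. f (idx k j :: 'n tab_index)) = (\<Prod>d\<in>{d. row d = k} - {idx k i}. f d)"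
proof -
  have b: "bij_betw (idx k) {1..k} {c :: 'n tab_index. row c = k}" by (rule bij_betw_idx_row[OF assms(1)])
  have "bij_betw (idx k) ({1..k} - {i}) ({c :: 'n tab_index. row c = k} - {idx k i})"
    using bij_betw_DiffI[OF b, of "{i}" "{idx k i}"] assms(2) bij_betwE[OF b] by (simp add: bij_betw_def)
  then show ?thesis by (rule prod.reindex_bij_betw)
qed

lemma prod_idx_row:
  assumes "k \<le> CARD('n::finite)"
  shows "(\<Prod>j\<in>{1..k}. f (idx k j :: 'n tab_index)) = (\<Prod>d\<in>{d. row d = k}. f d)"
  by (rule prod.reindex_bij_betw[OF bij_betw_idx_row[OF assms]])

lemma sum_idx_row:
  assumes "k \<le> CARD('n::finite)"
  shows "(\<Sum>j\<in>{1..k}. f (idx k j :: 'n tab_index)) = (\<Sum>d\<in>{d. row d = k}. f d)"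
  by (rule sum.reindex_bij_betw[OF bij_betw_idx_row[OF assms]])

lemma shift_at_sigma:
  "row c < CARD('n) \<Longrightarrow> shift_at (sigma (row c) (col c)) d = (if d = (c :: 'n::finite tab_index) then 1 else 0)"
  unfolding shift_at_def sigma.rep_eq by (auto intro: tab_index_eqI)

section \<open>The matrix Lie algebra in its enveloping algebra\<close>

lemma uea_commutator:
  "uea_gen s t * uea_gen u w - uea_gen u w * uea_gen s t =
    (if t = u then uea_gen s w else 0) - (if s = w then uea_gen u t else 0)"
proof transfer
  fix s t u w :: "'n::finite mat_index"
  show "free_gen (s, t) * free_gen (u, w) - free_gen (u, w) * free_gen (s, t) -
      ((if t = u then free_gen (s, w) else 0) - (if s = w then free_gen (u, t) else 0)) \<in> gl_ideal"
    by (rule gl_ideal.rel)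
qed

lemma uea_scalar_mult: "uea_scalar (c * d) = uea_scalar c * uea_scalar d"
  by transfer (simp add: mult_single gl_ideal.zero)

lemma uea_scalar_add: "uea_scalar (c + d) = uea_scalar c + uea_scalar d"
  by transfer (simp add: single_add gl_ideal.zero)

lemma uea_scalar_zero: "uea_scalar 0 = 0"
  by transfer (simp add: gl_ideal.zero)

lemma uea_scalar_sum: "uea_scalar (\<Sum>i\<in>I. f i) = (\<Sum>i\<in>I. uea_scalar (f i))"
  by (induction I rule: infinite_finite_induct) (simp_all add: uea_scalar_zero uea_scalar_add)

lemma uea_scalar_commute: "uea_scalar c * x = x * uea_scalar c"
proof transfer
  fix c and p :: "('a::finite mat_index \<times> 'a mat_index) free_algebra"
  have "Poly_Mapping.single 0 c * p = p * Poly_Mapping.single 0 c"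
    by (induction p rule: poly_mapping_single_induct)
      (simp_all add: mult_single mult.commute distrib_left distrib_right)
  then show "Poly_Mapping.single 0 c * p - p * Poly_Mapping.single 0 c \<in> gl_ideal"
    by (simp add: gl_ideal.zero)
qed

lemma uea_of_add: "uea_of (X + Y) = uea_of X + uea_of Y"
  by (simp add: uea_of_def uea_scalar_add distrib_right sum.distrib)

lemma uea_of_scale: "uea_of (mat c ** X) = uea_scalar c * uea_of X"
proof -
  have "(mat c ** X) $ s $ t = c * X $ s $ t" for s t
    by (simp add: matrix_matrix_mult_def mat_def if_distrib[of "\<lambda>y. y * _"] cong: if_cong)
  then show ?thesis
    by (simp add: uea_of_def uea_scalar_mult sum_distrib_left mult.assoc)
qed

lemma uea_of_product:
  fixes X Y :: "'n::finite gl"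
  shows "uea_of X * uea_of Y = (\<Sum>s\<in>UNIV. \<Sum>t\<in>UNIV. \<Sum>u\<in>UNIV. \<Sum>w\<in>UNIV.
    uea_scalar (X $ s $ t * Y $ u $ w) * (uea_gen s t * uea_gen u w))"
proof -
  have "uea_scalar c * g * (uea_scalar d * h) = uea_scalar (c * d) * (g * h)" for c d and g h :: "'n uea"
    by (metis uea_scalar_commute uea_scalar_mult mult.assoc)
  then show ?thesis
    unfolding uea_of_def unfolding sum_distrib_right unfolding sum_distrib_left by simp
qed

text \<open>Scalars are central, so both products are quadruple sums with the same coefficients
  \<open>X\<^sub>s\<^sub>t Y\<^sub>u\<^sub>w\<close>, and their difference is a sum of commutators of matrix units. The two Kronecker deltas turn
  it into the two matrix products.\<close>

lemma uea_of_bracket: "uea_of (X ** Y - Y ** X) = uea_of X * uea_of Y - uea_of Y * uea_of X"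
proof -
  let ?c = "\<lambda>s t u w. uea_scalar (X $ s $ t * Y $ u $ w)"
  have YX: "uea_of Y * uea_of X = (\<Sum>s\<in>UNIV. \<Sum>t\<in>UNIV. \<Sum>u\<in>UNIV. \<Sum>w\<in>UNIV.
      ?c s t u w * (uea_gen u w * uea_gen s t))"
  proof -
    have "uea_of Y * uea_of X = (\<Sum>u\<in>UNIV. \<Sum>w\<in>UNIV. \<Sum>s\<in>UNIV. \<Sum>t\<in>UNIV.
        ?c s t u w * (uea_gen u w * uea_gen s t))"
      unfolding uea_of_product by (simp add: mult.commute)
    also have "\<dots> = (\<Sum>u\<in>UNIV. \<Sum>s\<in>UNIV. \<Sum>t\<in>UNIV. \<Sum>w\<in>UNIV. ?c s t u w * (uea_gen u w * uea_gen s t))"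
      by (rule sum.cong[OF refl], subst sum.swap, rule sum.cong[OF refl], rule sum.swap)
    also have "\<dots> = (\<Sum>s\<in>UNIV. \<Sum>t\<in>UNIV. \<Sum>u\<in>UNIV. \<Sum>w\<in>UNIV. ?c s t u w * (uea_gen u w * uea_gen s t))"
      by (subst sum.swap, rule sum.cong[OF refl], rule sum.swap)
    finally show ?thesis .
  qed
  have "uea_of X * uea_of Y - uea_of Y * uea_of X =
    (\<Sum>s\<in>UNIV. \<Sum>t\<in>UNIV. \<Sum>u\<in>UNIV. \<Sum>w\<in>UNIV.
      ?c s t u w * ((if t = u then uea_gen s w else 0) - (if s = w then uea_gen u t else 0)))"
    unfolding uea_of_product[of X Y] YX
    by (simp add: sum_subtractf[symmetric] right_diff_distrib[symmetric] uea_commutator)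
  also have "\<dots> = (\<Sum>s\<in>UNIV. \<Sum>t\<in>UNIV. \<Sum>u\<in>UNIV. \<Sum>w\<in>UNIV. (if t = u then ?c s t u w * uea_gen s w else 0))
      - (\<Sum>s\<in>UNIV. \<Sum>t\<in>UNIV. \<Sum>u\<in>UNIV. \<Sum>w\<in>UNIV. (if s = w then ?c s t u w * uea_gen u t else 0))"
    unfolding sum_subtractf[symmetric] by (intro sum.cong refl) (simp add: right_diff_distrib)
  also have "(\<Sum>s\<in>UNIV. \<Sum>t\<in>UNIV. \<Sum>u\<in>UNIV. \<Sum>w\<in>UNIV. (if t = u then ?c s t u w * uea_gen s w else 0))
      = uea_of (X ** Y)"
  proof -
    have "(\<Sum>t\<in>UNIV. \<Sum>u\<in>UNIV. \<Sum>w\<in>UNIV. (if t = u then ?c s t u w * uea_gen s w else 0)) =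
        (\<Sum>w\<in>UNIV. uea_scalar ((X ** Y) $ s $ w) * uea_gen s w)" for s
    proof -
      have "(\<Sum>t\<in>UNIV. \<Sum>u\<in>UNIV. \<Sum>w\<in>UNIV. (if t = u then ?c s t u w * uea_gen s w else 0)) =
          (\<Sum>t\<in>UNIV. \<Sum>w\<in>UNIV. \<Sum>u\<in>UNIV. (if t = u then ?c s t u w * uea_gen s w else 0))"
        by (rule sum.cong[OF refl], rule sum.swap)
      also have "\<dots> = (\<Sum>t\<in>UNIV. \<Sum>w\<in>UNIV. ?c s t t w * uea_gen s w)" by simp
      also have "\<dots> = (\<Sum>w\<in>UNIV. \<Sum>t\<in>UNIV. ?c s t t w * uea_gen s w)" by (rule sum.swap)
      finally show ?thesis
        by (simp add: matrix_matrix_mult_def uea_scalar_sum sum_distrib_right)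
    qed
    then show ?thesis unfolding uea_of_def by simp
  qed
  also have "(\<Sum>s\<in>UNIV. \<Sum>t\<in>UNIV. \<Sum>u\<in>UNIV. \<Sum>w\<in>UNIV. (if s = w then ?c s t u w * uea_gen u t else 0))
      = uea_of (Y ** X)"
  proof -
    have "(\<Sum>s\<in>UNIV. \<Sum>t\<in>UNIV. \<Sum>u\<in>UNIV. \<Sum>w\<in>UNIV. (if s = w then ?c s t u w * uea_gen u t else 0)) =
        (\<Sum>s\<in>UNIV. \<Sum>t\<in>UNIV. \<Sum>u\<in>UNIV. ?c s t u s * uea_gen u t)" by simp
    also have "\<dots> = (\<Sum>s\<in>UNIV. \<Sum>u\<in>UNIV. \<Sum>t\<in>UNIV. ?c s t u s * uea_gen u t)"
      by (rule sum.cong[OF refl], rule sum.swap)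
    also have "\<dots> = (\<Sum>u\<in>UNIV. \<Sum>s\<in>UNIV. \<Sum>t\<in>UNIV. ?c s t u s * uea_gen u t)" by (rule sum.swap)
    also have "\<dots> = (\<Sum>u\<in>UNIV. \<Sum>t\<in>UNIV. \<Sum>s\<in>UNIV. ?c s t u s * uea_gen u t)"
      by (rule sum.cong[OF refl], rule sum.swap)
    finally show ?thesis
      by (simp add: uea_of_def matrix_matrix_mult_def uea_scalar_sum sum_distrib_right mult.commute)
  qed
  finally have "uea_of X * uea_of Y - uea_of Y * uea_of X = uea_of (X ** Y) - uea_of (Y ** X)" .
  moreover have "uea_of (X ** Y - Y ** X) = uea_of (X ** Y) - uea_of (Y ** X)"
    by (simp add: eq_diff_eq uea_of_add[symmetric])
  ultimately show ?thesis by simp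
qed

section \<open>A neighbourhood of a singular orbit\<close>

text \<open>That the orbit has no singularity besides the pair \<open>a\<close>, \<open>b\<close> is expressed by \<open>nbhd\<close>, which keeps the other
  differences of entries in a row away from \<open>0\<close>.\<close>

locale one_singular_point =
  fixes a b :: "'n::finite tab_index" and v :: "'n tab" and W :: "'n tab set"
  assumes ab: "a \<noteq> b" "row a = row b" and z1_v: "z1 a b v = 0" and nbhd: "admissible_nbhd a b v W"
begin

abbreviation \<tau> :: "'n row_perm" where "\<tau> \<equiv> row_transp a b"

lemma Rep_tau: "Rep_row_perm \<tau> = Transposition.transpose a b"
  using ab by (simp add: row_transp.rep_eq)

lemma perm_tab_tau: "perm_tab \<tau> x $ c = x $ Transposition.transpose a b c"
  by (simp add: perm_tab.rep_eq Rep_tau)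

lemma tau_tau: "perm_tab \<tau> (perm_tab \<tau> x) = x"
  by (simp add: vec_eq_iff perm_tab_tau)

lemma inv_tau: "inv (perm_tab \<tau>) = perm_tab \<tau>"
  by (rule inv_unique_comp) (simp_all add: fun_eq_iff tau_tau)

lemma z1_tau: "z1 a b (perm_tab \<tau> x) = - z1 a b x"
  by (simp add: z1_def perm_tab_tau)

lemma tau_fixes: "z1 a b x = 0 \<Longrightarrow> perm_tab \<tau> x = x"
  by (auto simp: vec_eq_iff perm_tab_tau z1_def Transposition.transpose_def)

lemma perm_shift_tau_tau: "perm_shift \<tau> (perm_shift \<tau> \<sigma>) = \<sigma>"
  by (rule gimel_eqI) (simp add: shift_at_perm Rep_tau)

lemma open_W: "open W" and orbit_in_W: "shift_tab \<sigma> v \<in> W"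
  and W_shift: "shift_tab \<sigma> ` W = W" and W_tau: "perm_tab \<tau> ` W = W"
  using nbhd unfolding admissible_nbhd_def gimel_orbit_def by auto

lemma v_in_W: "v \<in> W"
  using orbit_in_W[of 0] by (simp add: shift_tab_zero)

lemma W_nonzero: "row c = row d \<Longrightarrow> c \<noteq> d \<Longrightarrow> {c, d} \<noteq> {a, b} \<Longrightarrow> x \<in> W \<Longrightarrow> x $ c - x $ d \<noteq> 0"
  using nbhd unfolding admissible_nbhd_def by blast

lemma shift_in_W: "x \<in> W \<Longrightarrow> shift_tab \<sigma> x \<in> W"
  using W_shift[of \<sigma>] by blast

lemma tau_in_W_iff: "perm_tab \<tau> x \<in> W \<longleftrightarrow> x \<in> W"
  using W_tau tau_tau by (metis imageI)

lemma tau_vimage_W: "perm_tab \<tau> -` W = W"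
  using tau_in_W_iff by auto

lemma v_generic: "row c = row d \<Longrightarrow> c \<noteq> d \<Longrightarrow> {c, d} \<noteq> {a, b} \<Longrightarrow> v $ c \<noteq> v $ d"
  using W_nonzero[OF _ _ _ v_in_W] by force

text \<open>A permutation in the stabilizer can only move an index to one with the same entry in the same
  row, and \<open>{a, b}\<close> is the only pair with equal entries.\<close>

lemma stabilizer:
  assumes "perm_tab s v = v" shows "Rep_row_perm s = id \<or> s = \<tau>"
proof -
  let ?p = "Rep_row_perm s"
  have p: "bij ?p" "\<And>c. row (?p c) = row c" using Rep_row_perm[of s] by auto
  have vp: "v $ ?p c = v $ c" for c using assms by (metis perm_tab.rep_eq vec_lambda_beta)
  have moved: "?p c = c \<or> {c, ?p c} = {a, b}" for c
    using v_generic[of c "?p c"] p(2)[of c] vp[of c] by metis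
  have outside: "?p c = c" if "c \<noteq> a" "c \<noteq> b" for c using moved[of c] that by blast
  have inj: "?p c = ?p d \<longleftrightarrow> c = d" for c d using p(1) by (metis bij_pointE)
  show ?thesis
  proof (cases "?p a = a")
    case True
    then have "?p b = b" using moved[of b] inj[of a b] ab(1) by (metis doubleton_eq_iff)
    then have "?p = id" using True outside by (metis eq_id_iff)
    then show ?thesis ..
  next
    case False
    then have pa: "?p a = b" using moved[of a] ab(1) by (metis doubleton_eq_iff)
    then have "?p b = a" using moved[of b] inj[of a b] ab(1) by (metis doubleton_eq_iff)
    then have "?p = Rep_row_perm \<tau>"
      unfolding Rep_tau using pa outside by (auto simp: fun_eq_iff Transposition.transpose_def)
    then show ?thesis by (simp add: Rep_row_perm_inject)
  qed
qed

lemma stabilizer_tau: "perm_tab \<tau> v = v"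
  by (rule tau_fixes[OF z1_v])

lemma skew_invariants_iff: "A \<in> skew_invariants v \<longleftrightarrow> perm_skew \<tau> A = A"
proof
  assume "A \<in> skew_invariants v"
  then show "perm_skew \<tau> A = A" using stabilizer_tau unfolding skew_invariants_def by blast
next
  assume A: "perm_skew \<tau> A = A"
  have "perm_skew s A = A" if "Rep_row_perm s = id" for s
  proof (rule skew_eqI)
    fix \<sigma>
    have 1: "perm_shift s \<sigma> = \<sigma>" by (rule gimel_eqI) (simp add: shift_at_perm that)
    have "inv (perm_tab s) = id" unfolding inv_perm_tab that by (simp add: fun_eq_iff vec_eq_iff)
    then have 2: "perm_mero s f = f" for f
      using mero_obtain_representative[of f] perm_mero_mero_of[of _ s] by (metis comp_id)
    show "coeff (perm_skew s A) \<sigma> = coeff A \<sigma>" using coeff_perm_skew[of s A \<sigma>] by (simp add: 1 2)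
  qed
  then show "A \<in> skew_invariants v" using A stabilizer unfolding skew_invariants_def by blast
qed

lemma inv_holo_iff: "F \<in> inv_holo v W \<longleftrightarrow>
    F holo_on W \<and> (\<forall>x. x \<notin> W \<longrightarrow> F x = 0) \<and> (\<forall>x. F (perm_tab \<tau> x) = F x)"
proof -
  have "(\<forall>s. perm_tab s v = v \<longrightarrow> F \<circ> inv (perm_tab s) = F) \<longleftrightarrow> (\<forall>x. F (perm_tab \<tau> x) = F x)"
  proof
    assume "\<forall>s. perm_tab s v = v \<longrightarrow> F \<circ> inv (perm_tab s) = F"
    then have "F \<circ> perm_tab \<tau> = F" using stabilizer_tau inv_tau by metis
    then show "\<forall>x. F (perm_tab \<tau> x) = F x" by (metis comp_apply)
  next
    assume F: "\<forall>x. F (perm_tab \<tau> x) = F x"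
    show "\<forall>s. perm_tab s v = v \<longrightarrow> F \<circ> inv (perm_tab s) = F"
    proof (intro allI impI)
      fix s assume "perm_tab s v = v"
      from stabilizer[OF this] show "F \<circ> inv (perm_tab s) = F"
      proof
        assume s: "Rep_row_perm s = id"
        have "inv (perm_tab s) = id" unfolding inv_perm_tab s by (simp add: fun_eq_iff vec_eq_iff)
        then show ?thesis by simp
      qed (simp add: inv_tau F fun_eq_iff)
    qed
  qed
  then show ?thesis unfolding inv_holo_def by simp
qed

lemma holo_shift_W: "f holo_on W \<Longrightarrow> (\<lambda>x. f (shift_tab \<sigma> x)) holo_on W"
  using holo_on_shift[of f W \<sigma>] shift_tab_vimage[OF W_shift] by simp

lemma agree_on_tau:
  assumes "agree_on U f g" "perm_tab \<tau> -` U = U"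
  shows "agree_on U (\<lambda>x. f (perm_tab \<tau> x)) (\<lambda>x. g (perm_tab \<tau> x))"
  using agree_on_comp[OF assms(1) tau_tau tau_tau continuous_perm_tab(1) continuous_perm_tab(1)]
    assms(2) by simp

text \<open>Points of \<open>z\<^sub>1 = 0\<close> are fixed by \<open>\<tau>\<close>, so an antisymmetric function vanishes there and can be divided
  by \<open>z\<^sub>1\<close>. For the same reason the symmetry of the quotient on \<open>z\<^sub>1 = 0\<close> is automatic.\<close>

lemma antisymmetric_divide:
  assumes "open U" "K holo_on U" "\<And>x. x \<in> U \<Longrightarrow> K (perm_tab \<tau> x) = - K x"
    "\<And>x. x \<in> U \<Longrightarrow> perm_tab \<tau> x \<in> U"
  obtains G where "G holo_on U" "\<And>x. x \<in> U \<Longrightarrow> K x = z1 a b x * G x"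
    "\<And>x. x \<in> U \<Longrightarrow> G (perm_tab \<tau> x) = G x"
proof -
  have "K x = 0" if "x \<in> U" "z1 a b x = 0" for x
    using assms(3)[OF that(1)] tau_fixes[OF that(2)] by simp
  then obtain G where G: "G holo_on U" "\<And>x. x \<in> U \<Longrightarrow> K x = z1 a b x * G x"
    using z1_divides[OF ab(1) assms(1,2)] by metis
  have "G (perm_tab \<tau> x) = G x" if x: "x \<in> U" for x
  proof (cases "z1 a b x = 0")
    case True
    then show ?thesis by (simp add: tau_fixes)
  next
    case False
    have "- (z1 a b x * G (perm_tab \<tau> x)) = - (z1 a b x * G x)"
      using G(2)[OF x] G(2)[OF assms(4)[OF x]] assms(3)[OF x] by (auto simp: z1_tau)
    then show ?thesis using False by auto
  qed
  then show thesis using G that by blast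
qed

section \<open>The action on invariant holomorphic functions\<close>

text \<open>The singularities of \<open>A(F)\<close> on \<open>W\<close> are removable and the extension is again an invariant
  holomorphic function. Single coefficients may well have poles on \<open>W\<close>, even outside \<open>z\<^sub>1 = 0\<close>.\<close>

definition acts_on_inv_holo :: "'n skew_ring \<Rightarrow> bool"
  where "acts_on_inv_holo A \<longleftrightarrow>
    (\<forall>F\<in>inv_holo v W. \<exists>G\<in>inv_holo v W. agree_on W (skew_op A F) G)"

lemma act_eqI:
  assumes "G \<in> inv_holo v W" "agree_on W (skew_op A F) G"
  shows "act W A F = G"
proof
  fix x
  show "act W A F x = G x"
    using assms hol_value_eq[OF open_W, of x G "skew_op A F"]
    by (auto simp: act_skew_op inv_holo_iff)
qed

lemma act_agree:
  assumes "acts_on_inv_holo A" "F \<in> inv_holo v W"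
  shows "act W A F \<in> inv_holo v W" "agree_on W (skew_op A F) (act W A F)"
  using assms act_eqI unfolding acts_on_inv_holo_def by metis+

lemma inv_holo_linear:
  "F \<in> inv_holo v W \<Longrightarrow> F' \<in> inv_holo v W \<Longrightarrow> (\<lambda>x. c * F x + d * F' x) \<in> inv_holo v W"
  by (auto simp: inv_holo_iff intro!: holo_on_add holo_on_mult holo_on_const)

lemma skew_op_add_agree:
  assumes "acts_on_inv_holo A" "acts_on_inv_holo B" "F \<in> inv_holo v W"
  shows "(\<lambda>x. act W A F x + act W B F x) \<in> inv_holo v W"
    "agree_on W (skew_op (A + B) F) (\<lambda>x. act W A F x + act W B F x)"
proof -
  show "(\<lambda>x. act W A F x + act W B F x) \<in> inv_holo v W"
    using inv_holo_linear[OF act_agree(1)[OF assms(1,3)] act_agree(1)[OF assms(2,3)], of 1 1] by simp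
  show "agree_on W (skew_op (A + B) F) (\<lambda>x. act W A F x + act W B F x)"
    by (rule agree_on_trans[OF agree_on_UNIV[OF skew_op_add open_W]
          agree_on_add[OF act_agree(2)[OF assms(1,3)] act_agree(2)[OF assms(2,3)]]])
qed

lemma act_add:
  assumes "acts_on_inv_holo A" "acts_on_inv_holo B" "F \<in> inv_holo v W"
  shows "act W (A + B) F = (\<lambda>x. act W A F x + act W B F x)"
  by (rule act_eqI[OF skew_op_add_agree[OF assms]])

text \<open>Replacing \<open>B(F)\<close> by its holomorphic extension changes the operator of \<open>A\<close> only outside a dense open
  set, because \<open>W\<close> is stable under shifts.\<close>

lemma skew_op_mult_agree:
  assumes "acts_on_inv_holo A" "acts_on_inv_holo B" "F \<in> inv_holo v W"
  shows "act W A (act W B F) \<in> inv_holo v W"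
    "agree_on W (skew_op (A * B) F) (act W A (act W B F))"
proof -
  note B = act_agree[OF assms(2,3)]
  note A = act_agree[OF assms(1) B(1)]
  show "act W A (act W B F) \<in> inv_holo v W" by (rule A(1))
  have "agree_on W (skew_op (A * B) F) (skew_op A (skew_op B F))"
    by (rule agree_on_UNIV[OF skew_op_mult open_W])
  also have "agree_on W \<dots> (skew_op A (act W B F))"
    by (rule skew_op_cong[OF B(2) open_W W_shift])
  also have "agree_on W \<dots> (act W A (act W B F))" by (rule A(2))
  finally show "agree_on W (skew_op (A * B) F) (act W A (act W B F))" .
qed

lemma act_mult:
  assumes "acts_on_inv_holo A" "acts_on_inv_holo B" "F \<in> inv_holo v W"
  shows "act W (A * B) F = act W A (act W B F)"
  by (rule act_eqI[OF skew_op_mult_agree[OF assms]])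

lemma act_linear:
  assumes "acts_on_inv_holo A" "F \<in> inv_holo v W" "F' \<in> inv_holo v W"
  shows "act W A (\<lambda>x. c * F x + d * F' x) = (\<lambda>x. c * act W A F x + d * act W A F' x)"
proof (rule act_eqI)
  show "(\<lambda>x. c * act W A F x + d * act W A F' x) \<in> inv_holo v W"
    by (intro inv_holo_linear act_agree assms)
  show "agree_on W (skew_op A (\<lambda>x. c * F x + d * F' x)) (\<lambda>x. c * act W A F x + d * act W A F' x)"
    unfolding skew_op_linear[abs_def]
    by (intro agree_on_add agree_on_mult agree_on_refl open_W act_agree assms)
qed

lemma act_function:
  assumes "f holo_on W" "\<And>x. f (perm_tab \<tau> x) = f x" "meromorphic f" "F \<in> inv_holo v W"
  shows "act W (fn (mero_of f)) F = (\<lambda>x. f x * F x)"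
proof (rule act_eqI)
  show "(\<lambda>x. f x * F x) \<in> inv_holo v W"
    using assms by (auto simp: inv_holo_iff intro: holo_on_mult)
  show "agree_on W (skew_op (fn (mero_of f)) F) (\<lambda>x. f x * F x)"
    using agree_on_mult[OF agree_on_UNIV[OF mero_value_mero_of[OF assms(3)] open_W]
        agree_on_refl[OF open_W]] by (simp add: skew_op_fn[abs_def])
qed

text \<open>At most a simple pole along \<open>z\<^sub>1 = 0\<close> and no other poles on \<open>U\<close>.\<close>

definition simple_polar :: "'n tab set \<Rightarrow> ('n tab \<Rightarrow> complex) \<Rightarrow> bool"
  where "simple_polar U f \<longleftrightarrow> (\<exists>H. H holo_on U \<and> agree_on U f (\<lambda>x. H x / z1 a b x))"

lemma simple_polarI:
  "H holo_on U \<Longrightarrow> agree_on U f (\<lambda>x. H x / z1 a b x) \<Longrightarrow> simple_polar U f"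
  unfolding simple_polar_def by blast

text \<open>Write \<open>f = K / z\<^sub>1\<close>. Invariance of \<open>f\<close> makes \<open>K\<close> antisymmetric, hence divisible by \<open>z\<^sub>1\<close>. This
  serves twice: for the functions \<open>A(F)\<close> on \<open>W\<close>, and for the coefficients of \<open>\<tau>\<close>-invariant shifts near
  \<open>v\<close>.\<close>

lemma symmetric_simple_polar_extends:
  assumes "open U" "perm_tab \<tau> -` U = U" "simple_polar U f" "agree_on U f (\<lambda>x. f (perm_tab \<tau> x))"
  obtains G where "G holo_on U" "agree_on U f G" "\<And>x. x \<in> U \<Longrightarrow> G (perm_tab \<tau> x) = G x"
proof -
  obtain K where K: "K holo_on U" and fK: "agree_on U f (\<lambda>x. K x / z1 a b x)"
    using assms(3) unfolding simple_polar_def by metis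
  have K': "(\<lambda>x. K (perm_tab \<tau> x)) holo_on U" using holo_on_perm[OF K, of \<tau>] assms(2) by simp
  have U: "perm_tab \<tau> x \<in> U" if "x \<in> U" for x using assms(2) that by blast
  have "agree_on U f (\<lambda>x. K (perm_tab \<tau> x) / z1 a b (perm_tab \<tau> x))"
    by (rule agree_on_trans[OF assms(4) agree_on_tau[OF fK assms(2)]])
  then have "agree_on U (\<lambda>x. K x / z1 a b x) (\<lambda>x. - K (perm_tab \<tau> x) / z1 a b x)"
    using agree_on_trans[OF agree_on_sym[OF fK]] by (simp add: z1_tau)
  note mid = agree_on_mult[OF agree_on_refl[OF assms(1), of "z1 a b"] this]
  have "agree_on U K (\<lambda>x. z1 a b x * (K x / z1 a b x))"
    "agree_on U (\<lambda>x. z1 a b x * (- K (perm_tab \<tau> x) / z1 a b x)) (\<lambda>x. - K (perm_tab \<tau> x))"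
    by (rule agree_off_z1[OF ab(1) assms(1)]; simp)+
  from agree_on_trans[OF agree_on_trans[OF this(1) mid] this(2)]
  have "agree_on U K (\<lambda>x. - K (perm_tab \<tau> x))" .
  then have "K x = - K (perm_tab \<tau> x)" if "x \<in> U" for x
    by (rule holo_agree_eq[OF _ assms(1) K holo_on_uminus[OF K'] that])
  then have "K (perm_tab \<tau> x) = - K x" if "x \<in> U" for x using that by force
  then obtain G where G: "G holo_on U" "\<And>x. x \<in> U \<Longrightarrow> K x = z1 a b x * G x"
    "\<And>x. x \<in> U \<Longrightarrow> G (perm_tab \<tau> x) = G x"
    using antisymmetric_divide[OF assms(1) K] U by metis
  have "agree_on U (\<lambda>x. K x / z1 a b x) G"
    by (rule agree_off_z1[OF ab(1) assms(1)]) (simp add: G)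
  then have "agree_on U f G" by (rule agree_on_trans[OF fK])
  then show thesis using G(1,3) that by metis
qed

lemma generator_acts:
  assumes inv: "perm_skew \<tau> A = A" and polar: "\<And>\<sigma>. simple_polar W (mero_value (coeff A \<sigma>))"
  shows "acts_on_inv_holo A"
  unfolding acts_on_inv_holo_def
proof
  fix F assume F: "F \<in> inv_holo v W"
  then have F': "F holo_on W" "\<And>x. F (perm_tab \<tau> x) = F x" by (auto simp: inv_holo_iff)
  obtain H where H: "\<And>\<sigma>. H \<sigma> holo_on W"
    "\<And>\<sigma>. agree_on W (mero_value (coeff A \<sigma>)) (\<lambda>x. H \<sigma> x / z1 a b x)"
    using polar unfolding simple_polar_def by metis
  have "agree_on W (skew_op A F) (\<lambda>x. \<Sum>\<sigma>\<in>supp A. (H \<sigma> x / z1 a b x) * F (shift_tab (- \<sigma>) x))"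
    unfolding skew_op_def by (intro agree_on_sum agree_on_mult H agree_on_refl open_W)
  then have "agree_on W (skew_op A F)
      (\<lambda>x. (\<Sum>\<sigma>\<in>supp A. H \<sigma> x * F (shift_tab (- \<sigma>) x)) / z1 a b x)"
    by (simp add: sum_divide_distrib)
  moreover have "(\<lambda>x. \<Sum>\<sigma>\<in>supp A. H \<sigma> x * F (shift_tab (- \<sigma>) x)) holo_on W"
    by (rule holo_on_sum, rule holo_on_mult[OF H(1) holo_shift_W[OF F'(1)]])
  ultimately have "simple_polar W (skew_op A F)" by (rule simple_polarI[rotated])
  moreover have "agree_on W (skew_op A F) (\<lambda>x. skew_op A F (perm_tab \<tau> x))"
    using agree_on_UNIV[OF skew_op_perm[of \<tau> A F] open_W] by (simp add: inv F' inv_tau)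
  ultimately obtain G where G: "G holo_on W" "agree_on W (skew_op A F) G"
    "\<And>x. x \<in> W \<Longrightarrow> G (perm_tab \<tau> x) = G x"
    using symmetric_simple_polar_extends[OF open_W tau_vimage_W] by metis
  \<comment> \<open>Functions on \<open>W\<close> are represented by their extension by zero.\<close>
  define G' where "G' = (\<lambda>x. if x \<in> W then G x else 0)"
  have "G' holo_on W" by (rule holo_on_cong[OF open_W _ G(1)]) (simp add: G'_def)
  then have "G' \<in> inv_holo v W"
    unfolding inv_holo_iff using G(3) by (simp add: G'_def tau_in_W_iff)
  moreover have "agree_on W (skew_op A F) G'"
    by (rule agree_on_trans[OF G(2) agree_on_eqI[OF open_W]]) (simp add: G'_def)
  ultimately show "\<exists>G\<in>inv_holo v W. agree_on W (skew_op A F) G" by blast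
qed

text \<open>Only generators need the pole argument: the property passes to sums and products by composition,
  although the coefficients of a product can have poles on \<open>W\<close> along \<open>z\<^sub>1 = m\<close> for integers \<open>m \<noteq> 0\<close>.\<close>

lemma universal_ring_acts: "A \<in> universal_ring a b v W \<Longrightarrow> acts_on_inv_holo A"
proof (induction rule: universal_ring.induct)
  case (generator A)
  then show ?case
    by (intro generator_acts) (simp_all add: skew_invariants_iff simple_polar_def)
next
  case one
  then show ?case
    unfolding acts_on_inv_holo_def skew_op_one[abs_def] using agree_on_refl[OF open_W] by blast
next
  case (add A B)
  then show ?case
    using skew_op_add_agree[of A B] unfolding acts_on_inv_holo_def[of "A + B"] by blast
next
  case (uminus A)
  show ?case
    unfolding acts_on_inv_holo_def[of "- A"]
  proof
    fix F assume F: "F \<in> inv_holo v W"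
    note A = act_agree[OF uminus.IH F]
    have "agree_on W (\<lambda>x. - skew_op A F x) (\<lambda>x. - act W A F x)"
      by (rule agree_on_binop[OF A(2) A(2), of "\<lambda>x y. - x"])
    then have "agree_on W (skew_op (- A) F) (\<lambda>x. - act W A F x)"
      by (rule agree_on_trans[OF agree_on_UNIV[OF skew_op_uminus open_W]])
    moreover have "(\<lambda>x. - act W A F x) \<in> inv_holo v W"
      using inv_holo_linear[OF A(1) A(1), of "-1" 0] by simp
    ultimately show "\<exists>G\<in>inv_holo v W. agree_on W (skew_op (- A) F) G" by blast
  qed
next
  case (times A B)
  then show ?case
    using skew_op_mult_agree[of A B] unfolding acts_on_inv_holo_def[of "A * B"] by blast
qed


section \<open>Poles of the coefficients at the singular point\<close>

lemma meromorphic_z1: "meromorphic (z1 a b)"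
  by (rule meromorphic_holo[OF holo_on_z1])

lemma simple_polar_add:
  assumes "simple_polar U f" "simple_polar U g"
  shows "simple_polar U (\<lambda>x. f x + g x)"
proof -
  obtain H where H: "H holo_on U" "agree_on U f (\<lambda>x. H x / z1 a b x)"
    using assms(1) unfolding simple_polar_def by metis
  obtain K where K: "K holo_on U" "agree_on U g (\<lambda>x. K x / z1 a b x)"
    using assms(2) unfolding simple_polar_def by metis
  show ?thesis
    using agree_on_add[OF H(2) K(2)]
    by (intro simple_polarI[OF holo_on_add[OF H(1) K(1)]]) (simp add: add_divide_distrib)
qed

lemma simple_polar_mult_holo:
  assumes "simple_polar U f" "g holo_on U" "open U"
  shows "simple_polar U (\<lambda>x. f x * g x)"
proof -
  obtain H where H: "H holo_on U" "agree_on U f (\<lambda>x. H x / z1 a b x)"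
    using assms(1) unfolding simple_polar_def by metis
  show ?thesis
    using agree_on_mult[OF H(2) agree_on_refl[OF assms(3), of g]]
    by (intro simple_polarI[OF holo_on_mult[OF H(1) assms(2)]]) simp
qed

lemma simple_polar_agree:
  assumes "simple_polar U f" "agree_on U g f" shows "simple_polar U g"
proof -
  obtain H where H: "H holo_on U" "agree_on U f (\<lambda>x. H x / z1 a b x)"
    using assms(1) unfolding simple_polar_def by metis
  show ?thesis by (rule simple_polarI[OF H(1) agree_on_trans[OF assms(2) H(2)]])
qed

lemma simple_polar_subset:
  assumes "simple_polar U f" "open V" "V \<subseteq> U" shows "simple_polar V f"
proof -
  obtain H where H: "H holo_on U" "agree_on U f (\<lambda>x. H x / z1 a b x)"
    using assms(1) unfolding simple_polar_def by metis
  show ?thesis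
    by (rule simple_polarI[OF holo_on_subset[OF H(1) assms(3)] agree_on_subset[OF H(2) assms(2,3)]])
qed

lemma simple_polar_holo:
  assumes "f holo_on U" "open U" shows "simple_polar U f"
  by (rule simple_polarI[OF holo_on_mult[OF holo_on_z1[of a b] assms(1)]])
    (rule agree_off_z1[OF ab(1) assms(2)], simp)

definition pole_at_v :: "'n tab_index mero \<Rightarrow> bool"
  where "pole_at_v m \<longleftrightarrow> (\<exists>U. open U \<and> v \<in> U \<and> simple_polar U (mero_value m))"

lemma pole_at_vI: "open U \<Longrightarrow> v \<in> U \<Longrightarrow> simple_polar U (mero_value m) \<Longrightarrow> pole_at_v m"
  unfolding pole_at_v_def by (rule exI[of _ U]) simp

lemma pole_at_vE:
  assumes "pole_at_v m" obtains U where "open U" "v \<in> U" "U \<subseteq> W" "simple_polar U (mero_value m)"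
proof -
  from assms obtain U where "open U \<and> v \<in> U \<and> simple_polar U (mero_value m)"
    unfolding pole_at_v_def by (elim exE)
  then have U: "open U" "v \<in> U" "simple_polar U (mero_value m)" by simp_all
  show thesis
    by (rule that[of "U \<inter> W"])
      (use U open_W v_in_W in \<open>auto intro: simple_polar_subset[OF U(3)]\<close>)
qed

lemma pole_at_v_zero: "pole_at_v 0"
  by (rule pole_at_vI[OF open_W v_in_W])
    (simp add: mero_value_zero[abs_def] simple_polar_holo open_W holo_on_const)

lemma pole_at_v_add:
  assumes "pole_at_v m" "pole_at_v m'" shows "pole_at_v (m + m')"
proof -
  obtain U where U: "open U" "v \<in> U" "U \<subseteq> W" "simple_polar U (mero_value m)"
    by (rule pole_at_vE[OF assms(1)])
  obtain U' where U': "open U'" "v \<in> U'" "U' \<subseteq> W" "simple_polar U' (mero_value m')"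
    by (rule pole_at_vE[OF assms(2)])
  have o: "open (U \<inter> U')" using U(1) U'(1) by (rule open_Int)
  have "simple_polar (U \<inter> U') (\<lambda>x. mero_value m x + mero_value m' x)"
    by (intro simple_polar_add simple_polar_subset[OF U(4) o] simple_polar_subset[OF U'(4) o]) auto
  then show ?thesis
    by (intro pole_at_vI[OF o]) (use U(2) U'(2) in
        \<open>auto intro: simple_polar_agree agree_on_UNIV[OF mero_value_add o]\<close>)
qed

lemma pole_at_v_sum: "(\<And>i. i \<in> I \<Longrightarrow> pole_at_v (m i)) \<Longrightarrow> pole_at_v (\<Sum>i\<in>I. m i)"
  by (induction I rule: infinite_finite_induct) (auto intro: pole_at_v_zero pole_at_v_add)

lemma pole_times_regular:
  assumes "open U" "v \<in> U" "simple_polar U (mero_value m)"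
    "open U'" "v \<in> U'" "g holo_on U'" "agree_on U' (mero_value m') g"
  shows "pole_at_v (m * m')"
proof -
  have o: "open (U \<inter> U')" using assms(1,4) by (rule open_Int)
  have 1: "simple_polar (U \<inter> U') (\<lambda>x. mero_value m x * g x)"
    by (intro simple_polar_mult_holo simple_polar_subset[OF assms(3) o] holo_on_subset[OF assms(6)] o) auto
  have 2: "agree_on (U \<inter> U') (\<lambda>x. mero_value m x * mero_value m' x) (\<lambda>x. mero_value m x * g x)"
    by (intro agree_on_mult agree_on_refl o agree_on_subset[OF assms(7) o]) auto
  show ?thesis
    by (rule pole_at_vI[OF o _ simple_polar_agree[OF 1 agree_on_trans[OF agree_on_UNIV[OF mero_value_mult o] 2]]])
      (use assms(2,5) in simp)
qed

lemma perm_shift_tau_fixed_iff: "perm_shift \<tau> \<sigma> = \<sigma> \<longleftrightarrow> shift_at \<sigma> a = shift_at \<sigma> b"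
proof
  assume "perm_shift \<tau> \<sigma> = \<sigma>"
  then have "shift_at \<sigma> b = shift_at (perm_shift \<tau> \<sigma>) b" by simp
  then show "shift_at \<sigma> a = shift_at \<sigma> b" by (simp add: shift_at_perm Rep_tau)
next
  assume "shift_at \<sigma> a = shift_at \<sigma> b"
  then show "perm_shift \<tau> \<sigma> = \<sigma>"
    by (intro gimel_eqI) (auto simp: shift_at_perm Rep_tau Transposition.transpose_def)
qed

lemma z1_shift: "z1 a b (shift_tab \<sigma> x) = z1 a b x + of_int (shift_at \<sigma> a - shift_at \<sigma> b)"
  by (simp add: z1_def shift_tab_def)

text \<open>The coefficient of a \<open>\<tau>\<close>-invariant shift in an invariant element is itself \<open>\<tau>\<close>-invariant, so a
  simple pole is impossible. The neighbourhood is first made symmetric.\<close>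

lemma tau_fixed_coeff_regular:
  assumes "perm_skew \<tau> A = A" "pole_at_v (coeff A \<sigma>)" "perm_shift \<tau> \<sigma> = \<sigma>"
  obtains U g where "open U" "v \<in> U" "g holo_on U" "agree_on U (mero_value (coeff A \<sigma>)) g"
proof -
  let ?m = "mero_value (coeff A \<sigma>)"
  obtain U where U: "open U" "v \<in> U" "simple_polar U ?m"
    using pole_at_vE[OF assms(2)] by metis
  define V where "V = U \<inter> perm_tab \<tau> -` U"
  have V: "open V" "v \<in> V" "perm_tab \<tau> -` V = V"
    unfolding V_def using U(1,2) stabilizer_tau
    by (auto simp: tau_tau intro!: open_Int open_vimage continuous_perm_tab)
  have "perm_mero \<tau> (coeff A \<sigma>) = coeff A \<sigma>"
    using coeff_perm_skew[of \<tau> A \<sigma>] assms(1,3) by simp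
  then have "agree_on V ?m (\<lambda>x. ?m (perm_tab \<tau> x))"
    using agree_on_UNIV[OF mero_value_perm[of \<tau> "coeff A \<sigma>"] V(1)] by (simp add: inv_tau)
  then obtain G where "G holo_on V" "agree_on V ?m G"
    using symmetric_simple_polar_extends[OF V(1,3) simple_polar_subset[OF U(3) V(1)]]
    by (metis V_def inf_le1)
  then show thesis using that V by metis
qed

text \<open>The inductive invariant for products of generators: unlike the condition on generators it
  concerns a neighbourhood of \<open>v\<close> only, where shifted poles do not reach.\<close>

definition tame_at_v :: "'n skew_ring \<Rightarrow> bool"
  where "tame_at_v A \<longleftrightarrow> perm_skew \<tau> A = A \<and> (\<forall>\<sigma>. pole_at_v (coeff A \<sigma>))"

text \<open>The coefficients of the product are sums of \<open>c \<cdot> \<sigma>(d)\<close> with \<open>c\<close>, \<open>d\<close> coefficients of \<open>A\<close> and \<open>B\<close>. Each of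
  the two factors may have a simple pole; the case distinction shows that at \<open>v\<close> at most one of them
  does. The generator has to stand on the right: the shift then acts on \<open>B\<close>, whose poles are known on
  all of \<open>W\<close>.\<close>

lemma tame_times_generator:
  assumes "tame_at_v A" "perm_skew \<tau> B = B" "\<And>\<sigma>. simple_polar W (mero_value (coeff B \<sigma>))"
  shows "tame_at_v (A * B)"
  unfolding tame_at_v_def
proof (intro conjI allI)
  show "perm_skew \<tau> (A * B) = A * B"
    using assms(1,2) by (simp add: perm_skew_mult tame_at_v_def)
  fix \<rho>
  show "pole_at_v (coeff (A * B) \<rho>)"
    unfolding coeff_times
  proof (rule pole_at_v_sum)
    fix \<sigma>
    let ?c = "coeff A \<sigma>" and ?d = "coeff B (\<rho> - \<sigma>)"
    have A: "perm_skew \<tau> A = A" "pole_at_v ?c" using assms(1) by (auto simp: tame_at_v_def)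
    obtain H where H: "H holo_on W" "agree_on W (mero_value ?d) (\<lambda>x. H x / z1 a b x)"
      using assms(3)[of "\<rho> - \<sigma>"] unfolding simple_polar_def by metis
    have H': "(\<lambda>x. H (shift_tab (- \<sigma>) x)) holo_on W" by (rule holo_shift_W[OF H(1)])
    have d: "agree_on W (mero_value (shift_mero \<sigma> ?d))
        (\<lambda>x. H (shift_tab (- \<sigma>) x) / z1 a b (shift_tab (- \<sigma>) x))"
      by (rule agree_on_trans[OF agree_on_UNIV[OF mero_value_shift open_W] agree_on_shift[OF H(2) W_shift]])
    show "pole_at_v (?c * shift_mero \<sigma> ?d)"
    proof (cases "perm_shift \<tau> \<sigma> = \<sigma>")
      case True
      \<comment> \<open>Here \<open>\<sigma>\<close> does not move \<open>z\<^sub>1\<close>: the pole of \<open>\<sigma>(d)\<close> stays at \<open>v\<close>, but \<open>c\<close> has none.\<close>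
      obtain U g where g: "open U" "v \<in> U" "g holo_on U" "agree_on U (mero_value ?c) g"
        by (rule tau_fixed_coeff_regular[OF A True])
      have "simple_polar W (mero_value (shift_mero \<sigma> ?d))"
        using d True by (intro simple_polarI[OF H'])
          (simp add: z1_shift perm_shift_tau_fixed_iff shift_at_ops)
      from pole_times_regular[OF open_W v_in_W this g] show ?thesis by (simp add: mult.commute)
    next
      case False
      then have m: "shift_at \<sigma> a \<noteq> shift_at \<sigma> b" by (simp add: perm_shift_tau_fixed_iff)
      obtain U where U: "open U" "v \<in> U" "simple_polar U (mero_value ?c)"
        using pole_at_vE[OF A(2)] by metis
      \<comment> \<open>The pole of \<open>\<sigma>(d)\<close> lies on \<open>z\<^sub>1 = m\<close> with \<open>m = \<sigma>\<^sub>a - \<sigma>\<^sub>b \<noteq> 0\<close>, so \<open>\<sigma>(d)\<close> is holomorphic at \<open>v\<close>.\<close>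
      define V where "V = {x \<in> W. z1 a b (shift_tab (- \<sigma>) x) \<noteq> 0}"
      have hz: "(\<lambda>x. z1 a b (shift_tab (- \<sigma>) x)) holo_on W" by (rule holo_shift_W[OF holo_on_z1])
      have V: "open V" unfolding V_def by (rule holo_on_imp_open_nonzero[OF hz open_W])
      have "v \<in> V"
        using v_in_W m z1_v by (simp add: V_def z1_shift shift_at_ops flip: of_int_add of_int_diff)
      moreover have VW: "V \<subseteq> W" by (auto simp: V_def)
      have "(\<lambda>x. H (shift_tab (- \<sigma>) x) / z1 a b (shift_tab (- \<sigma>) x)) holo_on V"
        by (rule holo_on_divide[OF holo_on_subset[OF H' VW] holo_on_subset[OF hz VW]])
          (simp add: V_def)
      ultimately show ?thesis
        using pole_times_regular[OF U V _ _ agree_on_subset[OF d V VW]] by simp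
    qed
  qed
qed

lemma tame_add: "tame_at_v A \<Longrightarrow> tame_at_v B \<Longrightarrow> tame_at_v (A + B)"
  by (simp add: tame_at_v_def perm_skew_add coeff_add pole_at_v_add)

lemma tame_uminus: "tame_at_v A \<Longrightarrow> tame_at_v (- A)"
proof -
  assume A: "tame_at_v A"
  \<comment> \<open>The constant \<open>-1\<close> satisfies the condition on generators.\<close>
  have e: "- A = A * - 1" by simp
  show ?thesis
    unfolding e
  proof (rule tame_times_generator[OF A])
    show "perm_skew \<tau> (- 1) = - 1" by (simp add: perm_skew_uminus perm_skew_one)
    have m1: "mero_of (\<lambda>x. -1) = (-1 :: 'n tab_index mero)"
      using mero_of_ops(1)[OF meromorphic_const[of 1] meromorphic_const[of "-1"]]
      by (simp add: mero_of_zero mero_of_one add_eq_0_iff)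
    show "simple_polar W (mero_value (coeff (- 1) \<sigma>))" for \<sigma>
      by (simp add: coeff_uminus coeff_one m1[symmetric] mero_value_const[abs_def] mero_value_zero[abs_def]
          simple_polar_holo holo_on_const open_W)
  qed
qed

text \<open>For a product \<open>A A'\<close> knowing that both factors are tame does not suffice, as tameness is not known
  at the other points of the orbit. So the induction shows instead that right multiplication by \<open>A\<close>
  preserves tameness; these \<open>A\<close> are closed under products by associativity.\<close>

lemma universal_ring_tame:
  assumes "A \<in> universal_ring a b v W" shows "tame_at_v A"
proof -
  have "tame_at_v (B * A)" if "tame_at_v B" for B
    using assms that
  proof (induction arbitrary: B rule: universal_ring.induct)
    case (generator A)
    then show ?case
      by (intro tame_times_generator) (simp_all add: skew_invariants_iff simple_polar_def)
  next
    case (add A A')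
    then show ?case by (simp add: distrib_left tame_add)
  next
    case (times A A')
    then show ?case by (simp flip: mult.assoc)
  qed (simp_all add: tame_uminus)
  moreover have "tame_at_v 1"
    unfolding tame_at_v_def
    by (auto simp: perm_skew_one coeff_one pole_at_v_zero mero_value_one[abs_def]
        intro!: pole_at_vI[OF open_W v_in_W] simple_polar_holo holo_on_const open_W)
  ultimately show ?thesis by (metis mult_1)
qed

section \<open>Evaluation at the singular point\<close>

definition partial_z1 :: "('n tab \<Rightarrow> complex) \<Rightarrow> complex"
  where "partial_z1 f = deriv (\<lambda>t. f (v + t *s z1_dir a b)) 0"

lemma partial_z1_derivative:
  assumes "f holo_on U" "v \<in> U"
  shows "((\<lambda>t. f (v + t *s z1_dir a b)) has_field_derivative partial_z1 f) (at 0)"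
proof -
  have "v + 0 *s z1_dir a b \<in> U" using assms(2) by simp
  from holo_on_line_derivative[OF assms(1) this] show ?thesis
    unfolding partial_z1_def by (simp add: DERIV_imp_deriv)
qed

lemma partial_z1_cong:
  assumes "open U" "v \<in> U" "\<And>x. x \<in> U \<Longrightarrow> f x = g x"
  shows "partial_z1 f = partial_z1 g"
proof -
  have "continuous_on UNIV (\<lambda>t. v + t *s z1_dir a b)" by (intro continuous_intros)
  then have "open ((\<lambda>t. v + t *s z1_dir a b) -` U)" by (rule open_vimage[OF assms(1)])
  then have "\<forall>\<^sub>F t in nhds 0. t \<in> (\<lambda>t. v + t *s z1_dir a b) -` U"
    by (rule eventually_nhds_in_open) (simp add: assms(2))
  then have "\<forall>\<^sub>F t in nhds 0. f (v + t *s z1_dir a b) = g (v + t *s z1_dir a b)"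
    by (rule eventually_mono) (simp add: assms(3))
  then show ?thesis unfolding partial_z1_def by (rule deriv_cong_ev) simp
qed

lemma partial_z1_mult:
  assumes "f holo_on U" "g holo_on U" "v \<in> U"
  shows "partial_z1 (\<lambda>x. f x * g x) = partial_z1 f * g v + f v * partial_z1 g"
  using DERIV_imp_deriv[OF DERIV_mult[OF partial_z1_derivative[OF assms(1,3)]
        partial_z1_derivative[OF assms(2,3)]]]
  unfolding partial_z1_def[of "\<lambda>x. f x * g x"] by (simp add: algebra_simps)

lemma partial_z1_sum:
  assumes "\<And>i. i \<in> I \<Longrightarrow> f i holo_on U" "v \<in> U"
  shows "partial_z1 (\<lambda>x. \<Sum>i\<in>I. f i x) = (\<Sum>i\<in>I. partial_z1 (f i))"
  unfolding partial_z1_def[of "\<lambda>x. \<Sum>i\<in>I. f i x"]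
  by (intro DERIV_imp_deriv DERIV_sum partial_z1_derivative[OF assms(1)] assms(2))

lemma partial_z1_z1: "partial_z1 (z1 a b) = 1"
  unfolding partial_z1_def z1_along[OF ab(1)] by simp

lemma partial_z1_tau:
  assumes "f holo_on W" shows "partial_z1 (\<lambda>x. f (perm_tab \<tau> x)) = - partial_z1 f"
proof -
  have e: "perm_tab \<tau> (v + t *s z1_dir a b) = v + (- t) *s z1_dir a b" for t
  proof -
    have "perm_tab \<tau> (v + t *s z1_dir a b) = perm_tab \<tau> v + perm_tab \<tau> (t *s z1_dir a b)"
      by (simp add: vec_eq_iff perm_tab_tau)
    moreover have "perm_tab \<tau> (t *s z1_dir a b) = (- t) *s z1_dir a b"
      using ab(1) by (auto simp: vec_eq_iff perm_tab_tau axis_def Transposition.transpose_def)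
    ultimately show ?thesis by (simp add: stabilizer_tau)
  qed
  have "((\<lambda>t. f (v + (- t) *s z1_dir a b)) has_field_derivative partial_z1 f * (- 1)) (at 0)"
    by (rule DERIV_chain2[where f = "\<lambda>t. f (v + t *s z1_dir a b)" and g = uminus])
      (use partial_z1_derivative[OF assms v_in_W] in \<open>auto intro!: derivative_eq_intros\<close>)
  then show ?thesis unfolding partial_z1_def[of "\<lambda>x. f (perm_tab \<tau> x)"] e
    by (simp add: DERIV_imp_deriv)
qed

lemma deriv_z1_partial: "deriv_z1 a b g v = partial_z1 (mero_value g)"
proof -
  have "(t / 2) *s (axis a 1 - axis b 1) = t *s z1_dir a b" for t :: complex
    by (simp add: vec_eq_iff)
  then show ?thesis unfolding deriv_z1_def partial_z1_def by simp
qed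

text \<open>On a common neighbourhood of \<open>v\<close> the identity \<open>z\<^sub>1 A(F) = \<Sum> g\<^sub>\<sigma> \<phi>\<^sub>\<sigma>\<close> holds between holomorphic functions;
  differentiating it at the zero \<open>v\<close> of \<open>z\<^sub>1\<close> isolates \<open>A(F)(v)\<close>.\<close>

lemma act_at_v:
  assumes "A \<in> universal_ring a b v W" "F \<in> inv_holo v W" "finite I" "supp A \<subseteq> I"
  shows "act W A F v = (\<Sum>\<sigma>\<in>I.
    mero_value (mero_of (z1 a b) * coeff A \<sigma>) v * partial_z1 (\<lambda>x. F (shift_tab (- \<sigma>) x)) +
    deriv_z1 a b (mero_of (z1 a b) * coeff A \<sigma>) v * F (shift_tab (- \<sigma>) v))"
proof -
  let ?m = "\<lambda>\<sigma>. mero_value (coeff A \<sigma>)" and ?F = "\<lambda>\<sigma> x. F (shift_tab (- \<sigma>) x)"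
  let ?g = "\<lambda>\<sigma>. mero_value (mero_of (z1 a b) * coeff A \<sigma>)"
  have "\<exists>U. open U \<and> v \<in> U \<and> U \<subseteq> W \<and> simple_polar U (?m \<sigma>)" for \<sigma>
    using pole_at_vE[of "coeff A \<sigma>"] universal_ring_tame[OF assms(1)] unfolding tame_at_v_def by metis
  then obtain U where U: "\<And>\<sigma>. open (U \<sigma>)" "\<And>\<sigma>. v \<in> U \<sigma>" "\<And>\<sigma>. U \<sigma> \<subseteq> W"
    "\<And>\<sigma>. simple_polar (U \<sigma>) (?m \<sigma>)" by metis
  define V where "V = W \<inter> (\<Inter>\<sigma>\<in>I. U \<sigma>)"
  have V: "open V" "v \<in> V" "V \<subseteq> W"
    unfolding V_def using U(1,2) open_W v_in_W assms(3) by (auto intro!: open_INT)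
  have "\<exists>g. g holo_on V \<and> agree_on V (?m \<sigma>) (\<lambda>x. g x / z1 a b x)" if "\<sigma> \<in> I" for \<sigma>
  proof -
    have "V \<subseteq> U \<sigma>" using that by (auto simp: V_def)
    then show ?thesis using simple_polar_subset[OF U(4) V(1)] unfolding simple_polar_def by metis
  qed
  then obtain g where g: "\<And>\<sigma>. \<sigma> \<in> I \<Longrightarrow> g \<sigma> holo_on V"
    "\<And>\<sigma>. \<sigma> \<in> I \<Longrightarrow> agree_on V (?m \<sigma>) (\<lambda>x. g \<sigma> x / z1 a b x)" by metis
  have mg: "?g \<sigma> x = g \<sigma> x" if "\<sigma> \<in> I" "x \<in> V" for \<sigma> x
  proof (rule mero_value_eq[OF V(1) g(1)[OF that(1)] _ that(2)])
    have "agree_on V (?g \<sigma>) (\<lambda>x. mero_value (mero_of (z1 a b)) x * ?m \<sigma> x)"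
      by (rule agree_on_UNIV[OF mero_value_mult V(1)])
    also have "agree_on V \<dots> (\<lambda>x. z1 a b x * (g \<sigma> x / z1 a b x))"
      by (rule agree_on_mult[OF agree_on_UNIV[OF mero_value_mero_of[OF meromorphic_z1] V(1)] g(2)[OF that(1)]])
    also have "agree_on V \<dots> (g \<sigma>)" by (rule agree_off_z1[OF ab(1) V(1)]) simp
    finally show "agree_on V (?g \<sigma>) (g \<sigma>)" .
  qed
  have F: "?F \<sigma> holo_on V" for \<sigma>
    using holo_shift_W[of F "- \<sigma>"] assms(2) V(3) holo_on_subset by (metis inv_holo_iff)
  note act = act_agree[OF universal_ring_acts[OF assms(1)] assms(2)]
  have G: "act W A F holo_on V" using act(1) V(3) holo_on_subset by (metis inv_holo_iff)
  have gF: "(\<lambda>x. g \<sigma> x * ?F \<sigma> x) holo_on V" if "\<sigma> \<in> I" for \<sigma>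
    by (rule holo_on_mult[OF g(1)[OF that] F])
  have "agree_on V (act W A F) (skew_op A F)"
    by (rule agree_on_sym[OF agree_on_subset[OF act(2) V(1,3)]])
  also have "skew_op A F = (\<lambda>x. \<Sum>\<sigma>\<in>I. ?m \<sigma> x * ?F \<sigma> x)"
    using skew_op_superset[OF assms(3,4)] by (simp add: fun_eq_iff)
  also have "agree_on V \<dots> (\<lambda>x. \<Sum>\<sigma>\<in>I. (g \<sigma> x / z1 a b x) * ?F \<sigma> x)"
    by (rule agree_on_sum[OF V(1)], rule agree_on_mult[OF g(2) agree_on_refl[OF V(1)]])
  finally have "agree_on V (\<lambda>x. z1 a b x * act W A F x)
      (\<lambda>x. z1 a b x * (\<Sum>\<sigma>\<in>I. (g \<sigma> x / z1 a b x) * ?F \<sigma> x))"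
    by (rule agree_on_mult[OF agree_on_refl[OF V(1)]])
  also have "agree_on V \<dots> (\<lambda>x. \<Sum>\<sigma>\<in>I. g \<sigma> x * ?F \<sigma> x)"
    by (rule agree_off_z1[OF ab(1) V(1)]) (simp add: sum_distrib_left)
  finally have "z1 a b x * act W A F x = (\<Sum>\<sigma>\<in>I. g \<sigma> x * ?F \<sigma> x)" if "x \<in> V" for x
    by (rule holo_agree_eq[OF _ V(1) holo_on_mult[OF holo_on_z1 G] holo_on_sum[OF gF] that])
  then have "partial_z1 (\<lambda>x. z1 a b x * act W A F x) = partial_z1 (\<lambda>x. \<Sum>\<sigma>\<in>I. g \<sigma> x * ?F \<sigma> x)"
    by (rule partial_z1_cong[OF V(1,2)])
  moreover have "partial_z1 (\<lambda>x. z1 a b x * act W A F x) = act W A F v"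
    using partial_z1_mult[OF holo_on_z1 G V(2)] by (simp add: partial_z1_z1 z1_v)
  moreover have "partial_z1 (\<lambda>x. \<Sum>\<sigma>\<in>I. g \<sigma> x * ?F \<sigma> x) =
      (\<Sum>\<sigma>\<in>I. partial_z1 (\<lambda>x. g \<sigma> x * ?F \<sigma> x))"
    by (rule partial_z1_sum[OF gF V(2)])
  moreover have "partial_z1 (\<lambda>x. g \<sigma> x * ?F \<sigma> x) =
      ?g \<sigma> v * partial_z1 (?F \<sigma>) + deriv_z1 a b (mero_of (z1 a b) * coeff A \<sigma>) v * ?F \<sigma> v"
    if "\<sigma> \<in> I" for \<sigma>
  proof -
    have "partial_z1 (?g \<sigma>) = partial_z1 (g \<sigma>)"
      by (rule partial_z1_cong[OF V(1,2)]) (simp add: mg[OF that])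
    then show ?thesis
      using partial_z1_mult[OF g(1)[OF that] F V(2)] mg[OF that V(2)] by (simp add: deriv_z1_partial)
  qed
  ultimately show ?thesis by simp
qed


section \<open>Generators of the universal ring\<close>

definition polar :: "'n skew_ring \<Rightarrow> bool"
  where "polar A \<longleftrightarrow> (\<forall>\<sigma>. simple_polar W (mero_value (coeff A \<sigma>)))"

lemma simple_polar_zero: "simple_polar W (mero_value 0)"
  by (simp add: mero_value_zero[abs_def] simple_polar_holo open_W holo_on_const)

lemma simple_polar_mero_of:
  assumes "meromorphic f" "simple_polar W f" shows "simple_polar W (mero_value (mero_of f))"
  by (rule simple_polar_agree[OF assms(2) agree_on_UNIV[OF mero_value_mero_of[OF assms(1)] open_W]])

lemma polar_zero: "polar 0"
  by (simp add: polar_def coeff_zero simple_polar_zero)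

lemma polar_add: "polar A \<Longrightarrow> polar B \<Longrightarrow> polar (A + B)"
  unfolding polar_def coeff_add
  using simple_polar_agree[OF simple_polar_add agree_on_UNIV[OF mero_value_add open_W]] by simp

lemma polar_sum: "(\<And>i. i \<in> I \<Longrightarrow> polar (A i)) \<Longrightarrow> polar (\<Sum>i\<in>I. A i)"
  by (induction I rule: infinite_finite_induct) (auto intro: polar_zero polar_add)

lemma polar_monomial: "simple_polar W (mero_value f) \<Longrightarrow> polar (fn f * grp \<sigma>)"
  by (simp add: polar_def coeff_fn_grp simple_polar_zero)

lemma polar_uminus:
  assumes "polar A" shows "polar (- A)"
  unfolding polar_def coeff_uminus
proof
  fix \<sigma>
  have "simple_polar W (\<lambda>x. mero_value (coeff A \<sigma>) x * (- 1))"
    using assms by (intro simple_polar_mult_holo holo_on_const open_W) (simp add: polar_def)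
  then show "simple_polar W (mero_value (- coeff A \<sigma>))"
    using simple_polar_agree[OF _ agree_on_UNIV[OF mero_value_uminus open_W]] by simp
qed

lemma generator_in_universal_ring:
  "perm_skew \<tau> A = A \<Longrightarrow> polar A \<Longrightarrow> A \<in> universal_ring a b v W"
  by (rule universal_ring.generator) (simp_all add: skew_invariants_iff polar_def simple_polar_def)

lemma universal_ring_zero: "0 \<in> universal_ring a b v W"
  using universal_ring.add[OF universal_ring.one universal_ring.uminus[OF universal_ring.one]] by simp

lemma universal_ring_diff:
  "A \<in> universal_ring a b v W \<Longrightarrow> B \<in> universal_ring a b v W \<Longrightarrow> A - B \<in> universal_ring a b v W"
  using universal_ring.add[OF _ universal_ring.uminus, of A a b v W B] by simp

lemma universal_ring_sum:
  "(\<And>i. i \<in> I \<Longrightarrow> A i \<in> universal_ring a b v W) \<Longrightarrow> (\<Sum>i\<in>I. A i) \<in> universal_ring a b v W"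
  by (induction I rule: infinite_finite_induct)
    (auto intro: universal_ring_zero universal_ring.add)

lemma function_in_universal_ring:
  assumes "f holo_on UNIV" "\<And>x. f (perm_tab \<tau> x) = f x"
  shows "fn (mero_of f) \<in> universal_ring a b v W"
proof (rule generator_in_universal_ring)
  have m: "meromorphic f" by (rule meromorphic_holo[OF assms(1)])
  have "f \<circ> inv (perm_tab \<tau>) = f" using assms(2) by (simp add: fun_eq_iff inv_tau)
  then show "perm_skew \<tau> (fn (mero_of f)) = fn (mero_of f)"
    using perm_skew_monomial[of \<tau> "mero_of f" 0]
    by (simp add: fn_as_monomial perm_shift_hom perm_mero_mero_of[OF m])
  have "simple_polar W (mero_value (mero_of f))"
    by (rule simple_polar_mero_of[OF m simple_polar_holo[OF holo_on_subset[OF assms(1)] open_W]]) simp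
  from polar_monomial[OF this, of 0] show "polar (fn (mero_of f))" by (simp add: fn_as_monomial)
qed

lemma const_in_universal_ring: "fn (mero_of (\<lambda>x. c)) \<in> universal_ring a b v W"
  by (rule function_in_universal_ring) (simp_all add: holo_on_const)

lemma orbit_sum_in_universal_ring: "grp \<sigma> + grp (perm_shift \<tau> \<sigma>) \<in> universal_ring a b v W"
proof (rule generator_in_universal_ring)
  have p: "perm_skew \<tau> (grp \<rho>) = grp (perm_shift \<tau> \<rho>)" for \<rho>
    using perm_skew_monomial[of \<tau> 1 \<rho>] by (simp add: perm_mero_hom grp_as_monomial)
  show "perm_skew \<tau> (grp \<sigma> + grp (perm_shift \<tau> \<sigma>)) = grp \<sigma> + grp (perm_shift \<tau> \<sigma>)"
    by (simp add: perm_skew_add p perm_shift_tau_tau add.commute)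
  have "polar (grp \<rho>)" for \<rho>
    using polar_monomial[of 1 \<rho>]
    by (simp add: grp_as_monomial mero_value_one[abs_def] simple_polar_holo holo_on_const open_W)
  then show "polar (grp \<sigma> + grp (perm_shift \<tau> \<sigma>))" by (intro polar_add)
qed

lemma meromorphic_half_inverse_z1: "meromorphic (\<lambda>x. 1 / (2 * z1 a b x))"
proof (rule meromorphic_quotient)
  show "(\<lambda>x. 2 * z1 a b x) holo_on UNIV" by (rule holo_on_mult[OF holo_on_const holo_on_z1])
  show "closure {x. 2 * z1 a b x \<noteq> 0} = UNIV"
    using dense_coordinates_distinct[OF ab(1)] by (simp add: z1_def)
qed (rule holo_on_const)

lemma orbit_difference_in_universal_ring:
  "fn (mero_of (\<lambda>x. 1 / (2 * z1 a b x))) * (grp \<sigma> - grp (perm_shift \<tau> \<sigma>)) \<in> universal_ring a b v W"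
proof (rule generator_in_universal_ring)
  let ?f = "mero_of (\<lambda>x. 1 / (2 * z1 a b x))"
  note m = meromorphic_half_inverse_z1
  have "perm_mero \<tau> ?f = mero_of (\<lambda>x. - (1 / (2 * z1 a b x)))"
    by (simp add: perm_mero_mero_of[OF m] inv_tau comp_def z1_tau)
  moreover have "mero_of (\<lambda>x. - (1 / (2 * z1 a b x))) + ?f = 0"
    by (simp add: mero_of_ops meromorphic_uminus[OF m] m mero_of_zero)
  ultimately have f: "perm_mero \<tau> ?f = - ?f" by (simp add: eq_neg_iff_add_eq_0)
  have e: "fn ?f * (grp \<sigma> - grp (perm_shift \<tau> \<sigma>)) =
      fn ?f * grp \<sigma> + - (fn ?f * grp (perm_shift \<tau> \<sigma>))" by (simp add: right_diff_distrib)
  show "perm_skew \<tau> (fn ?f * (grp \<sigma> - grp (perm_shift \<tau> \<sigma>))) =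
      fn ?f * (grp \<sigma> - grp (perm_shift \<tau> \<sigma>))"
    unfolding e perm_skew_add perm_skew_uminus perm_skew_monomial f fn_uminus perm_shift_tau_tau
    by (simp add: add.commute)
  have "(\<lambda>x. 1 / (2 * z1 a b x)) = (\<lambda>x. (1 / 2) / z1 a b x)" by simp
  then have "simple_polar W (\<lambda>x. 1 / (2 * z1 a b x))"
    using simple_polarI[OF holo_on_const agree_on_refl[OF open_W]] by metis
  from polar_monomial[OF simple_polar_mero_of[OF m this]]
  show "polar (fn ?f * (grp \<sigma> - grp (perm_shift \<tau> \<sigma>)))"
    unfolding e by (intro polar_add polar_uminus)
qed

section \<open>Local distributions\<close>

lemma dcomp_ev:
  assumes "A \<in> universal_ring a b v W"
  shows "dcomp v W (ev v W) A F = (if F \<in> inv_holo v W then act W A F v else 0)"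
  using act_agree(1)[OF universal_ring_acts[OF assms]] by (simp add: dcomp_def ev_def)

lemma dcomp_dcomp_ev:
  assumes "A \<in> universal_ring a b v W" "B \<in> universal_ring a b v W"
  shows "dcomp v W (dcomp v W (ev v W) A) B = dcomp v W (ev v W) (A * B)"
proof
  fix F
  note acts = universal_ring_acts[OF assms(1)] universal_ring_acts[OF assms(2)]
  show "dcomp v W (dcomp v W (ev v W) A) B F = dcomp v W (ev v W) (A * B) F"
    unfolding dcomp_ev[OF universal_ring.times[OF assms]]
    using act_agree(1)[OF acts(2)] act_mult[OF acts]
    by (simp add: dcomp_def[of v W "dcomp v W (ev v W) A"] dcomp_ev[OF assms(1)])
qed

lemma dcomp_ev_add:
  assumes "A \<in> universal_ring a b v W" "B \<in> universal_ring a b v W"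
  shows "dcomp v W (ev v W) (A + B) = dcomp v W (ev v W) A + dcomp v W (ev v W) B"
  using act_add[OF universal_ring_acts[OF assms(1)] universal_ring_acts[OF assms(2)]]
  by (simp add: fun_eq_iff dcomp_ev assms universal_ring.add)

lemma dcomp_ev_diff:
  assumes "A \<in> universal_ring a b v W" "B \<in> universal_ring a b v W"
  shows "dcomp v W (ev v W) (A - B) = dcomp v W (ev v W) A - dcomp v W (ev v W) B"
  using dcomp_ev_add[OF universal_ring_diff[OF assms] assms(2)] by (simp add: fun_eq_iff)

lemma dcomp_ev_scale:
  assumes "A \<in> universal_ring a b v W"
  shows "dcomp v W (ev v W) (A * fn (mero_of (\<lambda>x. c))) = fscale c (dcomp v W (ev v W) A)"
proof
  fix F
  note A = universal_ring_acts[OF assms] and c = universal_ring_acts[OF const_in_universal_ring[of c]]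
  have "act W (A * fn (mero_of (\<lambda>x. c))) F v = c * act W A F v" if F: "F \<in> inv_holo v W"
  proof -
    have "act W (fn (mero_of (\<lambda>x. c))) F = (\<lambda>x. c * F x)"
      by (rule act_function[OF _ _ meromorphic_const F]) (simp_all add: holo_on_const)
    then show ?thesis using act_mult[OF A c F] act_linear[OF A F F, of c 0] by simp
  qed
  then show "dcomp v W (ev v W) (A * fn (mero_of (\<lambda>x. c))) F = fscale c (dcomp v W (ev v W) A) F"
    by (simp add: dcomp_ev assms universal_ring.times const_in_universal_ring fscale_def)
qed

text \<open>Since \<open>\<tau>\<close> conjugates the shifts and \<open>F\<close> is invariant, passing from \<open>\<sigma>\<close> to \<open>\<tau>(\<sigma>)\<close> composes \<open>\<phi>\<^sub>\<sigma>\<close> with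
  \<open>\<tau>\<close>. This keeps its value at \<open>v\<close> and changes the sign of its \<open>z\<^sub>1\<close>-derivative.\<close>

lemma invariant_shift_tau:
  assumes "F \<in> inv_holo v W"
  shows "F (shift_tab (- perm_shift \<tau> \<sigma>) x) = F (shift_tab (- \<sigma>) (perm_tab \<tau> x))"
  using assms unfolding inv_holo_iff
  by (simp add: shift_tab_perm_shift inv_tau flip: perm_shift_hom)

lemma D1_apply:
  assumes "F \<in> inv_holo v W" shows "D1 a b v W \<sigma> F = F (shift_tab (- \<sigma>) v)"
proof -
  note A = universal_ring_acts[OF orbit_sum_in_universal_ring[of \<sigma>]]
  let ?G = "\<lambda>x. F (shift_tab (- \<sigma>) x) + F (shift_tab (- perm_shift \<tau> \<sigma>) x)"
  have F: "F holo_on W" "\<And>x. x \<notin> W \<Longrightarrow> F x = 0" using assms by (auto simp: inv_holo_iff)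
  have op: "skew_op (grp \<rho>) F = (\<lambda>x. F (shift_tab (- \<rho>) x))" for \<rho>
    using skew_op_monomial[of 1 \<rho> F] by (simp add: fun_eq_iff grp_as_monomial mero_value_one)
  have "act W (grp \<sigma> + grp (perm_shift \<tau> \<sigma>)) F = ?G"
  proof (rule act_eqI)
    have "?G x = 0" if "x \<notin> W" for x
    proof -
      have "shift_tab \<rho> x \<notin> W" for \<rho>
        using that shift_in_W[of "shift_tab \<rho> x" "- \<rho>"]
        by (auto simp: shift_tab_add[symmetric] shift_tab_zero)
      then show ?thesis using F(2) by simp
    qed
    moreover have "?G (perm_tab \<tau> x) = ?G x" for x
      by (simp add: invariant_shift_tau[OF assms] tau_tau)
    moreover have "?G holo_on W" by (rule holo_on_add[OF holo_shift_W[OF F(1)] holo_shift_W[OF F(1)]])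
    ultimately show "?G \<in> inv_holo v W" unfolding inv_holo_iff by blast
    show "agree_on W (skew_op (grp \<sigma> + grp (perm_shift \<tau> \<sigma>)) F) ?G"
      using agree_on_UNIV[OF skew_op_add open_W, of "grp \<sigma>" "grp (perm_shift \<tau> \<sigma>)" F] by (simp add: op)
  qed
  then show ?thesis
    unfolding D1_def fscale_def dcomp_ev[OF orbit_sum_in_universal_ring]
    using invariant_shift_tau[OF assms] assms by (simp add: stabilizer_tau)
qed

lemma D1_apply_outside: "F \<notin> inv_holo v W \<Longrightarrow> D1 a b v W \<sigma> F = 0"
  by (simp add: D1_def fscale_def dcomp_def)

lemma partial_z1_shift_tau:
  assumes "F \<in> inv_holo v W"
  shows "partial_z1 (\<lambda>x. F (shift_tab (- perm_shift \<tau> \<sigma>) x)) = - partial_z1 (\<lambda>x. F (shift_tab (- \<sigma>) x))"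
  unfolding invariant_shift_tau[OF assms]
  using assms by (intro partial_z1_tau holo_shift_W) (simp add: inv_holo_iff)

text \<open>An instance of the evaluation formula: the two coefficients times \<open>z\<^sub>1\<close> are the constants
  \<open>\<plusminus>1/2\<close>, so only derivatives of \<open>F\<close> remain, and the two of them coincide up to the sign. If
  \<open>\<tau>(\<sigma>) = \<sigma>\<close>, the derivative equals its own negative, in accordance with the convention
  \<open>D\<^sup>2\<^sub>\<sigma> = 0\<close>.\<close>

lemma D2_apply:
  assumes "F \<in> inv_holo v W"
  shows "D2 a b v W \<sigma> F = partial_z1 (\<lambda>x. F (shift_tab (- \<sigma>) x))"
proof (cases "perm_shift \<tau> \<sigma> = \<sigma>")
  case True
  then show ?thesis using partial_z1_shift_tau[OF assms, of \<sigma>] by (simp add: D2_def)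
next
  case False
  let ?f = "mero_of (\<lambda>x. 1 / (2 * z1 a b x))" and ?\<sigma>' = "perm_shift \<tau> \<sigma>"
  let ?A = "fn ?f * (grp \<sigma> - grp ?\<sigma>')"
  have c: "coeff ?A \<rho> = (if \<rho> = \<sigma> then ?f else if \<rho> = ?\<sigma>' then - ?f else 0)" for \<rho>
    using False coeff_add[of "fn ?f * grp \<sigma>" "- (fn ?f * grp ?\<sigma>')" \<rho>]
    by (simp add: right_diff_distrib coeff_uminus coeff_fn_grp)
  then have s: "supp ?A \<subseteq> {\<sigma>, ?\<sigma>'}" by (auto simp: supp_iff split: if_splits)
  have zf: "mero_of (z1 a b) * ?f = mero_of (\<lambda>x. z1 a b x * (1 / (2 * z1 a b x)))"
    by (rule mero_of_ops[OF meromorphic_z1 meromorphic_half_inverse_z1])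
  have half: "mero_value (mero_of (z1 a b) * ?f) x = 1 / 2" for x
  proof (rule mero_value_eq[OF open_UNIV holo_on_const _ UNIV_I])
    have "agree_on UNIV (\<lambda>x. z1 a b x * (1 / (2 * z1 a b x))) (\<lambda>x. 1 / 2)"
      by (rule agree_off_z1[OF ab(1) open_UNIV]) simp
    then show "agree_on UNIV (mero_value (mero_of (z1 a b) * ?f)) (\<lambda>x. 1 / 2)"
      unfolding zf
      by (rule agree_on_trans[OF mero_value_mero_of[OF meromorphic_mult[OF meromorphic_z1 meromorphic_half_inverse_z1]]])
  qed
  have mhalf: "mero_value (- (mero_of (z1 a b) * ?f)) x = - (1 / 2)" for x
  proof (rule mero_value_eq[OF open_UNIV holo_on_const _ UNIV_I])
    show "agree_on UNIV (mero_value (- (mero_of (z1 a b) * ?f))) (\<lambda>x. - (1 / 2))"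
      using mero_value_uminus[of "mero_of (z1 a b) * ?f"] by (simp add: half)
  qed
  have d: "deriv_z1 a b (mero_of (z1 a b) * ?f) v = 0" "deriv_z1 a b (- (mero_of (z1 a b) * ?f)) v = 0"
    unfolding deriv_z1_partial partial_z1_def half mhalf by simp_all
  have "act W ?A F v = partial_z1 (\<lambda>x. F (shift_tab (- \<sigma>) x))"
    using act_at_v[OF orbit_difference_in_universal_ring assms _ s] False
    by (simp add: c half mhalf d partial_z1_shift_tau[OF assms])
  then show ?thesis
    unfolding D2_def using False assms by (simp add: dcomp_ev[OF orbit_difference_in_universal_ring])
qed

lemma D2_apply_outside: "F \<notin> inv_holo v W \<Longrightarrow> D2 a b v W \<sigma> F = 0"
  by (simp add: D2_def dcomp_def)

lemma sum_functional_apply: "(\<Sum>i\<in>I. f i) x = (\<Sum>i\<in>I. f i x :: complex)"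
  by (induction I rule: infinite_finite_induct) simp_all

lemma ev_formula:
  assumes "A \<in> universal_ring a b v W" "finite I" "supp A \<subseteq> I"
  shows "dcomp v W (ev v W) A =
    (\<Sum>\<sigma>\<in>I. fscale (mero_value (mero_of (z1 a b) * coeff A \<sigma>) v) (D2 a b v W \<sigma>)) +
    (\<Sum>\<sigma>\<in>I. fscale (deriv_z1 a b (mero_of (z1 a b) * coeff A \<sigma>) v) (D1 a b v W \<sigma>))"
proof
  fix F
  show "dcomp v W (ev v W) A F =
    ((\<Sum>\<sigma>\<in>I. fscale (mero_value (mero_of (z1 a b) * coeff A \<sigma>) v) (D2 a b v W \<sigma>)) +
    (\<Sum>\<sigma>\<in>I. fscale (deriv_z1 a b (mero_of (z1 a b) * coeff A \<sigma>) v) (D1 a b v W \<sigma>))) F"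
    using act_at_v[OF assms(1) _ assms(2,3), of F]
    by (cases "F \<in> inv_holo v W")
      (simp_all add: dcomp_ev[OF assms(1)] sum_functional_apply fscale_def sum.distrib
        D1_apply D2_apply D1_apply_outside D2_apply_outside)
qed

lemma D1_tau: "D1 a b v W (perm_shift \<tau> \<sigma>) = D1 a b v W \<sigma>"
proof
  fix F show "D1 a b v W (perm_shift \<tau> \<sigma>) F = D1 a b v W \<sigma> F"
    by (cases "F \<in> inv_holo v W")
      (simp_all add: D1_apply D1_apply_outside invariant_shift_tau stabilizer_tau)
qed

lemma D2_tau: "D2 a b v W (perm_shift \<tau> \<sigma>) = fscale (- 1) (D2 a b v W \<sigma>)"
proof
  fix F show "D2 a b v W (perm_shift \<tau> \<sigma>) F = fscale (- 1) (D2 a b v W \<sigma>) F"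
    by (cases "F \<in> inv_holo v W")
      (simp_all add: D2_apply D2_apply_outside partial_z1_shift_tau fscale_def)
qed

text \<open>\<^const>\<open>Delta\<close> contains a representative of each \<open>\<tau>\<close>-orbit of shifts, and the distributions of
  \<open>\<sigma>\<close> and \<open>\<tau>(\<sigma>)\<close> agree up to sign. So the span contains the distributions of all shifts.\<close>

lemma Delta_cases: "\<sigma> \<in> Delta a b \<or> perm_shift \<tau> \<sigma> \<in> Delta a b"
  by (auto simp: Delta_def shift_at_perm Rep_tau)

abbreviation S where "S \<equiv> distribution_space a b v W"

lemma D1_in_S: "D1 a b v W \<sigma> \<in> S"
proof -
  have "D1 a b v W \<rho> \<in> S" if "\<rho> \<in> Delta a b" for \<rho>
    unfolding distribution_space_def
    by (rule functional.span_base) (use that in \<open>simp add: distributions_def\<close>)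
  then show ?thesis using Delta_cases[of \<sigma>] D1_tau by metis
qed

lemma D2_in_S: "D2 a b v W \<sigma> \<in> S"
proof -
  have base: "D2 a b v W \<rho> \<in> S" if "\<rho> \<in> Delta a b" for \<rho>
  proof (cases "perm_shift \<tau> \<rho> = \<rho>")
    case True
    then show ?thesis
      unfolding distribution_space_def D2_def by (simp add: functional.span_zero)
  next
    case False
    then show ?thesis
      unfolding distribution_space_def
      by (intro functional.span_base) (use that in \<open>auto simp: distributions_def\<close>)
  qed
  from Delta_cases[of \<sigma>] show ?thesis
  proof
    assume "perm_shift \<tau> \<sigma> \<in> Delta a b"
    from functional.span_scale[OF base[OF this, unfolded distribution_space_def], of "- 1"]
    show ?thesis unfolding D2_tau distribution_space_def by (simp add: fscale_def)
  qed (rule base)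
qed

lemma dcomp_ev_in_S:
  assumes "A \<in> universal_ring a b v W" shows "dcomp v W (ev v W) A \<in> S"
  unfolding ev_formula[OF assms finite_supp order_refl] distribution_space_def
  by (intro functional.span_add functional.span_sum functional.span_scale
      D1_in_S[unfolded distribution_space_def] D2_in_S[unfolded distribution_space_def])

text \<open>The functionals \<open>ev\<^sub>v \<circ> A\<close> form a subspace, scalars being realized by right multiplication with
  constants, and they contain the spanning set by definition of \<^const>\<open>D1\<close> and \<^const>\<open>D2\<close>.\<close>

lemma distribution_space_ev:
  assumes "D \<in> S" shows "\<exists>A\<in>universal_ring a b v W. D = dcomp v W (ev v W) A"
proof -
  let ?R = "universal_ring a b v W"
  define M where "M = dcomp v W (ev v W) ` ?R"
  have scale: "fscale c D \<in> M" if "D \<in> M" for c D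
    using that unfolding M_def
    by (auto simp flip: dcomp_ev_scale intro!: imageI universal_ring.times const_in_universal_ring)
  have "functional.subspace M"
  proof (rule functional.subspaceI)
    show "0 \<in> M"
    proof -
      have "dcomp v W (ev v W) 1 \<in> M" unfolding M_def using universal_ring.one by (rule imageI)
      from scale[OF this, of 0] show ?thesis by (simp add: fscale_def zero_fun_def)
    qed
    show "x + y \<in> M" if "x \<in> M" "y \<in> M" for x y
      using that unfolding M_def by (auto simp flip: dcomp_ev_add intro!: imageI universal_ring.add)
  qed (rule scale)
  moreover have "distributions a b v W \<subseteq> M"
    unfolding distributions_def
  proof (intro Un_least image_subsetI)
    fix \<sigma> show "D1 a b v W \<sigma> \<in> M"
      unfolding D1_def by (rule scale) (simp add: M_def orbit_sum_in_universal_ring)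
  next
    fix \<sigma> assume "\<sigma> \<in> {\<sigma> \<in> Delta a b. perm_shift \<tau> \<sigma> \<noteq> \<sigma>}"
    then show "D2 a b v W \<sigma> \<in> M"
      unfolding D2_def M_def by (simp add: orbit_difference_in_universal_ring)
  qed
  ultimately have "S \<subseteq> M" unfolding distribution_space_def by (rule functional.span_minimal[rotated])
  then show ?thesis using assms unfolding M_def by blast
qed

section \<open>Gelfand-Tsetlin operators in the universal ring\<close>

abbreviation (input) swap :: "'n tab_index \<Rightarrow> 'n tab_index" where "swap \<equiv> Transposition.transpose a b"

lemma row_swap: "row (swap c) = row c"
  using ab(2) by (auto simp: Transposition.transpose_def)

lemma bij_swap_row: "bij_betw swap {c. row c = k} {c. row c = k}"
  by (rule bij_betw_byWitness[where f' = swap]) (auto simp: row_swap)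

lemma bij_swap_row_minus: "bij_betw swap ({d. row d = k} - {c}) ({d. row d = k} - {swap c})"
proof (rule bij_betw_byWitness[where f' = swap])
  have "swap x = swap y \<longleftrightarrow> x = y" for x y by (metis transpose_involutory)
  then show "swap ` ({d. row d = k} - {c}) \<subseteq> {d. row d = k} - {swap c}" by (auto simp: row_swap)
qed (auto simp: row_swap)

text \<open>Among the factors of the denominator, the set \<open>P\<close> of those with zeros on \<open>W\<close> is empty or consists of
  the single factor \<open>z\<^sub>1\<close> or \<open>-z\<^sub>1\<close>, according to the position of \<open>c\<close>.\<close>

lemma ladder_coeff_simple_polar:
  assumes "N holo_on UNIV" "row c = k"
  shows "simple_polar W (\<lambda>x. N x / (\<Prod>d\<in>{d. row d = k} - {c}. x $ c - x $ d))"
proof -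
  let ?R = "{d. row d = k} - {c}"
  define P where "P = {d \<in> ?R. {c, d} = {a, b}}"
  define Q where "Q = ?R - P"
  have NW: "N holo_on W" by (rule holo_on_subset[OF assms(1)]) simp
  have Qh: "(\<lambda>x. \<Prod>d\<in>Q. x $ c - x $ d) holo_on W"
    by (intro holo_on_prod holo_on_diff holo_on_component)
  have Q0: "(\<Prod>d\<in>Q. x $ c - x $ d) \<noteq> 0" if "x \<in> W" for x
  proof -
    have "x $ c - x $ d \<noteq> 0" if "d \<in> Q" for d
      by (rule W_nonzero) (use that assms(2) \<open>x \<in> W\<close> in \<open>auto simp: Q_def P_def\<close>)
    then show ?thesis by (simp add: prod_zero_iff)
  qed
  have PQ: "(\<Prod>d\<in>?R. x $ c - x $ d) = (\<Prod>d\<in>Q. x $ c - x $ d) * (\<Prod>d\<in>P. x $ c - x $ d)" for x :: "'n tab"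
    unfolding Q_def by (rule prod.subset_diff) (auto simp: P_def)
  have NQ: "(\<lambda>x. N x / (\<Prod>d\<in>Q. x $ c - x $ d)) holo_on W" by (rule holo_on_divide[OF NW Qh Q0])
  consider "P = {}" | "c = a" "P = {b}" | "c = b" "P = {a}"
  proof -
    have "P \<subseteq> (if c = a then {b} else if c = b then {a} else {})"
      by (auto simp: P_def doubleton_eq_iff)
    then show thesis using that by (auto split: if_splits)
  qed
  then show ?thesis
  proof cases
    case 1
    show ?thesis unfolding PQ 1 using simple_polar_holo[OF NQ open_W] by simp
  next
    case 2
    show ?thesis
      unfolding PQ 2(2) by (rule simple_polarI[OF NQ]) (simp add: z1_def 2(1) agree_on_refl[OF open_W])
  next
    case 3
    have e: "n / (q * (t - s)) = - (n / q) / (s - t)" for n q s t :: complex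
      using minus_divide_right[of n "q * (s - t)"] by (simp add: algebra_simps)
    have "(\<lambda>x. N x / ((\<Prod>d\<in>Q. x $ c - x $ d) * (\<Prod>d\<in>P. x $ c - x $ d))) =
        (\<lambda>x. - (N x / (\<Prod>d\<in>Q. x $ c - x $ d)) / z1 a b x)"
    proof
      fix x :: "'n tab"
      have P: "(\<Prod>d\<in>P. x $ c - x $ d) = x $ b - x $ a" by (simp add: 3)
      show "N x / ((\<Prod>d\<in>Q. x $ c - x $ d) * (\<Prod>d\<in>P. x $ c - x $ d)) =
          - (N x / (\<Prod>d\<in>Q. x $ c - x $ d)) / z1 a b x"
        unfolding P z1_def by (rule e)
    qed
    then show ?thesis
      unfolding PQ by (intro simple_polarI[OF holo_on_uminus[OF NQ]]) (simp add: agree_on_refl[OF open_W])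
  qed
qed

lemma meromorphic_ladder_coeff:
  fixes c :: "'n tab_index"
  assumes "N holo_on UNIV"
  shows "meromorphic (\<lambda>x. N x / (\<Prod>d\<in>{d. row d = k} - {c}. x $ c - x $ d))"
proof (rule meromorphic_quotient[OF assms])
  show "(\<lambda>x. \<Prod>d\<in>{d. row d = k} - {c}. x $ c - x $ d) holo_on UNIV"
    by (intro holo_on_prod holo_on_diff holo_on_component)
  show "closure {x :: 'n tab. (\<Prod>d\<in>{d. row d = k} - {c}. x $ c - x $ d) \<noteq> 0} = UNIV"
  proof (rule dense_prod_nonzero)
    show "finite ({d. row d = k} - {c})" by simp
    show "(\<lambda>x. x $ c - x $ d) holo_on UNIV" for d :: "'n tab_index"
      by (rule holo_on_diff[OF holo_on_component holo_on_component])
    show "closure {x :: 'n tab. x $ c - x $ d \<noteq> 0} = UNIV" if "d \<in> {d. row d = k} - {c}" for d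
      using that by (intro dense_coordinates_distinct) auto
  qed
qed

text \<open>The common shape of the images of raising and lowering operators. They are invariant because \<open>\<tau>\<close>
  permutes the summands: the numerators and shifts are equivariant, and so are the denominators, being
  products over a whole row with the index \<open>c\<close> left out.\<close>

lemma ladder_in_universal_ring:
  fixes N :: "'n tab_index \<Rightarrow> 'n tab \<Rightarrow> complex" and \<epsilon> :: "'n tab_index \<Rightarrow> 'n gimel"
  assumes N: "\<And>c. N c holo_on UNIV" "\<And>c x. N c (perm_tab \<tau> x) = N (swap c) x"
    and \<epsilon>: "\<And>c. row c = k \<Longrightarrow> perm_shift \<tau> (\<epsilon> c) = \<epsilon> (swap c)"
  shows "(\<Sum>c\<in>{c. row c = k}.
    fn (mero_of (\<lambda>x. N c x / (\<Prod>d\<in>{d. row d = k} - {c}. x $ c - x $ d))) * grp (\<epsilon> c))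
    \<in> universal_ring a b v W"
proof (rule generator_in_universal_ring)
  let ?f = "\<lambda>c x. N c x / (\<Prod>d\<in>{d. row d = k} - {c}. x $ c - x $ d)"
  note m = meromorphic_ladder_coeff[OF N(1)]
  have f: "?f c (perm_tab \<tau> x) = ?f (swap c) x" for c x
  proof -
    have "(\<Prod>d\<in>{d. row d = k} - {c}. x $ swap c - x $ swap d) =
        (\<Prod>d\<in>{d. row d = k} - {swap c}. x $ swap c - x $ d)"
      by (rule prod.reindex_bij_betw[OF bij_swap_row_minus])
    then show ?thesis by (simp add: N(2) perm_tab_tau)
  qed
  have "perm_mero \<tau> (mero_of (?f c)) = mero_of (?f (swap c))" for c
    unfolding perm_mero_mero_of[OF m] inv_tau comp_def f ..
  then have "perm_skew \<tau> (\<Sum>c\<in>{c. row c = k}. fn (mero_of (?f c)) * grp (\<epsilon> c)) =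
      (\<Sum>c\<in>{c. row c = k}. fn (mero_of (?f (swap c))) * grp (\<epsilon> (swap c)))"
    unfolding perm_skew_sum perm_skew_monomial by (intro sum.cong refl) (simp add: \<epsilon>)
  also have "\<dots> = (\<Sum>c\<in>{c. row c = k}. fn (mero_of (?f c)) * grp (\<epsilon> c))"
    by (rule sum.reindex_bij_betw[OF bij_swap_row])
  finally show "perm_skew \<tau> (\<Sum>c\<in>{c. row c = k}. fn (mero_of (?f c)) * grp (\<epsilon> c)) =
      (\<Sum>c\<in>{c. row c = k}. fn (mero_of (?f c)) * grp (\<epsilon> c))" .
  show "polar (\<Sum>c\<in>{c. row c = k}. fn (mero_of (?f c)) * grp (\<epsilon> c))"
    by (intro polar_sum polar_monomial simple_polar_mero_of[OF m] ladder_coeff_simple_polar N(1)) simp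
qed

lemma row_product_tau:
  "(\<Prod>d\<in>{d. row d = l}. perm_tab \<tau> x $ c - perm_tab \<tau> x $ d) = (\<Prod>d\<in>{d. row d = l}. x $ swap c - x $ d)"
  unfolding perm_tab_tau by (rule prod.reindex_bij_betw[OF bij_swap_row])

lemma perm_shift_sigma:
  assumes "row c < CARD('n)"
  shows "perm_shift \<tau> (sigma (row c) (col c)) = sigma (row (swap c)) (col (swap c))"
proof (rule gimel_eqI)
  fix d
  have "swap d = c \<longleftrightarrow> d = swap c" by auto
  then show "shift_at (perm_shift \<tau> (sigma (row c) (col c))) d = shift_at (sigma (row (swap c)) (col (swap c))) d"
    using assms shift_at_sigma[of "swap c" d] shift_at_sigma[of c "swap d"]
    by (simp add: shift_at_perm Rep_tau row_swap)
qed

lemma row_product_holo: "(\<lambda>x. \<Prod>d\<in>{d. row d = l}. x $ c - x $ d) holo_on U"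
  by (intro holo_on_prod holo_on_diff holo_on_component)

lemma raising_in_universal_ring:
  assumes "k < CARD('n)"
  shows "(\<Sum>i\<in>{1..k}. fn (raising_coeff k i) * grp (- sigma k i)) \<in> universal_ring a b v W"
proof -
  let ?N = "\<lambda>c x. \<Prod>d\<in>{d. row d = k + 1}. x $ c - x $ (d :: 'n tab_index)"
  have "fn (raising_coeff k i) * grp (- sigma k i) =
      (let c = idx k i in fn (mero_of (\<lambda>x. ?N c x / (\<Prod>d\<in>{d. row d = k} - {c}. x $ c - x $ d)))
        * grp (- sigma (row c) (col c) :: 'n gimel))" if i: "i \<in> {1..k}" for i
  proof -
    have k: "k \<le> CARD('n)" "k + 1 \<le> CARD('n)" using assms by simp_all
    have "raising_coeff k i = (mero_of (\<lambda>x. ?N (idx k i) x /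
        (\<Prod>d\<in>{d. row d = k} - {idx k i}. x $ idx k i - x $ d)) :: 'n tab_index mero)"
      unfolding raising_coeff_def
    proof (intro arg_cong[of _ _ mero_of] ext)
      fix x :: "'n tab"
      show "(\<Prod>j\<in>{1..k + 1}. x $ idx k i - x $ idx (k + 1) j) / (\<Prod>j\<in>{1..k} - {i}. x $ idx k i - x $ idx k j) =
          ?N (idx k i) x / (\<Prod>d\<in>{d. row d = k} - {idx k i}. x $ idx k i - x $ d)"
        unfolding prod_idx_row[OF k(2), of "\<lambda>d. x $ idx k i - x $ d"]
          prod_idx_row_minus[OF k(1) i, of "\<lambda>d. x $ idx k i - x $ d"] ..
    qed
    then show ?thesis using i assms by (simp add: Let_def row_idx col_idx)
  qed
  then have "(\<Sum>i\<in>{1..k}. fn (raising_coeff k i) * grp (- sigma k i)) =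
      (\<Sum>c\<in>{c. row c = k}. fn (mero_of (\<lambda>x. ?N c x / (\<Prod>d\<in>{d. row d = k} - {c}. x $ c - x $ d)))
        * grp (- sigma (row c) (col c) :: 'n gimel))"
    using sum_idx_row[of k "\<lambda>c. fn (mero_of (\<lambda>x. ?N c x / (\<Prod>d\<in>{d. row d = k} - {c}. x $ c - x $ d)))
        * grp (- sigma (row c) (col c) :: 'n gimel)"] assms
    by (simp add: Let_def)
  also have "\<dots> \<in> universal_ring a b v W"
    by (rule ladder_in_universal_ring, rule row_product_holo, rule row_product_tau)
      (use assms in \<open>simp add: perm_shift_hom flip: perm_shift_sigma\<close>)
  finally show ?thesis .
qed

lemma lowering_in_universal_ring:
  assumes "k < CARD('n)"
  shows "(\<Sum>i\<in>{1..k}. fn (lowering_coeff k i) * grp (sigma k i)) \<in> universal_ring a b v W"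
proof -
  let ?N = "\<lambda>c x. \<Prod>d\<in>{d. row d = k - 1}. x $ c - x $ (d :: 'n tab_index)"
  have "fn (lowering_coeff k i) * grp (sigma k i) =
      (let c = idx k i in fn (mero_of (\<lambda>x. ?N c x / (\<Prod>d\<in>{d. row d = k} - {c}. x $ c - x $ d)))
        * grp (sigma (row c) (col c) :: 'n gimel))" if i: "i \<in> {1..k}" for i
  proof -
    have k: "k \<le> CARD('n)" "k - 1 \<le> CARD('n)" using assms by simp_all
    have "lowering_coeff k i = (mero_of (\<lambda>x. ?N (idx k i) x /
        (\<Prod>d\<in>{d. row d = k} - {idx k i}. x $ idx k i - x $ d)) :: 'n tab_index mero)"
      unfolding lowering_coeff_def
    proof (intro arg_cong[of _ _ mero_of] ext)
      fix x :: "'n tab"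
      show "(\<Prod>j\<in>{1..k - 1}. x $ idx k i - x $ idx (k - 1) j) / (\<Prod>j\<in>{1..k} - {i}. x $ idx k i - x $ idx k j) =
          ?N (idx k i) x / (\<Prod>d\<in>{d. row d = k} - {idx k i}. x $ idx k i - x $ d)"
        unfolding prod_idx_row[OF k(2), of "\<lambda>d. x $ idx k i - x $ d"]
          prod_idx_row_minus[OF k(1) i, of "\<lambda>d. x $ idx k i - x $ d"] ..
    qed
    then show ?thesis using i assms by (simp add: Let_def row_idx col_idx)
  qed
  then have "(\<Sum>i\<in>{1..k}. fn (lowering_coeff k i) * grp (sigma k i)) =
      (\<Sum>c\<in>{c. row c = k}. fn (mero_of (\<lambda>x. ?N c x / (\<Prod>d\<in>{d. row d = k} - {c}. x $ c - x $ d)))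
        * grp (sigma (row c) (col c) :: 'n gimel))"
    using sum_idx_row[of k "\<lambda>c. fn (mero_of (\<lambda>x. ?N c x / (\<Prod>d\<in>{d. row d = k} - {c}. x $ c - x $ d)))
        * grp (sigma (row c) (col c) :: 'n gimel)"] assms
    by (simp add: Let_def)
  also have "\<dots> \<in> universal_ring a b v W"
    by (rule ladder_in_universal_ring, rule row_product_holo, rule row_product_tau)
      (use assms in \<open>simp flip: perm_shift_sigma\<close>)
  finally show ?thesis .
qed

lemma diagonal_in_universal_ring:
  assumes "k \<le> CARD('n)" shows "fn (diagonal_coeff k) \<in> universal_ring a b v W"
proof -
  have r: "(\<Sum>i\<in>{1..l}. x $ idx l i + of_nat i - 1) =
      (\<Sum>d\<in>{d. row d = l}. x $ d) + (\<Sum>i\<in>{1..l}. of_nat i - 1)" if "l \<le> CARD('n)" for l and x :: "'n tab"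
    unfolding add_diff_eq[symmetric] sum.distrib using sum_idx_row[OF that, of "\<lambda>c. x $ c"] by simp
  have s: "(\<Sum>d\<in>{d. row d = l}. perm_tab \<tau> x $ d) = (\<Sum>d\<in>{d. row d = l}. x $ d)" for l and x :: "'n tab"
    unfolding perm_tab_tau by (rule sum.reindex_bij_betw[OF bij_swap_row])
  have k: "k - 1 \<le> CARD('n)" using assms by simp
  show ?thesis
    unfolding diagonal_coeff_def r[OF assms] r[OF k]
    by (rule function_in_universal_ring)
      (intro holo_on_diff holo_on_add holo_on_sum holo_on_component holo_on_const, simp add: s)
qed

text \<open>The images of \<open>E\<^sub>k\<^sub>,\<^sub>k\<^sub>+\<^sub>1\<close>, \<open>E\<^sub>k\<^sub>+\<^sub>1\<^sub>,\<^sub>k\<close> and \<open>E\<^sub>k\<^sub>,\<^sub>k\<close> are generators; the matrix units at distance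
  \<open>d + 1\<close> from the diagonal are commutators of those at distance \<open>d\<close> and \<open>1\<close>.\<close>

lemma gelfand_tsetlin_in_universal_ring:
  assumes \<Phi>: "gelfand_tsetlin_hom (\<Phi> :: 'n uea \<Rightarrow> 'n skew_ring)"
  shows "\<Phi> (uea_of X) \<in> universal_ring a b v W"
proof -
  let ?R = "universal_ring a b v W"
  have add: "\<Phi> (x + y) = \<Phi> x + \<Phi> y" and mult: "\<Phi> (x * y) = \<Phi> y * \<Phi> x"
    and scalar: "\<Phi> (uea_scalar c) = fn (mero_of (\<lambda>x. c))" for x y c
    using \<Phi> by (auto simp: gelfand_tsetlin_hom_def star_def)
  have zero: "\<Phi> 0 = 0" using add[of 0 0] by simp
  have diff: "\<Phi> (x - y) = \<Phi> x - \<Phi> y" for x y using add[of "x - y" y] by simp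
  have sum: "\<Phi> (\<Sum>i\<in>I. f i) = (\<Sum>i\<in>I. \<Phi> (f i))" for I and f :: "'i \<Rightarrow> 'n uea"
    by (induction I rule: infinite_finite_induct) (simp_all add: zero add)
  have bracket: "\<Phi> (x * y - y * x) \<in> ?R" if "\<Phi> x \<in> ?R" "\<Phi> y \<in> ?R" for x y
    unfolding diff mult by (intro universal_ring_diff universal_ring.times that)
  have up: "\<Phi> (uea_E k (k + 1)) \<in> ?R" and down: "\<Phi> (uea_E (k + 1) k) \<in> ?R"
    if "1 \<le> k" "k < CARD('n)" for k
    using \<Phi> that raising_in_universal_ring[OF that(2)] lowering_in_universal_ring[OF that(2)]
    by (auto simp: gelfand_tsetlin_hom_def intro: universal_ring.uminus)
  have E: "uea_E s t * uea_E t w - uea_E t w * uea_E s t = (uea_E s w :: 'n uea)"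
    if "s \<in> {1..CARD('n)}" "w \<in> {1..CARD('n)}" "s \<noteq> w" for s t w
    unfolding uea_E_def uea_commutator using that by (simp add: Abs_mat_index_inject)
  have "s + d \<le> CARD('n) \<longrightarrow> \<Phi> (uea_E s (s + d)) \<in> ?R \<and> \<Phi> (uea_E (s + d) s) \<in> ?R" if "1 \<le> s" for s d
  proof (induction d)
    case 0
    then show ?case
      using \<Phi> that diagonal_in_universal_ring[of s] by (auto simp: gelfand_tsetlin_hom_def)
  next
    case (Suc d)
    show ?case
    proof
      assume l: "s + Suc d \<le> CARD('n)"
      have near: "\<Phi> (uea_E s (s + d)) \<in> ?R" "\<Phi> (uea_E (s + d) s) \<in> ?R"
        using Suc.IH l by simp_all
      have step: "\<Phi> (uea_E (s + d) (s + d + 1)) \<in> ?R" "\<Phi> (uea_E (s + d + 1) (s + d)) \<in> ?R"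
        using up[of "s + d"] down[of "s + d"] that l by simp_all
      have e: "uea_E s (s + d) * uea_E (s + d) (s + d + 1) - uea_E (s + d) (s + d + 1) * uea_E s (s + d)
          = (uea_E s (s + d + 1) :: 'n uea)"
        "uea_E (s + d + 1) (s + d) * uea_E (s + d) s - uea_E (s + d) s * uea_E (s + d + 1) (s + d)
          = (uea_E (s + d + 1) s :: 'n uea)"
        by (rule E; use that l in simp)+
      show "\<Phi> (uea_E s (s + Suc d)) \<in> ?R \<and> \<Phi> (uea_E (s + Suc d) s) \<in> ?R"
        using bracket[OF near(1) step(1)] bracket[OF step(2) near(2)] unfolding e by simp
    qed
  qed
  then have up': "\<Phi> (uea_E s (s + d)) \<in> ?R" "\<Phi> (uea_E (s + d) s) \<in> ?R"
    if "1 \<le> s" "s + d \<le> CARD('n)" for s d using that by simp_all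
  have all: "\<Phi> (uea_E s t) \<in> ?R" if "s \<in> {1..CARD('n)}" "t \<in> {1..CARD('n)}" for s t
    using that up'(1)[of s "t - s"] up'(2)[of t "s - t"] by (cases "s \<le> t") simp_all
  have "\<Phi> (uea_gen s t) \<in> ?R" for s t
    using all[of "Rep_mat_index s" "Rep_mat_index t"] Rep_mat_index[of s] Rep_mat_index[of t]
    by (simp add: uea_E_def Rep_mat_index_inverse)
  then show ?thesis
    unfolding uea_of_def sum mult scalar
    by (intro universal_ring_sum universal_ring.times const_in_universal_ring)
qed

end

section \<open>The module of local distributions\<close>

text \<open>
  Writing \<open>D = ev\<^sub>v \<circ> A\<close>, all module axioms become identities in the universal ring: the action of \<open>X\<close>
  replaces \<open>A\<close> by \<open>A \<Phi>(X)\<close>. In the bracket axiom the order of the factors matches because \<open>\<Phi>\<close> reverses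
  products of the skew group ring.
\<close>

theorem theorem2:
  fixes a b :: "'n::finite tab_index"
    and x0 v :: "'n tab"
    and W :: "'n tab set"
    and \<Phi> :: "'n uea \<Rightarrow> 'n skew_ring"
  assumes "CARD('n) \<ge> 2"
    and "one_singular a b x0"
    and "v \<in> gimel_orbit x0"
    and "z1 a b v = 0"
    and "admissible_nbhd a b v W"
    and "gelfand_tsetlin_hom \<Phi>"
  shows "gl_module (distribution_space a b v W) (gl_act v W \<Phi>) \<and>
    (\<forall>D\<in>distribution_space a b v W.
      (\<exists>A\<in>universal_ring a b v W. D = dcomp v W (ev v W) A) \<and>
      (\<forall>A\<in>universal_ring a b v W. \<forall>X. D = dcomp v W (ev v W) A \<longrightarrow>
        A * \<Phi> (uea_of X) \<in> universal_ring a b v W \<and>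
        (\<forall>I h. finite I \<and> A * \<Phi> (uea_of X) = (\<Sum>\<sigma>\<in>I. fn (h \<sigma>) * grp \<sigma>) \<longrightarrow>
          gl_act v W \<Phi> X D = dcomp v W (ev v W) (\<Sum>\<sigma>\<in>I. fn (h \<sigma>) * grp \<sigma>) \<and>
          dcomp v W (ev v W) (\<Sum>\<sigma>\<in>I. fn (h \<sigma>) * grp \<sigma>) =
            (\<Sum>\<sigma>\<in>I. fscale (mero_value (mero_of (z1 a b) * h \<sigma>) v) (D2 a b v W \<sigma>)) +
            (\<Sum>\<sigma>\<in>I. fscale (deriv_z1 a b (mero_of (z1 a b) * h \<sigma>) v) (D1 a b v W \<sigma>)))))"
proof -
  interpret one_singular_point a b v W
    using assms(2,4,5) by unfold_locales (simp_all add: one_singular_def)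
  let ?R = "universal_ring a b v W" and ?ev = "dcomp v W (ev v W)" and ?\<Phi> = "\<lambda>X. \<Phi> (uea_of X)"
  have add: "\<Phi> (x + y) = \<Phi> x + \<Phi> y" and mult: "\<Phi> (x * y) = \<Phi> y * \<Phi> x"
    and scalar: "\<Phi> (uea_scalar c) = fn (mero_of (\<lambda>x. c))" for x y c
    using assms(6) by (auto simp: gelfand_tsetlin_hom_def star_def)
  have diff: "\<Phi> (x - y) = \<Phi> x - \<Phi> y" for x y using add[of "x - y" y] by simp
  note R = gelfand_tsetlin_in_universal_ring[OF assms(6)]
  note RR = universal_ring.times[OF _ R]
  have act: "gl_act v W \<Phi> X (?ev A) = ?ev (A * ?\<Phi> X)" if "A \<in> ?R" for A X
    unfolding gl_act_def by (rule dcomp_dcomp_ev[OF that R])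
  have formula: "gl_act v W \<Phi> X (?ev A) = ?ev (\<Sum>\<sigma>\<in>I. fn (h \<sigma>) * grp \<sigma>) \<and>
      ?ev (\<Sum>\<sigma>\<in>I. fn (h \<sigma>) * grp \<sigma>) =
        (\<Sum>\<sigma>\<in>I. fscale (mero_value (mero_of (z1 a b) * h \<sigma>) v) (D2 a b v W \<sigma>)) +
        (\<Sum>\<sigma>\<in>I. fscale (deriv_z1 a b (mero_of (z1 a b) * h \<sigma>) v) (D1 a b v W \<sigma>))"
    if A: "A \<in> ?R" and I: "finite I" and e: "A * ?\<Phi> X = (\<Sum>\<sigma>\<in>I. fn (h \<sigma>) * grp \<sigma>)" for A X I h
  proof
    show "gl_act v W \<Phi> X (?ev A) = ?ev (\<Sum>\<sigma>\<in>I. fn (h \<sigma>) * grp \<sigma>)" unfolding act[OF A] e ..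
    let ?B = "\<Sum>\<sigma>\<in>I. fn (h \<sigma>) * grp \<sigma>"
    have "?B \<in> ?R" using RR[OF A, of X] by (simp add: e)
    moreover have c: "coeff ?B \<sigma> = (if \<sigma> \<in> I then h \<sigma> else 0)" for \<sigma>
      by (rule coeff_monomial_sum[OF I])
    moreover have "supp ?B \<subseteq> I" by (auto simp: supp_iff c split: if_splits)
    ultimately show "?ev ?B =
        (\<Sum>\<sigma>\<in>I. fscale (mero_value (mero_of (z1 a b) * h \<sigma>) v) (D2 a b v W \<sigma>)) +
        (\<Sum>\<sigma>\<in>I. fscale (deriv_z1 a b (mero_of (z1 a b) * h \<sigma>) v) (D1 a b v W \<sigma>))"
      using ev_formula[of ?B I] I by simp
  qed
  have "gl_module S (gl_act v W \<Phi>)"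
    unfolding gl_module_def
  proof (intro conjI allI ballI)
    show "functional.subspace S"
      unfolding distribution_space_def by (rule functional.subspace_span)
  next
    fix X D D' c
    show "gl_act v W \<Phi> X (D + D') = gl_act v W \<Phi> X D + gl_act v W \<Phi> X D'"
      by (simp add: gl_act_def dcomp_def fun_eq_iff)
    show "gl_act v W \<Phi> X (fscale c D) = fscale c (gl_act v W \<Phi> X D)"
      by (simp add: gl_act_def dcomp_def fun_eq_iff fscale_def)
  next
    fix X Y D c assume "D \<in> S"
    then obtain A where A: "A \<in> ?R" and D: "D = ?ev A" using distribution_space_ev by blast
    note AX = RR[OF A]
    show "gl_act v W \<Phi> X D \<in> S" unfolding D act[OF A] by (rule dcomp_ev_in_S[OF AX])
    show "gl_act v W \<Phi> (X + Y) D = gl_act v W \<Phi> X D + gl_act v W \<Phi> Y D"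
      unfolding D act[OF A] uea_of_add add distrib_left by (rule dcomp_ev_add[OF AX AX])
    show "gl_act v W \<Phi> (mat c ** X) D = fscale c (gl_act v W \<Phi> X D)"
      unfolding D act[OF A] uea_of_scale mult scalar mult.assoc[symmetric] by (rule dcomp_ev_scale[OF AX])
    show "gl_act v W \<Phi> (X ** Y - Y ** X) D =
        gl_act v W \<Phi> X (gl_act v W \<Phi> Y D) - gl_act v W \<Phi> Y (gl_act v W \<Phi> X D)"
      unfolding D act[OF A] act[OF AX] uea_of_bracket diff mult right_diff_distrib mult.assoc[symmetric]
      by (rule dcomp_ev_diff[OF RR[OF AX] RR[OF AX]])
  qed
  then show ?thesis using distribution_space_ev RR formula by blast
qed

end
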